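(* Every doubly entire, infinitely supported $X\in U_{\ge0}$ can be factorized as $X=AYB$, where $A\in\mathbb{L}_r$, $B\in\mathbb{L}_l$ and $Y\in U_{\ge0}$ is regular.
   Context: Fix $n\ge1$. $GL_n(\mathbb{R}((t)))$ is the group of $n\times n$ matrices $A(t)=(a_{ij}(t))$ over the field of formal Laurent series with non-zero determinant. $A(t)$ is identified with its unfolding $X=(x_{i,j})_{i,j\in\mathbb{Z}}$, the doubly infinite real matrix with $x_{i+n,j+n}=x_{i,j}$ and $a_{ij}(t)=\sum_{k\in\mathbb{Z}}x_{i,j+kn}t^k$ for $1\le i,j\le n$; $A(t)$ is called the folding of $X$. $X$ is totally nonnegative if all finite minors of $X$ are nonnegative. $U$ is the subgroup of matrices $X$ that are upper triangular with $1$'s on the diagonal, and $U_{\ge0}$ is the set of totally nonnegative elements of $U$. $X\in U_{\ge 0}$ is finitely supported if only finitely many of its diagonals $j-i=\text{constant}$ are non-zero, and infinitely supported otherwise. $X$ is entire if all entries of its folding are entire functions of $t$, and doubly entire if both $X$ and $X^{-1}$ are entire. For infinitely supported $X\in U_{\ge0}$ (for which all entries above the diagonal are non-zero) put $$\epsilon_i(X)=\lim_{j\to\infty}\frac{x_{i,j}}{x_{i+1,j}},\qquad \mu_i(X)=\lim_{j\to-\infty}\frac{x_{j,i+1}}{x_{j,i}};$$ these limits exist. $X\in U_{\ge0}$ is regular if it is either the identity matrix, or doubly entire, infinitely supported, and $\epsilon_i(X)=\mu_i(X)=0$ for every $i$. For $a\ge0$, the Chevalley generator $e_k(a)=(x_{i,j})$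 has $x_{i,i}=1$, $x_{i,i+1}=a$ if $i\equiv k\pmod n$, and other entries $0$ (when $n=1$ there are no Chevalley generators). Limits of matrices are entrywise; $\prod_{i=1}^\infty X^{(i)}=\lim_{k\to\infty}X^{(1)}\cdots X^{(k)}$ and $\prod_{i=-\infty}^{-1}X^{(i)}=\lim_{k\to-\infty}X^{(k)}X^{(k+1)}\cdots X^{(-1)}$. A subsemigroup $\Sigma\subset U$ is a right (resp. left) limit semigroup if whenever a right-infinite product $\prod_{i=1}^\infty X^{(i)}$ (resp. left-infinite product $\prod_{i=-\infty}^{-1}X^{(i)}$) of elements of $\Sigma$ exists, it lies in $\Sigma$. $\mathbb{L}_r$ (resp. $\mathbb{L}_l$) is the smallest right (resp. left) limit semigroup contained in $U_{\ge0}$ and containing the identity and all $e_i(a)$, $a\ge0$. *)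

theory Defs
  imports
    "HOL-Complex_Analysis.Complex_Analysis"
    "HOL-Number_Theory.Cong"
    "Jordan_Normal_Form.Determinant"
begin

section \<open>The loop group and unfoldings\<close>

definition loop_GL :: "nat \<Rightarrow> real fls mat set" where
  "loop_GL n = {A \<in> carrier_mat n n. Determinant.det A \<noteq> 0}"

text \<open>
  Matrices in \<open>carrier_mat n n\<close> are indexed from 0, while rows and columns of the folding
  are numbered \<open>1, \<dots>, n\<close>: the series \<open>a\<^sub>i\<^sub>j(t)\<close> is the entry at \<open>(i - 1, j - 1)\<close>.
  Its coefficient at \<open>t^k\<close> is \<open>x\<^sub>i\<^sub>,\<^sub>j\<^sub>+\<^sub>k\<^sub>n\<close>. Thus, for arbitrary integers \<open>i\<close>, \<open>j\<close>, the entry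
  \<open>x\<^sub>i\<^sub>,\<^sub>j\<close> is found by reducing both indices to the range \<open>1, \<dots>, n\<close>.
\<close>

definition unfolding_mat :: "nat \<Rightarrow> real fls mat \<Rightarrow> int \<Rightarrow> int \<Rightarrow> real" where
  "unfolding_mat n A i j =
     fls_nth (index_mat A (nat ((i - 1) mod int n), nat ((j - 1) mod int n)))
             ((j - 1) div int n - (i - 1) div int n)"

definition folding_mat :: "nat \<Rightarrow> (int \<Rightarrow> int \<Rightarrow> real) \<Rightarrow> real fls mat" where
  "folding_mat n x =
     Matrix.mat n n (\<lambda>(i, j). Abs_fls (\<lambda>k. x (int i + 1) (int j + 1 + k * int n)))"

lemma unfolding_mat_periodic:
  assumes "n \<ge> 1"
  shows "unfolding_mat n A (i + int n) (j + int n) = unfolding_mat n A i j"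
proof -
  have *: "i + int n - 1 = (i - 1) + int n" "j + int n - 1 = (j - 1) + int n" by auto
  show ?thesis
    using assms unfolding unfolding_mat_def * by simp
qed

lemma unfolding_mat_coeff:
  assumes "i < n" "j < n"
  shows "unfolding_mat n A (int i + 1) (int j + 1 + k * int n) = fls_nth (index_mat A (i, j)) k"
proof -
  have *: "int j + 1 + k * int n - 1 = int j + k * int n" by simp
  show ?thesis using assms unfolding unfolding_mat_def * by simp
qed

lemma folding_unfolding_mat:
  assumes "A \<in> carrier_mat n n"
  shows "folding_mat n (unfolding_mat n A) = A"
  using assms
  by (intro eq_matI) (auto simp: folding_mat_def unfolding_mat_coeff fls_nth_inverse)

lemma unfolding_folding_mat:
  assumes n: "n \<ge> 1"
    and periodic: "\<And>i j. x (i + int n) (j + int n) = x i j"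
    and lower: "\<And>i. \<exists>N. \<forall>j<N. x i j = 0"
  shows "unfolding_mat n (folding_mat n x) = x"
proof (intro ext)
  fix i j :: int
  define r q s p where "r = (i - 1) mod int n" and "q = (i - 1) div int n"
    and "s = (j - 1) mod int n" and "p = (j - 1) div int n"
  have rs: "0 \<le> r" "r < int n" "0 \<le> s" "s < int n" using n by (auto simp: r_def s_def)
  have i: "i = r + 1 + q * int n" and j: "j = s + 1 + p * int n"
    by (auto simp: r_def q_def s_def p_def algebra_simps)
  have shift_nat: "x (a + int m * int n) (b + int m * int n) = x a b" for a b m
  proof (induction m)
    case (Suc m)
    then show ?case
      using periodic[of "a + int m * int n" "b + int m * int n"] by (simp add: algebra_simps)
  qed simp
  have shift: "x (a + m * int n) (b + m * int n) = x a b" for a b m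
  proof (cases "m \<ge> 0")
    case True
    then show ?thesis using shift_nat[of a "nat m" b] by simp
  next
    case False
    then show ?thesis
      using shift_nat[of "a + m * int n" "nat (- m)" "b + m * int n"] by simp
  qed
  obtain N where N: "\<And>j. j < N \<Longrightarrow> x (r + 1) j = 0" using lower by blast
  have vanish: "\<forall>k < - \<bar>N\<bar> - int n. x (r + 1) (s + 1 + k * int n) = 0"
  proof (intro allI impI N)
    fix k assume k: "k < - \<bar>N\<bar> - int n"
    hence "k * int n \<le> k * 1" using n by (intro mult_left_mono_neg) auto
    thus "s + 1 + k * int n < N" using k rs by linarith
  qed
  have "unfolding_mat n (folding_mat n x) i j
      = fls_nth (Abs_fls (\<lambda>k. x (r + 1) (s + 1 + k * int n))) (p - q)"
    using rs unfolding unfolding_mat_def folding_mat_def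
      r_def[symmetric] s_def[symmetric] p_def[symmetric] q_def[symmetric]
    by (simp add: nat_less_iff)
  also have "\<dots> = x (r + 1) (s + 1 + (p - q) * int n)"
    using nth_Abs_fls_lower_bound[OF vanish] by simp
  also have "\<dots> = x i j"
    using shift[of "r + 1" q "s + 1 + (p - q) * int n"] by (simp add: i j algebra_simps)
  finally show "unfolding_mat n (folding_mat n x) i j = x i j" .
qed


section \<open>Total nonnegativity and unipotent matrices\<close>

definition totally_nonneg :: "(int \<Rightarrow> int \<Rightarrow> real) \<Rightarrow> bool" where
  "totally_nonneg x \<longleftrightarrow>
     (\<forall>(m::nat) (r::nat \<Rightarrow> int) (c::nat \<Rightarrow> int).
        strict_mono_on {..<m} r \<longrightarrow> strict_mono_on {..<m} c \<longrightarrow>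
        Determinant.det (Matrix.mat m m (\<lambda>(a, b). x (r a) (c b))) \<ge> 0)"

definition loop_U :: "nat \<Rightarrow> real fls mat set" where
  "loop_U n = {A \<in> loop_GL n. (\<forall>i j. j < i \<longrightarrow> unfolding_mat n A i j = 0) \<and>
                              (\<forall>i. unfolding_mat n A i i = 1)}"

definition loop_U_nonneg :: "nat \<Rightarrow> real fls mat set" where
  "loop_U_nonneg n = {A \<in> loop_U n. totally_nonneg (unfolding_mat n A)}"

definition finitely_supported :: "nat \<Rightarrow> real fls mat \<Rightarrow> bool" where
  "finitely_supported n A \<longleftrightarrow> finite {d::int. \<exists>i. unfolding_mat n A i (i + d) \<noteq> 0}"

definition infinitely_supported :: "nat \<Rightarrow> real fls mat \<Rightarrow> bool" where
  "infinitely_supported n A \<longleftrightarrow> \<not> finitely_supported n A"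


section \<open>Entire and regular matrices\<close>

definition entire_fls :: "real fls \<Rightarrow> bool" where
  "entire_fls a \<longleftrightarrow>
     (\<exists>f. f holomorphic_on UNIV \<and>
          f has_laurent_expansion Abs_fls (\<lambda>k. complex_of_real (fls_nth a k)))"

definition entire_mat :: "nat \<Rightarrow> real fls mat \<Rightarrow> bool" where
  "entire_mat n A \<longleftrightarrow> (\<forall>i<n. \<forall>j<n. entire_fls (index_mat A (i, j)))"

definition doubly_entire :: "nat \<Rightarrow> real fls mat \<Rightarrow> bool" where
  "doubly_entire n A \<longleftrightarrow> entire_mat n A \<and>
     (\<exists>B \<in> carrier_mat n n. inverts_mat A B \<and> inverts_mat B A \<and> entire_mat n B)"

text \<open>
  The next two predicates say that the limits defining \<open>\<epsilon>\<^sub>i\<close> and \<open>\<mu>\<^sub>i\<close> exist and have the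
  given value. They are meant for infinitely supported totally nonnegative matrices, for which
  the denominators are eventually non-zero.
\<close>

definition has_epsilon :: "nat \<Rightarrow> real fls mat \<Rightarrow> int \<Rightarrow> real \<Rightarrow> bool" where
  "has_epsilon n A i e \<longleftrightarrow>
     ((\<lambda>j. unfolding_mat n A i j / unfolding_mat n A (i + 1) j) \<longlongrightarrow> e) at_top"

definition has_mu :: "nat \<Rightarrow> real fls mat \<Rightarrow> int \<Rightarrow> real \<Rightarrow> bool" where
  "has_mu n A i m \<longleftrightarrow>
     ((\<lambda>j. unfolding_mat n A j (i + 1) / unfolding_mat n A j i) \<longlongrightarrow> m) at_bot"

definition regular_mat :: "nat \<Rightarrow> real fls mat \<Rightarrow> bool" where
  "regular_mat n A \<longleftrightarrow> A \<in> loop_U_nonneg n \<and>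
     (A = 1\<^sub>m n \<or>
      doubly_entire n A \<and> infinitely_supported n A \<and>
      (\<forall>i. has_epsilon n A i 0 \<and> has_mu n A i 0))"


section \<open>Chevalley generators and limit semigroups\<close>

definition chevalley :: "nat \<Rightarrow> int \<Rightarrow> real \<Rightarrow> real fls mat" where
  "chevalley n k a = folding_mat n (\<lambda>i j.
     if i = j then 1 else if j = i + 1 \<and> [i = k] (mod int n) then a else 0)"

text \<open>For \<open>n = 1\<close> there are no generators.\<close>

definition chevalley_gens :: "nat \<Rightarrow> real fls mat set" where
  "chevalley_gens n = {chevalley n k a | k a. n \<ge> 2 \<and> a \<ge> 0}"

definition converges_to :: "nat \<Rightarrow> (nat \<Rightarrow> real fls mat) \<Rightarrow> real fls mat \<Rightarrow> bool" where
  "converges_to n P A \<longleftrightarrow>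
     (\<forall>i j. (\<lambda>m. unfolding_mat n (P m) i j) \<longlonglongrightarrow> unfolding_mat n A i j)"

text \<open>
  A right-infinite sequence \<open>X\<^sup>(\<^sup>1\<^sup>), X\<^sup>(\<^sup>2\<^sup>), \<dots>\<close> is given as \<open>X 0, X 1, \<dots>\<close>; a left-infinite
  sequence \<open>\<dots>, X\<^sup>(\<^sup>-\<^sup>2\<^sup>), X\<^sup>(\<^sup>-\<^sup>1\<^sup>)\<close> is given as \<open>\<dots>, X 1, X 0\<close>.
\<close>

fun right_partial_prod :: "nat \<Rightarrow> (nat \<Rightarrow> real fls mat) \<Rightarrow> nat \<Rightarrow> real fls mat" where
  "right_partial_prod n X 0 = 1\<^sub>m n"
| "right_partial_prod n X (Suc m) = right_partial_prod n X m * X m"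

fun left_partial_prod :: "nat \<Rightarrow> (nat \<Rightarrow> real fls mat) \<Rightarrow> nat \<Rightarrow> real fls mat" where
  "left_partial_prod n X 0 = 1\<^sub>m n"
| "left_partial_prod n X (Suc m) = X m * left_partial_prod n X m"

definition U_subsemigroup :: "nat \<Rightarrow> real fls mat set \<Rightarrow> bool" where
  "U_subsemigroup n S \<longleftrightarrow> S \<subseteq> loop_U n \<and> (\<forall>A\<in>S. \<forall>B\<in>S. A * B \<in> S)"

text \<open>
  An entrywise limit of elements of \<open>loop_U n\<close> is again (the unfolding of) an element of
  \<open>loop_U n\<close>, so it is enough to let the limits below range over \<open>loop_U n\<close>.
\<close>

definition right_limit_semigroup :: "nat \<Rightarrow> real fls mat set \<Rightarrow> bool" where
  "right_limit_semigroup n S \<longleftrightarrow> U_subsemigroup n S \<and>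
     (\<forall>X. \<forall>A \<in> loop_U n. (\<forall>m. X m \<in> S) \<longrightarrow>
        converges_to n (right_partial_prod n X) A \<longrightarrow> A \<in> S)"

definition left_limit_semigroup :: "nat \<Rightarrow> real fls mat set \<Rightarrow> bool" where
  "left_limit_semigroup n S \<longleftrightarrow> U_subsemigroup n S \<and>
     (\<forall>X. \<forall>A \<in> loop_U n. (\<forall>m. X m \<in> S) \<longrightarrow>
        converges_to n (left_partial_prod n X) A \<longrightarrow> A \<in> S)"

text \<open>
  All the closure conditions are stable under intersection, so the smallest limit semigroup
  is the intersection of the limit semigroups in question (\<open>loop_U_nonneg n\<close> is one of them).
\<close>

definition right_limit_L :: "nat \<Rightarrow> real fls mat set" where
  "right_limit_L n = \<Inter>{S. right_limit_semigroup n S \<and> S \<subseteq> loop_U_nonneg n \<and>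
                            insert (1\<^sub>m n) (chevalley_gens n) \<subseteq> S}"

definition left_limit_L :: "nat \<Rightarrow> real fls mat set" where
  "left_limit_L n = \<Inter>{S. left_limit_semigroup n S \<and> S \<subseteq> loop_U_nonneg n \<and>
                           insert (1\<^sub>m n) (chevalley_gens n) \<subseteq> S}"

end

theory Submission
  imports Defs
begin

text \<open>
  A matrix over Laurent series is handled through its unfolding, a periodic doubly infinite real
  matrix. The idea is to split off from the left a factor in \<open>L\<^sub>r\<close> that is as large as possible, then
  from the right a factor in \<open>L\<^sub>l\<close> that is as large as possible. What remains is regular, because
  from a doubly entire matrix that is not regular a Chevalley generator can still be split off.

  \<^emph>\<open>Maximal factors.\<close> The sum of the superdiagonal entries over one period (\<open>weight\<close>) is additive
  under products. Factors are chosen greedily, each having at least half of the weight that is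
  possible at its stage. The partial products increase and are bounded entrywise by the given
  matrix, so they converge; since \<open>L\<^sub>r\<close> is closed under right-infinite products, it contains the
  limit. The weights of the factors are summable and tend to 0, so the remainder in the
  limit admits no further generator (\<open>maximal_left_factor\<close>).

  \<^emph>\<open>When a generator splits off.\<close> Multiplication by \<open>e\<^sub>i(-c)\<close> subtracts \<open>c\<close> times row \<open>i + 1\<close> from
  row \<open>i\<close>. By Whitney's reduction (\<open>minor_row_shift_nonneg\<close>) this preserves total nonnegativity once
  it does so for the minors with last row \<open>i\<close>. Those are controlled by adding row \<open>i + 1\<close> and a
  column far to the right and expanding along that column (\<open>row_op_minor_limit\<close>). If all entries above
  the diagonal are positive, this allows \<open>c = \<epsilon>\<^sub>i\<close> whenever \<open>\<epsilon>\<^sub>i\<^sub>-\<^sub>1 = 0\<close>. Not all \<open>\<epsilon>\<^sub>i\<close> are positive, for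
  then the entries would decay at most geometrically away from the diagonal, and the matrix would
  not be entire;
  so if some \<open>\<epsilon>\<^sub>i\<close> is positive, there is by periodicity also one with \<open>\<epsilon>\<^sub>i\<^sub>-\<^sub>1 = 0 < \<epsilon>\<^sub>i\<close>. If some entry above
  the diagonal vanishes, every row has finite support and the last nonzero entries of the rows form
  a staircase. A corner of the staircase yields a factor in the same way. A staircase without
  corners is a diagonal; if it is not the main one, the entries of the inverse satisfy a
  linear recursion that prevents them from decaying faster than geometrically, so the inverse is
  not entire.

  \<^emph>\<open>Putting both sides together.\<close> Reflection in the antidiagonal reverses products and exchanges
  left with right and \<open>\<epsilon>\<close> with \<open>\<mu>\<close>, so only left factors need to be studied. The inverse of a
  totally nonnegative unipotent matrix has alternating signs; hence a factor and its inverse are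
  dominated entrywise by the product and its inverse, and the remainders stay doubly entire
  (\<open>doubly_rapid_factor\<close>). Splitting off the right factor does not create new left factors, because
  multiplication by elements of the limit semigroups preserves total nonnegativity
  (\<open>right_limit_preserver\<close>): the matrices with this property form a limit semigroup themselves.
\<close>

section \<open>Minors of doubly infinite matrices\<close>

definition sq_det :: "nat \<Rightarrow> (nat \<Rightarrow> nat \<Rightarrow> real) \<Rightarrow> real" where
  "sq_det m f = Determinant.det (Matrix.mat m m (\<lambda>(a, b). f a b))"

abbreviation sq_mat :: "nat \<Rightarrow> (nat \<Rightarrow> nat \<Rightarrow> real) \<Rightarrow> real mat" where
  "sq_mat m f \<equiv> Matrix.mat m m (\<lambda>(a, b). f a b)"

definition minor :: "(int \<Rightarrow> int \<Rightarrow> real) \<Rightarrow> nat \<Rightarrow> (nat \<Rightarrow> int) \<Rightarrow> (nat \<Rightarrow> int) \<Rightarrow> real" where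
  "minor x m r c = sq_det m (\<lambda>a b. x (r a) (c b))"

lemma sq_det_cong:
  assumes "\<And>a b. a < m \<Longrightarrow> b < m \<Longrightarrow> f a b = g a b"
  shows "sq_det m f = sq_det m g"
  unfolding sq_det_def by (rule arg_cong[where f = Determinant.det]) (rule eq_matI, use assms in auto)

lemma minor_cong:
  assumes "\<And>a b. a < m \<Longrightarrow> b < m \<Longrightarrow> x (r a) (c b) = y (s a) (d b)"
  shows "minor x m r c = minor y m s d"
  unfolding minor_def by (rule sq_det_cong) (use assms in auto)

lemma totally_nonneg_minor:
  "totally_nonneg x \<longleftrightarrow> (\<forall>m r c. strict_mono_on {..<m} r \<longrightarrow> strict_mono_on {..<m} c \<longrightarrow> minor x m r c \<ge> 0)"
  by (simp add: totally_nonneg_def minor_def sq_det_def)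

lemma sq_det_row_expand:
  assumes "p < m"
  shows "sq_det m (f(p := w)) = (\<Sum>b<m. w b * cofactor (sq_mat m f) p b)"
proof -
  have "sq_det m (f(p := w)) = (\<Sum>b<m. sq_mat m (f(p := w)) $$ (p, b) * cofactor (sq_mat m (f(p := w))) p b)"
    unfolding sq_det_def by (rule laplace_expansion_row) (use assms in auto)
  also have "\<dots> = (\<Sum>b<m. w b * cofactor (sq_mat m f) p b)"
  proof (rule sum.cong)
    fix b assume b: "b \<in> {..<m}"
    have "mat_delete (sq_mat m (f(p := w))) p b = mat_delete (sq_mat m f) p b"
      unfolding mat_delete_def using assms b by (auto intro!: eq_matI)
    thus "sq_mat m (f(p := w)) $$ (p, b) * cofactor (sq_mat m (f(p := w))) p b = w b * cofactor (sq_mat m f) p b"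
      using assms b by (simp add: cofactor_def)
  qed simp
  finally show ?thesis .
qed

lemma sq_det_row_expand':
  assumes "p < m"
  shows "sq_det m f = (\<Sum>b<m. f p b * cofactor (sq_mat m f) p b)"
  using sq_det_row_expand[OF assms, of f "f p"] by simp

lemma sq_det_row_add:
  assumes "p < m"
  shows "sq_det m (f(p := \<lambda>b. u b + e * v b)) = sq_det m (f(p := u)) + e * sq_det m (f(p := v))"
  unfolding sq_det_row_expand[OF assms]
  by (simp add: algebra_simps sum.distrib sum_distrib_left)

lemma sq_det_row_sum:
  assumes "p < m"
  shows "sq_det m (f(p := \<lambda>b. \<Sum>q\<in>S. e q * v q b)) = (\<Sum>q\<in>S. e q * sq_det m (f(p := v q)))"
  unfolding sq_det_row_expand[OF assms] sum_distrib_left sum_distrib_right mult.assoc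
  by (rule sum.swap)

lemma sq_det_identical_rows:
  assumes "p < m" "q < m" "p \<noteq> q" "\<And>b. b < m \<Longrightarrow> f p b = f q b"
  shows "sq_det m f = 0"
  unfolding sq_det_def
  by (rule det_identical_rows[of _ m p q]) (use assms in \<open>auto intro!: eq_vecI\<close>)

lemma sq_det_swap_rows:
  assumes "p < m" "q < m" "p \<noteq> q"
  shows "sq_det m (f(p := f q, q := f p)) = - sq_det m f"
proof -
  have "sq_mat m (f(p := f q, q := f p)) = swaprows p q (sq_mat m f)"
    using assms by (intro eq_matI) auto
  thus ?thesis unfolding sq_det_def using det_swaprows[of p m q "sq_mat m f"] assms
    by (simp del: fun_upd_apply)
qed

text \<open>
  Cramer's rule, obtained by multiplying \<open>adj(N) N = det(N) 1\<close> from the left by the row \<open>w\<close>. It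
  expresses an additional row by the rows of \<open>N\<close>, with determinants as coefficients.
\<close>

lemma sq_det_cramer:
  assumes "b < m"
  shows "sq_det m f * w b = (\<Sum>q<m. sq_det m (f(q := w)) * f q b)"
proof -
  let ?N = "sq_mat m f"
  have adj: "adj_mat ?N \<in> carrier_mat m m" "adj_mat ?N * ?N = Determinant.det ?N \<cdot>\<^sub>m 1\<^sub>m m"
    using adj_mat[of ?N m] by auto
  have ent: "(\<Sum>q<m. adj_mat ?N $$ (l, q) * f q b) = (if l = b then sq_det m f else 0)" if "l < m" for l
  proof -
    have "(adj_mat ?N * ?N) $$ (l, b) = (\<Sum>q<m. adj_mat ?N $$ (l, q) * f q b)"
      using adj(1) assms that by (simp add: scalar_prod_def atLeast0LessThan)
    thus ?thesis using assms that by (auto simp: adj(2) sq_det_def split: if_splits)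
  qed
  have "(\<Sum>q<m. sq_det m (f(q := w)) * f q b) = (\<Sum>q<m. (\<Sum>l<m. w l * cofactor ?N q l) * f q b)"
    by (intro sum.cong refl) (simp add: sq_det_row_expand)
  also have "\<dots> = (\<Sum>l<m. \<Sum>q<m. w l * (cofactor ?N q l * f q b))"
    unfolding sum_distrib_right mult.assoc by (rule sum.swap)
  also have "\<dots> = (\<Sum>l<m. w l * (\<Sum>q<m. adj_mat ?N $$ (l, q) * f q b))"
    unfolding sum_distrib_left by (intro sum.cong refl) (simp add: adj_mat_def)
  also have "\<dots> = (\<Sum>l<m. if l = b then w l * sq_det m f else 0)"
    by (intro sum.cong refl) (simp add: ent)
  also have "\<dots> = sq_det m f * w b" using assms by simp
  finally show ?thesis by simp
qed

text \<open>
  The increasing enumeration of the indices different from \<open>p\<close>, as used in cofactors.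
\<close>

definition skip :: "nat \<Rightarrow> nat \<Rightarrow> nat" where
  "skip p a = (if a < p then a else Suc a)"

lemma cofactor_sq_mat:
  assumes "p < Suc m" "d < Suc m"
  shows "cofactor (sq_mat (Suc m) f) p d = (-1) ^ (p + d) * sq_det m (\<lambda>a b. f (skip p a) (skip d b))"
proof -
  have "mat_delete (sq_mat (Suc m) f) p d = sq_mat m (\<lambda>a b. f (skip p a) (skip d b))"
    using assms unfolding mat_delete_def skip_def by (auto intro!: eq_matI)
  thus ?thesis by (simp add: cofactor_def sq_det_def)
qed

lemma strict_mono_on_skip:
  fixes r :: "nat \<Rightarrow> int"
  assumes "strict_mono_on {..<Suc m} r"
  shows "strict_mono_on {..<m} (\<lambda>a. r (skip p a))"
  using assms by (auto simp: strict_mono_on_def skip_def)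

section \<open>Whitney's reduction of totally nonnegative matrices\<close>

text \<open>
  The effect of adding \<open>e\<close> times row \<open>i + 1\<close> to row \<open>i\<close> on the minors in which \<open>i\<close> is the last row.
  For negative \<open>e\<close> this is the part of total nonnegativity that has to be checked by hand; the
  remaining minors follow by Whitney's argument below.
\<close>

definition last_row_op_nonneg :: "(int \<Rightarrow> int \<Rightarrow> real) \<Rightarrow> int \<Rightarrow> real \<Rightarrow> bool" where
  "last_row_op_nonneg x i e \<longleftrightarrow>
     (\<forall>p r c. strict_mono_on {..<Suc p} r \<longrightarrow> strict_mono_on {..<Suc p} c \<longrightarrow> r p = i \<longrightarrow>
        minor x (Suc p) r c + e * minor x (Suc p) (r(p := i + 1)) c \<ge> 0)"

text \<open>
  Induction on the number \<open>k\<close> of rows after row \<open>i\<close>. Let \<open>t\<close> be the row that follows \<open>i\<close>, and \<open>N\<close> the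
  minor with \<open>i + 1\<close> in place of \<open>i\<close>. If \<open>det N = 0\<close> the claim is plain nonnegativity. Otherwise
  some minor \<open>N'\<close> of \<open>N\<close> without row \<open>t\<close> and without one column is nonzero, and a three-term Pluecker
  relation reads
  \<open>det N \<sqdot> N'(i) = minor(i) \<sqdot> N' - minor(i, i + 1) \<sqdot> N'(t)\<close>,
  where an argument names the rows that take the place of row \<open>i + 1\<close> (or of rows \<open>i + 1\<close> and \<open>t\<close>).
  All minors here are nonnegative, so the quotient \<open>minor(i) / det N\<close> is at least \<open>N'(i) / N'\<close>, to
  which the induction hypothesis applies.
\<close>

lemma minor_row_shift_nonneg:
  assumes tnn: "totally_nonneg x"
    and base: "last_row_op_nonneg x i e"
  shows "strict_mono_on {..<Suc p + k} r \<Longrightarrow> strict_mono_on {..<Suc p + k} c \<Longrightarrow> r p = i \<Longrightarrow>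
         (\<And>q. p < q \<Longrightarrow> q < Suc p + k \<Longrightarrow> i + 1 < r q) \<Longrightarrow>
         minor x (Suc p + k) r c + e * minor x (Suc p + k) (r(p := i + 1)) c \<ge> 0"
proof (induction k arbitrary: r c)
  case 0
  then show ?case using base unfolding last_row_op_nonneg_def by (simp del: fun_upd_apply)
next
  case (Suc k)
  define m where "m = Suc p + k"
  define s where "s = r(p := i + 1)"
  define N where "N = (\<lambda>a b. x (s a) (c b))"
  define w where "w = (\<lambda>b. x i (c b))"
  have r: "r a < r b" if "a < b" "b < Suc m" for a b
    using Suc.prems(1) that by (auto simp: strict_mono_on_def m_def)
  have pm: "p < m" by (simp add: m_def)
  have gap: "i + 1 < r q" if "p < q" "q < Suc m" for q using Suc.prems(4) that by (simp add: m_def)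
  have s_mono: "strict_mono_on {..<Suc m} s"
    unfolding strict_mono_on_def
  proof safe
    fix a b assume ab: "a < Suc m" "b < Suc m" "a < b"
    consider "a = p" | "b = p" | "a \<noteq> p" "b \<noteq> p" by blast
    thus "s a < s b"
    proof cases
      case 1 thus ?thesis using gap[of b] ab by (simp add: s_def)
    next
      case 2 thus ?thesis using r[of a b] ab Suc.prems(3) by (simp add: s_def)
    next
      case 3 thus ?thesis using r[of a b] ab by (simp add: s_def)
    qed
  qed
  have c_mono: "strict_mono_on {..<Suc m} c" using Suc.prems(2) by (simp add: m_def)
  have r_mono: "strict_mono_on {..<Suc m} r" using Suc.prems(1) by (simp add: m_def)
  have nonneg: "minor x l u v \<ge> 0" if "strict_mono_on {..<l} u" "strict_mono_on {..<l} v" for l u v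
    using tnn that by (auto simp: totally_nonneg_minor)
  have detN: "minor x (Suc m) s c = sq_det (Suc m) N" by (simp add: minor_def N_def)
  show ?case
  proof (cases "sq_det (Suc m) N = 0")
    case True
    thus ?thesis using nonneg[OF r_mono c_mono] detN by (simp add: m_def s_def del: fun_upd_apply)
  next
    case False
    hence Npos: "sq_det (Suc m) N > 0" using nonneg[OF s_mono c_mono] detN by simp
    from False sq_det_row_expand'[of "Suc p" "Suc m" N] pm
    have "(\<Sum>b<Suc m. N (Suc p) b * cofactor (sq_mat (Suc m) N) (Suc p) b) \<noteq> 0" by simp
    then obtain d where d: "d < Suc m" "cofactor (sq_mat (Suc m) N) (Suc p) d \<noteq> 0"
      by (metis (no_types, lifting) lessThan_iff mult_zero_right sum.neutral)
    define c' where "c' = (\<lambda>b. c (skip d b))"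
    define s' where "s' = (\<lambda>a. s (skip (Suc p) a))"
    define r' where "r' = (\<lambda>a. r (skip (Suc p) a))"
    define N' where "N' = (\<lambda>a b. x (s' a) (c' b))"
    have c'_mono: "strict_mono_on {..<m} c'" unfolding c'_def by (rule strict_mono_on_skip[OF c_mono])
    have s'_mono: "strict_mono_on {..<m} s'" unfolding s'_def by (rule strict_mono_on_skip[OF s_mono])
    have r'_mono: "strict_mono_on {..<m} r'" unfolding r'_def by (rule strict_mono_on_skip[OF r_mono])
    have r's': "r'(p := i + 1) = s'" by (auto simp: r'_def s'_def s_def skip_def fun_eq_iff)
    have "sq_det m N' \<noteq> 0"
      using d cofactor_sq_mat[of "Suc p" m d N] pm by (simp add: N_def N'_def s'_def c'_def)
    moreover have "sq_det m N' \<ge> 0" using nonneg[OF s'_mono c'_mono] by (simp add: minor_def N'_def)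
    ultimately have N'pos: "sq_det m N' > 0" by simp
    have IH: "minor x m r' c' + e * minor x m (r'(p := i + 1)) c' \<ge> 0"
      unfolding m_def
    proof (rule Suc.IH)
      show "r' p = i" using Suc.prems(3) by (simp add: r'_def skip_def)
      show "i + 1 < r' q" if "p < q" "q < Suc p + k" for q
        using gap[of "Suc q"] that by (simp add: r'_def skip_def m_def)
    qed (use r'_mono c'_mono in \<open>simp_all add: m_def\<close>)
    have minor_s': "minor x m (r'(p := i + 1)) c' = sq_det m N'"
      by (simp add: minor_def N'_def r's')
    have minor_r': "minor x m r' c' = sq_det m (N'(p := \<lambda>b. w (skip d b)))"
      unfolding minor_def N'_def
      by (rule sq_det_cong) (use Suc.prems(3) in \<open>auto simp: w_def s'_def r'_def c'_def s_def skip_def\<close>)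
    have minor_r: "minor x (Suc m) r c = sq_det (Suc m) (N(p := w))"
      unfolding minor_def N_def
      by (rule sq_det_cong) (use Suc.prems(3) in \<open>auto simp: w_def s_def\<close>)
    \<comment> \<open>The Pluecker relation: expand row \<open>i\<close> by Cramer's rule and use linearity of \<open>N'\<close> in row \<open>p\<close>;
      only the rows \<open>p\<close> and \<open>p + 1\<close> of \<open>N\<close> do not already occur in \<open>N'\<close> elsewhere.\<close>
    have "sq_det (Suc m) N * minor x m r' c' = sq_det m (N'(p := \<lambda>b. \<Sum>q<Suc m. sq_det (Suc m) (N(q := w)) * N q (skip d b)))"
    proof -
      have "sq_det (Suc m) N * minor x m r' c' = sq_det m (N'(p := \<lambda>b. \<Sum>q\<in>{0::nat}. sq_det (Suc m) N * w (skip d b)))"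
        unfolding minor_r' using sq_det_row_sum[OF pm, of N' "\<lambda>_. sq_det (Suc m) N" "\<lambda>_ b. w (skip d b)" "{0::nat}"] by simp
      also have "\<dots> = sq_det m (N'(p := \<lambda>b. \<Sum>q<Suc m. sq_det (Suc m) (N(q := w)) * N q (skip d b)))"
      proof (rule sq_det_cong)
        fix a b assume "a < m" "b < m"
        hence "skip d b < Suc m" by (simp add: skip_def)
        from sq_det_cramer[OF this, of N w]
        show "(N'(p := \<lambda>b. \<Sum>q\<in>{0::nat}. sq_det (Suc m) N * w (skip d b))) a b =
          (N'(p := \<lambda>b. \<Sum>q<Suc m. sq_det (Suc m) (N(q := w)) * N q (skip d b))) a b"
          by simp
      qed
      finally show ?thesis .
    qed
    also have "\<dots> = (\<Sum>q<Suc m. sq_det (Suc m) (N(q := w)) * sq_det m (N'(p := \<lambda>b. N q (skip d b))))"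
      by (rule sq_det_row_sum[OF pm])
    also have "\<dots> = (\<Sum>q\<in>{p, Suc p}. sq_det (Suc m) (N(q := w)) * sq_det m (N'(p := \<lambda>b. N q (skip d b))))"
    proof (rule sum.mono_neutral_right)
      show "\<forall>q\<in>{..<Suc m} - {p, Suc p}. sq_det (Suc m) (N(q := w)) * sq_det m (N'(p := \<lambda>b. N q (skip d b))) = 0"
      proof
        fix q assume q: "q \<in> {..<Suc m} - {p, Suc p}"
        define q' where "q' = (if q < p then q else q - 1)"
        have q': "q' < m" "q' \<noteq> p" "skip (Suc p) q' = q" using q pm by (auto simp: q'_def skip_def)
        have "sq_det m (N'(p := \<lambda>b. N q (skip d b))) = 0"
          by (rule sq_det_identical_rows[of p m q']) (use pm q' in \<open>auto simp: N'_def N_def s'_def c'_def\<close>)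
        thus "sq_det (Suc m) (N(q := w)) * sq_det m (N'(p := \<lambda>b. N q (skip d b))) = 0" by simp
      qed
    qed (use pm in auto)
    also have "\<dots> = sq_det (Suc m) (N(p := w)) * sq_det m (N'(p := \<lambda>b. N p (skip d b)))
                 + sq_det (Suc m) (N(Suc p := w)) * sq_det m (N'(p := \<lambda>b. N (Suc p) (skip d b)))"
      by simp
    also have "N'(p := \<lambda>b. N p (skip d b)) = N'"
      by (auto simp: fun_eq_iff N'_def N_def s'_def c'_def skip_def)
    finally have eq: "sq_det (Suc m) N * minor x m r' c' = minor x (Suc m) r c * sq_det m N'
        + sq_det (Suc m) (N(Suc p := w)) * sq_det m (N'(p := \<lambda>b. N (Suc p) (skip d b)))"
      by (simp add: minor_r del: fun_upd_apply)
    have "sq_det (Suc m) (N(Suc p := w)) = - minor x (Suc m) (r(Suc p := i + 1)) c"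
    proof -
      have "minor x (Suc m) (r(Suc p := i + 1)) c
          = sq_det (Suc m) ((N(Suc p := w))(p := (N(Suc p := w)) (Suc p), Suc p := (N(Suc p := w)) p))"
        unfolding minor_def N_def
        by (rule sq_det_cong) (use Suc.prems(3) in \<open>auto simp: w_def s_def\<close>)
      thus ?thesis using sq_det_swap_rows[of p "Suc m" "Suc p" "N(Suc p := w)"] pm
        by (simp del: fun_upd_apply)
    qed
    moreover have "minor x (Suc m) (r(Suc p := i + 1)) c \<ge> 0"
    proof (rule nonneg[OF _ c_mono])
      show "strict_mono_on {..<Suc m} (r(Suc p := i + 1))"
        unfolding strict_mono_on_def
      proof safe
        fix a b assume ab: "a < Suc m" "b < Suc m" "a < b"
        show "(r(Suc p := i + 1)) a < (r(Suc p := i + 1)) b"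
        proof -
          consider "a = Suc p" | "b = Suc p" "a = p" | "b = Suc p" "a < p" | "a \<noteq> Suc p" "b \<noteq> Suc p"
            using ab by linarith
          thus ?thesis
          proof cases
            case 1 thus ?thesis using gap[of b] ab by simp
          next
            case 2 thus ?thesis using Suc.prems(3) by simp
          next
            case 3 thus ?thesis using Suc.prems(3) r[of a p] pm by simp
          next
            case 4 thus ?thesis using r[OF ab(3,2)] by simp
          qed
        qed
      qed
    qed
    moreover have "sq_det m (N'(p := \<lambda>b. N (Suc p) (skip d b))) \<ge> 0"
    proof -
      have "sq_det m (N'(p := \<lambda>b. N (Suc p) (skip d b))) = minor x m (\<lambda>a. s (skip p a)) c'"
        unfolding minor_def
        by (rule sq_det_cong) (auto simp: N'_def N_def s'_def c'_def skip_def)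
      thus ?thesis using nonneg[OF strict_mono_on_skip[OF s_mono] c'_mono, of p] by simp
    qed
    ultimately have "sq_det (Suc m) N * minor x m r' c' \<le> minor x (Suc m) r c * sq_det m N'"
      using eq by (simp add: mult_nonneg_nonneg del: fun_upd_apply)
    moreover have "sq_det (Suc m) N * (minor x m r' c' + e * sq_det m N') \<ge> 0"
      using IH Npos unfolding minor_s' by (simp del: fun_upd_apply)
    ultimately have "(minor x (Suc m) r c + e * sq_det (Suc m) N) * sq_det m N' \<ge> 0"
      by (simp add: algebra_simps)
    hence "minor x (Suc m) r c + e * sq_det (Suc m) N \<ge> 0"
      using N'pos by (simp add: zero_le_mult_iff)
    thus ?thesis using detN by (simp add: m_def s_def del: fun_upd_apply)
  qed
qed

text \<open>
  Minors that avoid row \<open>i\<close> or contain both \<open>i\<close> and \<open>i + 1\<close> are unchanged, so only those treated in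
  \<open>minor_row_shift_nonneg\<close> matter.
\<close>

lemma totally_nonneg_row_operation:
  assumes tnn: "totally_nonneg x"
    and base: "last_row_op_nonneg x i e"
  shows "totally_nonneg (x(i := \<lambda>j. x i j + e * x (i + 1) j))"
  unfolding totally_nonneg_minor
proof safe
  fix m and r c :: "nat \<Rightarrow> int" assume r: "strict_mono_on {..<m} r" and c: "strict_mono_on {..<m} c"
  let ?y = "x(i := \<lambda>j. x i j + e * x (i + 1) j)"
  have pos: "minor x m r c \<ge> 0" using tnn r c by (auto simp: totally_nonneg_minor)
  show "minor ?y m r c \<ge> 0"
  proof (cases "\<exists>p<m. r p = i")
    case False
    hence "minor ?y m r c = minor x m r c" by (intro minor_cong) auto
    thus ?thesis using pos by simp
  next
    case True
    then obtain p where p: "p < m" "r p = i" by blast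
    have other: "r q \<noteq> i" if "q < m" "q \<noteq> p" for q
      using strict_mono_on_imp_inj_on[OF r] p that by (metis inj_onD lessThan_iff)
    let ?f = "\<lambda>a b. x (r a) (c b)"
    have "minor ?y m r c = sq_det m (?f(p := \<lambda>b. x i (c b) + e * x (i + 1) (c b)))"
      unfolding minor_def by (rule sq_det_cong) (use p other in auto)
    also have "\<dots> = sq_det m (?f(p := \<lambda>b. x i (c b))) + e * sq_det m (?f(p := \<lambda>b. x (i + 1) (c b)))"
      by (rule sq_det_row_add[OF p(1)])
    also have "sq_det m (?f(p := \<lambda>b. x i (c b))) = minor x m r c"
      unfolding minor_def by (rule sq_det_cong) (use p in auto)
    also have "sq_det m (?f(p := \<lambda>b. x (i + 1) (c b))) = minor x m (r(p := i + 1)) c"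
      unfolding minor_def by (rule sq_det_cong) (use p in auto)
    finally have eq: "minor ?y m r c = minor x m r c + e * minor x m (r(p := i + 1)) c" .
    show ?thesis
    proof (cases "\<exists>q<m. r q = i + 1")
      case True
      then obtain q where q: "q < m" "r q = i + 1" by blast
      have "minor x m (r(p := i + 1)) c = 0"
        unfolding minor_def
        by (rule sq_det_identical_rows[of p m q]) (use p q in auto)
      thus ?thesis using eq pos by simp
    next
      case False
      obtain k where k: "m = Suc p + k" using p(1) less_iff_Suc_add by auto
      have gap: "i + 1 < r q" if "p < q" "q < Suc p + k" for q
      proof -
        have "q < m" using that(2) k by simp
        hence "r p < r q" using strict_mono_onD[OF r, of p q] that p(1) by simp
        moreover have "r q \<noteq> i + 1" using False \<open>q < m\<close> by blast
        ultimately show ?thesis using p(2) by simp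
      qed
      have "strict_mono_on {..<Suc p + k} r" "strict_mono_on {..<Suc p + k} c" using r c k by auto
      hence "minor x (Suc p + k) r c + e * minor x (Suc p + k) (r(p := i + 1)) c \<ge> 0"
        by (rule minor_row_shift_nonneg[OF tnn base, where r = r and p = p, OF _ _ p(2)]) (rule gap)
      thus ?thesis unfolding eq unfolding k .
    qed
  qed
qed

definition row_op :: "int set \<Rightarrow> real \<Rightarrow> (int \<Rightarrow> int \<Rightarrow> real) \<Rightarrow> int \<Rightarrow> int \<Rightarrow> real" where
  "row_op S e x i j = (if i \<in> S then x i j + e * x (i + 1) j else x i j)"

lemma totally_nonneg_row_op_finite:
  assumes tnn: "totally_nonneg x" and "finite S"
    and sep: "\<And>i. i \<in> S \<Longrightarrow> i + 1 \<notin> S"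
    and base: "\<And>i. i \<in> S \<Longrightarrow> last_row_op_nonneg x i e"
  shows "totally_nonneg (row_op S e x)"
  using assms(2) sep base
proof (induction S rule: finite_linorder_min_induct)
  case empty
  have "row_op {} e x = x" by (simp add: row_op_def fun_eq_iff)
  thus ?case using tnn by simp
next
  case (insert i S)
  let ?y = "row_op S e x"
  have y: "totally_nonneg ?y"
  proof (rule insert.IH)
    show "j + 1 \<notin> S" if "j \<in> S" for j using insert.prems(1)[of j] that by blast
  qed (use insert.prems(2) in blast)
  \<comment> \<open>Rows are treated from the largest index down, so that the rows up to \<open>i + 1\<close> are still those of \<open>x\<close>.\<close>
  have low: "?y a = x a" if "a \<le> i + 1" for a
  proof -
    have "a \<notin> S" using insert.hyps(2)[rule_format, of a] insert.prems(1)[of i] that by (cases "a = i + 1") auto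
    thus ?thesis by (simp add: row_op_def fun_eq_iff)
  qed
  have "totally_nonneg (?y(i := \<lambda>j. ?y i j + e * ?y (i + 1) j))"
  proof (rule totally_nonneg_row_operation[OF y], unfold last_row_op_nonneg_def, intro allI impI)
    fix p and r c :: "nat \<Rightarrow> int" assume r: "strict_mono_on {..<Suc p} r" and c: "strict_mono_on {..<Suc p} (c :: nat \<Rightarrow> int)" and rp: "r p = i"
    have le: "r a \<le> i" if "a < Suc p" for a
      using r that rp by (cases "a = p") (auto simp: strict_mono_on_def less_Suc_eq intro: less_imp_le)
    have low_r: "?y (r a) = x (r a)" if "a < Suc p" for a
      using low[of "r a"] le[OF that] by simp
    have "minor ?y (Suc p) r c = minor x (Suc p) r c"
      by (rule minor_cong) (simp add: low_r)
    moreover have "minor ?y (Suc p) (r(p := i + 1)) c = minor x (Suc p) (r(p := i + 1)) c"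
      by (rule minor_cong) (simp add: low_r low)
    ultimately show "minor ?y (Suc p) r c + e * minor ?y (Suc p) (r(p := i + 1)) c \<ge> 0"
      using insert.prems(2)[of i] r c rp unfolding last_row_op_nonneg_def by (simp del: fun_upd_apply)
  qed
  also have "?y(i := \<lambda>j. ?y i j + e * ?y (i + 1) j) = row_op (insert i S) e x"
  proof (intro ext)
    fix a j
    show "(?y(i := \<lambda>j. ?y i j + e * ?y (i + 1) j)) a j = row_op (insert i S) e x a j"
      by (cases "a = i") (simp add: low row_op_def[of "insert i S"], simp add: row_op_def)
  qed
  finally show ?case .
qed

text \<open>
  A minor sees only finitely many rows, so the operation may be carried out on all rows of an
  infinite set at once.
\<close>

lemma totally_nonneg_row_op:
  assumes tnn: "totally_nonneg x"
    and sep: "\<And>i. i \<in> S \<Longrightarrow> i + 1 \<notin> S"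
    and base: "\<And>i. i \<in> S \<Longrightarrow> last_row_op_nonneg x i e"
  shows "totally_nonneg (row_op S e x)"
  unfolding totally_nonneg_minor
proof safe
  fix m and r c :: "nat \<Rightarrow> int" assume r: "strict_mono_on {..<m} r" and c: "strict_mono_on {..<m} c"
  let ?T = "S \<inter> r ` {..<m}"
  have "minor (row_op S e x) m r c = minor (row_op ?T e x) m r c"
    by (rule minor_cong) (auto simp: row_op_def)
  moreover have "totally_nonneg (row_op ?T e x)"
  proof (rule totally_nonneg_row_op_finite[OF tnn])
    show "i + 1 \<notin> ?T" if "i \<in> ?T" for i using sep[of i] that by blast
  qed (use base in blast)+
  ultimately show "minor (row_op S e x) m r c \<ge> 0" using r c by (auto simp: totally_nonneg_minor)
qed

section \<open>Unipotent periodic matrices\<close>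

definition unipotent :: "nat \<Rightarrow> (int \<Rightarrow> int \<Rightarrow> real) set" where
  "unipotent n = {x. (\<forall>i j. x (i + int n) (j + int n) = x i j) \<and> (\<forall>i j. j < i \<longrightarrow> x i j = 0) \<and> (\<forall>i. x i i = 1)}"

definition unipotent_tnn :: "nat \<Rightarrow> (int \<Rightarrow> int \<Rightarrow> real) set" where
  "unipotent_tnn n = {x \<in> unipotent n. totally_nonneg x}"

text \<open>
  The product of upper triangular matrices: the other summands of the infinite sum vanish.
\<close>

definition mprod :: "(int \<Rightarrow> int \<Rightarrow> real) \<Rightarrow> (int \<Rightarrow> int \<Rightarrow> real) \<Rightarrow> int \<Rightarrow> int \<Rightarrow> real" (infixl "\<star>" 70) where
  "(x \<star> y) i j = (\<Sum>k=i..j. x i k * y k j)"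

definition idm :: "int \<Rightarrow> int \<Rightarrow> real" where
  "idm i j = (if i = j then 1 else 0)"

lemma unipotentI:
  assumes "\<And>i j. x (i + int n) (j + int n) = x i j" "\<And>i j. j < i \<Longrightarrow> x i j = 0" "\<And>i. x i i = 1"
  shows "x \<in> unipotent n"
  using assms by (auto simp: unipotent_def)

lemma unipotentD:
  assumes "x \<in> unipotent n"
  shows "x (i + int n) (j + int n) = x i j" "j < i \<Longrightarrow> x i j = 0" "x i i = 1"
  using assms by (auto simp: unipotent_def)

lemma unipotent_tnnD:
  assumes "x \<in> unipotent_tnn n"
  shows "x \<in> unipotent n" "totally_nonneg x"
  using assms by (auto simp: unipotent_tnn_def)

lemma unipotent_shift:
  assumes "x \<in> unipotent n"
  shows "x (i + q * int n) (j + q * int n) = x i j"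
proof -
  have *: "x (a + int m * int n) (b + int m * int n) = x a b" for a b m
  proof (induction m)
    case (Suc m)
    have "a + int (Suc m) * int n = a + int m * int n + int n" "b + int (Suc m) * int n = b + int m * int n + int n"
      by (simp_all add: algebra_simps)
    then show ?case using Suc unipotentD(1)[OF assms, of "a + int m * int n" "b + int m * int n"] by metis
  qed simp
  show ?thesis
  proof (cases "q \<ge> 0")
    case True
    then show ?thesis using *[of i "nat q" j] by simp
  next
    case False
    then show ?thesis using *[of "i + q * int n" "nat (- q)" "j + q * int n"] by simp
  qed
qed

lemma mprod_extend:
  assumes "x \<in> unipotent n" "y \<in> unipotent n" "lo \<le> i" "j \<le> hi"
  shows "(x \<star> y) i j = (\<Sum>k=lo..hi. x i k * y k j)"
  unfolding mprod_def
proof (rule sum.mono_neutral_left)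
  show "\<forall>k\<in>{lo..hi} - {i..j}. x i k * y k j = 0"
    using unipotentD(2)[OF assms(1)] unipotentD(2)[OF assms(2)] by auto
qed (use assms in auto)

lemma mprod_unipotent:
  assumes "x \<in> unipotent n" "y \<in> unipotent n"
  shows "x \<star> y \<in> unipotent n"
proof (rule unipotentI)
  fix i j :: int
  have "(\<Sum>k=i + int n..j + int n. x (i + int n) k * y k (j + int n))
      = (\<Sum>k=i..j. x (i + int n) (k + int n) * y (k + int n) (j + int n))"
    by (rule sum.reindex_bij_witness[where i = "\<lambda>k. k + int n" and j = "\<lambda>k. k - int n"]) auto
  thus "(x \<star> y) (i + int n) (j + int n) = (x \<star> y) i j"
    unfolding mprod_def by (simp add: unipotentD(1)[OF assms(1)] unipotentD(1)[OF assms(2)])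
qed (use assms in \<open>simp_all add: mprod_def unipotentD(3)\<close>)

lemma mprod_assoc:
  assumes "x \<in> unipotent n" "y \<in> unipotent n" "z \<in> unipotent n"
  shows "x \<star> y \<star> z = x \<star> (y \<star> z)"
proof (intro ext)
  fix i j :: int
  have "(x \<star> y \<star> z) i j = (\<Sum>k=i..j. (\<Sum>l=i..j. x i l * y l k) * z k j)"
    unfolding mprod_def[of "x \<star> y"]
    by (intro sum.cong refl) (simp add: mprod_extend[OF assms(1,2), of i i _ j])
  also have "\<dots> = (\<Sum>l=i..j. \<Sum>k=i..j. x i l * (y l k * z k j))"
    unfolding sum_distrib_right mult.assoc by (rule sum.swap)
  also have "\<dots> = (x \<star> (y \<star> z)) i j"
    unfolding mprod_def[of x]
    by (intro sum.cong refl) (simp add: mprod_extend[OF assms(2,3), of i _ j j] sum_distrib_left)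
  finally show "(x \<star> y \<star> z) i j = (x \<star> (y \<star> z)) i j" .
qed

lemma idm_unipotent [simp]: "idm \<in> unipotent n"
  by (rule unipotentI) (auto simp: idm_def)

lemma mprod_idm_left:
  assumes "x \<in> unipotent n" shows "idm \<star> x = x"
proof (intro ext)
  fix i j :: int
  have "(idm \<star> x) i j = (\<Sum>k=i..j. if k = i then x k j else 0)"
    unfolding mprod_def by (intro sum.cong) (auto simp: idm_def)
  thus "(idm \<star> x) i j = x i j" using unipotentD(2)[OF assms, of j i] by (simp split: if_splits)
qed

lemma mprod_idm_right:
  assumes "x \<in> unipotent n" shows "x \<star> idm = x"
proof (intro ext)
  fix i j :: int
  have "(x \<star> idm) i j = (\<Sum>k=i..j. if k = j then x i k else 0)"
    unfolding mprod_def by (intro sum.cong) (auto simp: idm_def)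
  thus "(x \<star> idm) i j = x i j" using unipotentD(2)[OF assms, of j i] by (simp split: if_splits)
qed

subsection \<open>Inverses\<close>

text \<open>
  Back substitution in \<open>x \<star> z = idm\<close>, starting from the diagonal. As the unipotent matrices form a
  group, this is the inverse of \<open>x\<close>.
\<close>

function right_inv :: "(int \<Rightarrow> int \<Rightarrow> real) \<Rightarrow> int \<Rightarrow> int \<Rightarrow> real" where
  "right_inv x i j = (if j < i then 0 else if i = j then 1 else - (\<Sum>k=i+1..j. x i k * right_inv x k j))"
  by auto
termination
  by (relation "Wellfounded.measure (\<lambda>(x, i, j). nat (j - i + 1))") auto

declare right_inv.simps [simp del]

lemma mprod_right_inv:
  assumes "x \<in> unipotent n"
  shows "x \<star> right_inv x = idm"
proof (intro ext)
  fix i j :: int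
  consider "j < i" | "i = j" | "i < j" by linarith
  thus "(x \<star> right_inv x) i j = idm i j"
  proof cases
    case 3
    have "{i..j} = insert i {i+1..j}" using 3 by auto
    hence "(x \<star> right_inv x) i j = right_inv x i j + (\<Sum>k=i+1..j. x i k * right_inv x k j)"
      unfolding mprod_def by (simp add: unipotentD(3)[OF assms])
    thus ?thesis using 3 right_inv.simps[of x i j] by (simp add: idm_def)
  qed (auto simp: mprod_def idm_def right_inv.simps unipotentD(3)[OF assms])
qed

lemma right_inv_unipotent:
  assumes "x \<in> unipotent n"
  shows "right_inv x \<in> unipotent n"
proof (rule unipotentI)
  fix i j :: int
  show "right_inv x (i + int n) (j + int n) = right_inv x i j"
  proof (induction "nat (j - i)" arbitrary: i rule: less_induct)
    case less
    show ?case
    proof (cases "i < j")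
      case True
      have "(\<Sum>k=i + int n + 1..j + int n. x (i + int n) k * right_inv x k (j + int n))
          = (\<Sum>k=i+1..j. x (i + int n) (k + int n) * right_inv x (k + int n) (j + int n))"
        by (rule sum.reindex_bij_witness[where i = "\<lambda>k. k + int n" and j = "\<lambda>k. k - int n"]) auto
      also have "\<dots> = (\<Sum>k=i+1..j. x i k * right_inv x k j)"
        by (intro sum.cong refl arg_cong2[where f = "(*)"] unipotentD(1)[OF assms] less) (use True in auto)
      finally show ?thesis using True
        by (simp add: right_inv.simps[of x i j] right_inv.simps[of x "i + int n" "j + int n"])
    qed (auto simp: right_inv.simps)
  qed
qed (auto simp: right_inv.simps)

text \<open>
  Every unipotent matrix has a right inverse, so the unipotent matrices form a group, where one-sided
  inverses are two-sided and unique.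
\<close>

lemma mprod_inverse_unique:
  assumes "x \<in> unipotent n" "y \<in> unipotent n" "x \<star> y = idm"
  shows "y = right_inv x" "y \<star> x = idm"
proof -
  let ?w = "right_inv y"
  have w: "?w \<in> unipotent n" "y \<star> ?w = idm"
    using right_inv_unipotent mprod_right_inv assms(2) by auto
  have "x = x \<star> (y \<star> ?w)" using w mprod_idm_right[OF assms(1)] by simp
  also have "\<dots> = ?w" using mprod_assoc[OF assms(1,2) w(1)] assms(3) mprod_idm_left[OF w(1)] by simp
  finally show yx: "y \<star> x = idm" using w by simp
  have r: "right_inv x \<in> unipotent n" by (rule right_inv_unipotent[OF assms(1)])
  have "y = y \<star> (x \<star> right_inv x)" using mprod_right_inv[OF assms(1)] mprod_idm_right[OF assms(2)] by simp
  thus "y = right_inv x" using mprod_assoc[OF assms(2,1) r] yx mprod_idm_left[OF r] by simp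
qed

lemma mprod_left_inv:
  assumes "x \<in> unipotent n"
  shows "right_inv x \<star> x = idm"
  using mprod_inverse_unique(2)[OF assms right_inv_unipotent[OF assms] mprod_right_inv[OF assms]] .

lemma right_inv_mprod:
  assumes x: "x \<in> unipotent n" and y: "y \<in> unipotent n"
  shows "right_inv (x \<star> y) = right_inv y \<star> right_inv x"
proof -
  let ?x' = "right_inv x" and ?y' = "right_inv y"
  have x': "?x' \<in> unipotent n" and y': "?y' \<in> unipotent n" using right_inv_unipotent x y by auto
  have "(x \<star> y) \<star> (?y' \<star> ?x') = x \<star> (y \<star> ?y') \<star> ?x'"
    using x y x' y' by (simp add: mprod_assoc[where n = n] mprod_unipotent)
  also have "\<dots> = idm" using x y by (simp add: mprod_right_inv[where n = n] mprod_idm_right[where n = n])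
  finally have "(x \<star> y) \<star> (?y' \<star> ?x') = idm" .
  from mprod_inverse_unique(1)[OF _ _ this, of n] x y x' y'
  show ?thesis by (simp add: mprod_unipotent)
qed

subsection \<open>Reflection in the antidiagonal\<close>

text \<open>
  This reflection is an anti-automorphism that preserves total nonnegativity. It exchanges left and
  right products, and the ratios of neighbouring rows with those of neighbouring columns.
\<close>

definition antireflect :: "(int \<Rightarrow> int \<Rightarrow> real) \<Rightarrow> int \<Rightarrow> int \<Rightarrow> real" where
  "antireflect x i j = x (- j) (- i)"

lemma antireflect_antireflect [simp]: "antireflect (antireflect x) = x"
  by (simp add: antireflect_def fun_eq_iff)

lemma antireflect_unipotent: "x \<in> unipotent n \<Longrightarrow> antireflect x \<in> unipotent n"
proof (rule unipotentI)
  fix i j :: int assume x: "x \<in> unipotent n"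
  show "antireflect x (i + int n) (j + int n) = antireflect x i j"
    using unipotent_shift[OF x, of "-j" "-1" "-i"] by (simp add: antireflect_def algebra_simps)
qed (auto simp: antireflect_def unipotentD)

lemma antireflect_mprod: "antireflect (x \<star> y) = antireflect y \<star> antireflect x"
proof (intro ext)
  fix i j :: int
  have "(\<Sum>k=-j..-i. x (-j) k * y k (-i)) = (\<Sum>k=i..j. y (-k) (-i) * x (-j) (-k))"
    by (rule sum.reindex_bij_witness[where i = uminus and j = uminus]) (auto simp: mult.commute)
  thus "antireflect (x \<star> y) i j = (antireflect y \<star> antireflect x) i j"
    by (simp add: antireflect_def mprod_def)
qed

lemma antireflect_idm [simp]: "antireflect idm = idm"
  by (auto simp: antireflect_def idm_def fun_eq_iff)

lemma antireflect_right_inv: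
  assumes "x \<in> unipotent n"
  shows "antireflect (right_inv x) = right_inv (antireflect x)"
proof -
  have "antireflect (right_inv x \<star> x) = idm" by (simp add: mprod_left_inv[OF assms])
  thus ?thesis
    using mprod_inverse_unique(1)[of "antireflect x" n "antireflect (right_inv x)"]
      antireflect_unipotent[OF assms] antireflect_unipotent[OF right_inv_unipotent[OF assms]]
    by (simp add: antireflect_mprod)
qed

text \<open>
  Transposition does not change the determinant, and reversing both the rows and the columns
  introduces the same sign twice.
\<close>

lemma sq_det_antitranspose: "sq_det m (\<lambda>a b. f (m - 1 - b) (m - 1 - a)) = sq_det m f"
proof -
  define \<pi> where "\<pi> = (\<lambda>a. if a < m then m - 1 - a else a)"
  have \<pi>: "\<pi> permutes {0..<m}"
  proof (rule bij_imp_permutes)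
    show "bij_betw \<pi> {0..<m} {0..<m}"
      by (rule bij_betw_byWitness[where f' = \<pi>]) (auto simp: \<pi>_def)
  qed (auto simp: \<pi>_def)
  let ?A = "sq_mat m f"
  let ?B = "Matrix.mat m m (\<lambda>(i, j). ?A $$ (\<pi> i, j))"
  have "Determinant.det ?B = signof \<pi> * Determinant.det ?A"
    by (rule det_permute_rows) (use \<pi> in auto)
  moreover have "Determinant.det (Matrix.mat m m (\<lambda>(i, j). transpose_mat ?B $$ (\<pi> i, j))) = signof \<pi> * Determinant.det (transpose_mat ?B)"
    by (rule det_permute_rows) (use \<pi> in auto)
  moreover have "Determinant.det (transpose_mat ?B) = Determinant.det ?B"
    by (rule det_transpose[of _ m]) auto
  moreover have "signof \<pi> * (signof \<pi> * (d::real)) = d" for d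
    by (simp add: sign_def)
  ultimately have "Determinant.det (Matrix.mat m m (\<lambda>(i, j). transpose_mat ?B $$ (\<pi> i, j))) = sq_det m f"
    by (simp add: sq_det_def)
  moreover have "Matrix.mat m m (\<lambda>(i, j). transpose_mat ?B $$ (\<pi> i, j)) = sq_mat m (\<lambda>a b. f (m - 1 - b) (m - 1 - a))"
    by (auto intro!: eq_matI simp: \<pi>_def)
  ultimately show ?thesis by (simp add: sq_det_def)
qed

lemma antireflect_totally_nonneg:
  assumes "totally_nonneg x"
  shows "totally_nonneg (antireflect x)"
  unfolding totally_nonneg_minor
proof safe
  fix m and r c :: "nat \<Rightarrow> int" assume r: "strict_mono_on {..<m} r" and c: "strict_mono_on {..<m} c"
  let ?r = "\<lambda>a. - c (m - 1 - a)" and ?c = "\<lambda>a. - r (m - 1 - a)"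
  have "strict_mono_on {..<m} (\<lambda>a. - s (m - 1 - a))" if "strict_mono_on {..<m} s" for s :: "nat \<Rightarrow> int"
    using that unfolding strict_mono_on_def by auto
  hence "minor x m ?r ?c \<ge> 0" using assms r c by (auto simp: totally_nonneg_minor)
  moreover have "minor (antireflect x) m r c = minor x m ?r ?c"
  proof -
    have "minor x m ?r ?c = sq_det m (\<lambda>a b. antireflect x (r (m - 1 - b)) (c (m - 1 - a)))"
      unfolding minor_def antireflect_def ..
    also have "\<dots> = minor (antireflect x) m r c"
      unfolding minor_def by (rule sq_det_antitranspose[of m "\<lambda>a b. antireflect x (r a) (c b)"])
    finally show ?thesis by simp
  qed
  ultimately show "minor (antireflect x) m r c \<ge> 0" by simp
qed

lemma antireflect_unipotent_tnn: "x \<in> unipotent_tnn n \<Longrightarrow> antireflect x \<in> unipotent_tnn n"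
  by (simp add: unipotent_tnn_def antireflect_unipotent antireflect_totally_nonneg)

subsection \<open>Total nonnegativity\<close>

lemma totally_nonneg_limit:
  assumes "\<And>m. totally_nonneg (x m)" "\<And>i j. (\<lambda>m. x m i j) \<longlonglongrightarrow> y i j"
  shows "totally_nonneg y"
  unfolding totally_nonneg_minor
proof safe
  fix l and r c :: "nat \<Rightarrow> int" assume rc: "strict_mono_on {..<l} r" "strict_mono_on {..<l} c"
  have "(\<lambda>m. minor (x m) l r c) \<longlonglongrightarrow> minor y l r c"
    unfolding minor_def sq_det_def Determinant.det_def
    by (simp, intro tendsto_intros) (auto intro!: tendsto_eq_intros assms(2) simp: permutes_in_image)
  thus "minor y l r c \<ge> 0"
    by (rule LIMSEQ_le_const) (use assms(1) rc in \<open>auto simp: totally_nonneg_minor\<close>)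
qed

lemma unipotent_limit:
  assumes "\<And>m. x m \<in> unipotent n" "\<And>i j. (\<lambda>m. x m i j) \<longlonglongrightarrow> y i j"
  shows "y \<in> unipotent n"
proof (rule unipotentI)
  fix i j :: int
  show "y (i + int n) (j + int n) = y i j"
    using LIMSEQ_unique[OF assms(2)[of "i + int n" "j + int n"]] assms(2)[of i j] unipotentD(1)[OF assms(1)] by simp
  show "y i j = 0" if "j < i"
    using LIMSEQ_unique[OF assms(2)[of i j]] unipotentD(2)[OF assms(1) that] by simp
  show "y i i = 1"
    using LIMSEQ_unique[OF assms(2)[of i i]] unipotentD(3)[OF assms(1)] by simp
qed

lemma unipotent_tnn_limit:
  assumes "\<And>m. x m \<in> unipotent_tnn n" "\<And>i j. (\<lambda>m. x m i j) \<longlonglongrightarrow> y i j"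
  shows "y \<in> unipotent_tnn n"
  using unipotent_limit[of x n y] totally_nonneg_limit[of x y] assms by (auto simp: unipotent_tnn_def)

lemma mprod_limit:
  assumes "\<And>i j. (\<lambda>m. x m i j) \<longlonglongrightarrow> x' i j" "\<And>i j. (\<lambda>m. y m i j) \<longlonglongrightarrow> y' i j"
  shows "(\<lambda>m. (x m \<star> y m) i j) \<longlonglongrightarrow> (x' \<star> y') i j"
  unfolding mprod_def by (intro tendsto_intros assms)

lemma sq_det_1: "sq_det (Suc 0) f = f 0 0"
  by (simp add: sq_det_def det_single)

lemma sq_det_2: "sq_det 2 f = f 0 0 * f 1 1 - f 0 1 * f 1 0"
  using sq_det_row_expand'[of 0 2 f]
  by (simp add: numeral_2_eq_2 cofactor_sq_mat sq_det_1 skip_def)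

lemma totally_nonneg_entry:
  assumes "totally_nonneg x" shows "x i j \<ge> 0"
proof -
  have "minor x 1 (\<lambda>_. i) (\<lambda>_. j) \<ge> 0"
    using assms unfolding totally_nonneg_minor by (auto simp: strict_mono_on_def)
  thus ?thesis by (simp add: minor_def sq_det_1)
qed

lemma totally_nonneg_minor2:
  assumes "totally_nonneg x" "i < i'" "j < j'"
  shows "x i j' * x i' j \<le> x i j * x i' j'"
proof -
  have "minor x 2 (\<lambda>a. if a = 0 then i else i') (\<lambda>b. if b = 0 then j else j') \<ge> 0"
    using assms(1)[unfolded totally_nonneg_minor, rule_format, of 2 "\<lambda>a. if a = 0 then i else i'" "\<lambda>b. if b = 0 then j else j'"] assms(2,3)
    by (auto simp: strict_mono_on_def)
  thus ?thesis by (simp add: minor_def sq_det_2)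
qed

text \<open>
  Induction on the size, comparing the last row index with the last column index: if they differ,
  the last row or the last column vanishes.
\<close>

lemma totally_nonneg_idm: "totally_nonneg idm"
  unfolding totally_nonneg_minor
proof (intro allI impI)
  fix m r c
  show "strict_mono_on {..<m} r \<Longrightarrow> strict_mono_on {..<m} c \<Longrightarrow> minor idm m r c \<ge> 0"
  proof (induction m)
    case 0
    show ?case by (simp add: minor_def sq_det_def)
  next
    case (Suc m)
    have IH: "minor idm m r c \<ge> 0"
      using Suc by (auto simp: strict_mono_on_def)
    have expand: "minor idm (Suc m) r c = (\<Sum>b<Suc m. idm (r m) (c b) * cofactor (sq_mat (Suc m) (\<lambda>a b. idm (r a) (c b))) m b)"
      unfolding minor_def by (rule sq_det_row_expand') simp
    consider (less) "r m < c m" | (eq) "r m = c m" | (greater) "r m > c m" by linarith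
    thus ?case
    proof cases
      case less
      have "idm (r a) (c m) = 0" if "a < Suc m" for a
        using less that strict_mono_onD[OF Suc.prems(1), of a m] by (cases "a = m") (auto simp: idm_def)
      hence "\<forall>a<Suc m. sq_mat (Suc m) (\<lambda>a b. idm (r a) (c b)) $$ (a, m) = 0" by auto
      hence "minor idm (Suc m) r c = 0"
        unfolding minor_def sq_det_def
        by (subst laplace_expansion_column[of _ "Suc m" m]) auto
      thus ?thesis by simp
    next
      case greater
      have "idm (r m) (c b) = 0" if "b < Suc m" for b
        using greater that strict_mono_onD[OF Suc.prems(2), of b m] by (cases "b = m") (auto simp: idm_def)
      thus ?thesis unfolding expand by simp
    next
      case eq
      have "idm (r m) (c b) = 0" if "b < m" for b
        using eq that strict_mono_onD[OF Suc.prems(2), of b m] by (auto simp: idm_def)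
      hence "minor idm (Suc m) r c = cofactor (sq_mat (Suc m) (\<lambda>a b. idm (r a) (c b))) m m"
        unfolding expand by (simp add: eq idm_def)
      also have "\<dots> = minor idm m r c"
        unfolding cofactor_sq_mat[OF lessI lessI] minor_def
        by (simp add: power_add[symmetric] mult_2[symmetric]) (rule sq_det_cong, simp add: skip_def)
      finally show ?thesis using IH by simp
    qed
  qed
qed

lemma idm_unipotent_tnn [simp]: "idm \<in> unipotent_tnn n"
  by (simp add: unipotent_tnn_def totally_nonneg_idm)

lemma mprod_ge:
  assumes "a \<in> unipotent n" "b \<in> unipotent n" "\<And>i j. a i j \<ge> 0" "\<And>i j. b i j \<ge> 0"
  shows "a i j \<le> (a \<star> b) i j" "b i j \<le> (a \<star> b) i j"
proof -
  have *: "a i k * b k j \<le> (a \<star> b) i j" if "i \<le> k" "k \<le> j" for k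
    unfolding mprod_def using that assms(3,4) by (intro member_le_sum) auto
  have nn: "(a \<star> b) i j \<ge> 0" unfolding mprod_def using assms(3,4) by (intro sum_nonneg) auto
  show "a i j \<le> (a \<star> b) i j"
    using *[of j] nn unipotentD(2)[OF assms(1), of j i] unipotentD(3)[OF assms(2)] by (cases "j < i") auto
  show "b i j \<le> (a \<star> b) i j"
    using *[of i] nn unipotentD(2)[OF assms(2), of j i] unipotentD(3)[OF assms(1)] by (cases "j < i") auto
qed

subsection \<open>Signs of the inverse\<close>

text \<open>
  Conjugation by the diagonal matrix with entries \<open>(-1)^i\<close>, and therefore multiplicative.
\<close>

definition alternate :: "(int \<Rightarrow> int \<Rightarrow> real) \<Rightarrow> int \<Rightarrow> int \<Rightarrow> real" where
  "alternate x i j = (if even (i + j) then x i j else - x i j)"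

lemma alternate_unipotent: "x \<in> unipotent n \<Longrightarrow> alternate x \<in> unipotent n"
  by (rule unipotentI) (auto simp: alternate_def unipotentD)

lemma alternate_mprod: "alternate (x \<star> y) = alternate x \<star> alternate y"
proof (intro ext)
  fix i j :: int
  have "(alternate x \<star> alternate y) i j = (\<Sum>k=i..j. if even (i + j) then x i k * y k j else - (x i k * y k j))"
    unfolding mprod_def by (intro sum.cong refl) (auto simp: alternate_def)
  thus "alternate (x \<star> y) i j = (alternate x \<star> alternate y) i j"
    by (simp add: alternate_def mprod_def sum_negf)
qed

lemma abs_alternate [simp]: "\<bar>alternate x i j\<bar> = \<bar>x i j\<bar>"
  by (simp add: alternate_def)

text \<open>
  On the window of indices \<open>i, \<dots>, j\<close> the inverse is a Cramer quotient with denominator 1. Its corner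
  entry is, up to the sign \<open>(-1)^(j - i)\<close>, the minor of \<open>x\<close> with rows \<open>i, \<dots>, j - 1\<close> and columns
  \<open>i + 1, \<dots>, j\<close>.
\<close>

lemma right_inv_alternating:
  assumes "x \<in> unipotent_tnn n"
  shows "alternate (right_inv x) i j \<ge> 0"
proof (cases "i \<le> j")
  case False
  thus ?thesis by (simp add: alternate_def right_inv.simps)
next
  case True
  note x = unipotent_tnnD(1)[OF assms] and tnn = unipotent_tnnD(2)[OF assms]
  note z = right_inv_unipotent[OF x]
  define l where "l = nat (j - i)"
  have j: "j = i + int l" using True by (simp add: l_def)
  define W where "W = (\<lambda>a b. x (i + int a) (i + int b))"
  have WZ: "(\<Sum>k<Suc l. W a k * right_inv x (i + int k) j) = (if a = l then 1 else 0)" if "a < Suc l" for a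
  proof -
    have "(\<Sum>k<Suc l. W a k * right_inv x (i + int k) j) = (\<Sum>k=i..j. x (i + int a) k * right_inv x k j)"
      by (rule sum.reindex_bij_witness[where i = "\<lambda>k. nat (k - i)" and j = "\<lambda>k. i + int k"])
        (auto simp: W_def j)
    also have "\<dots> = (x \<star> right_inv x) (i + int a) j"
      by (rule mprod_extend[OF x z, symmetric]) auto
    also have "\<dots> = (if a = l then 1 else 0)"
      by (simp add: mprod_right_inv[OF x] idm_def j)
    finally show ?thesis .
  qed
  have detW: "sq_det (Suc l) W = 1"
  proof -
    have "upper_triangular (sq_mat (Suc l) W)"
      unfolding upper_triangular_def using unipotentD(2)[OF x] by (auto simp: W_def)
    hence "sq_det (Suc l) W = prod_list (diag_mat (sq_mat (Suc l) W))"
      unfolding sq_det_def by (rule det_upper_triangular) auto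
    thus ?thesis by (simp add: prod_list_diag_prod W_def unipotentD(3)[OF x])
  qed
  let ?e = "\<lambda>b::nat. if b = 0 then 1 else 0 :: real"
  have "right_inv x i j = (\<Sum>b<Suc l. ?e b * right_inv x (i + int b) j)"
    by (subst sum.remove[of _ 0]) auto
  also have "\<dots> = (\<Sum>b<Suc l. \<Sum>q<Suc l. sq_det (Suc l) (W(q := ?e)) * (W q b * right_inv x (i + int b) j))"
  proof (intro sum.cong refl)
    fix b assume "b \<in> {..<Suc l}"
    hence "?e b = (\<Sum>q<Suc l. sq_det (Suc l) (W(q := ?e)) * W q b)"
      using sq_det_cramer[of b "Suc l" W ?e] detW by simp
    thus "?e b * right_inv x (i + int b) j = (\<Sum>q<Suc l. sq_det (Suc l) (W(q := ?e)) * (W q b * right_inv x (i + int b) j))"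
      by (simp only: sum_distrib_right mult.assoc)
  qed
  also have "\<dots> = (\<Sum>q<Suc l. sq_det (Suc l) (W(q := ?e)) * (\<Sum>b<Suc l. W q b * right_inv x (i + int b) j))"
    unfolding sum_distrib_left by (rule sum.swap)
  also have "\<dots> = (\<Sum>q<Suc l. if q = l then sq_det (Suc l) (W(q := ?e)) else 0)"
    by (intro sum.cong refl) (simp add: WZ del: sum.lessThan_Suc fun_upd_apply)
  also have "\<dots> = sq_det (Suc l) (W(l := ?e))" by simp
  also have "\<dots> = (\<Sum>b<Suc l. if b = 0 then cofactor (sq_mat (Suc l) W) l b else 0)"
    unfolding sq_det_row_expand[OF lessI] by (intro sum.cong refl) auto
  also have "\<dots> = cofactor (sq_mat (Suc l) W) l 0" by (simp del: sum.lessThan_Suc)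
  also have "\<dots> = (-1) ^ l * sq_det l (\<lambda>a b. W (skip l a) (skip 0 b))"
    by (simp add: cofactor_sq_mat)
  also have "sq_det l (\<lambda>a b. W (skip l a) (skip 0 b)) = minor x l (\<lambda>a. i + int a) (\<lambda>b. i + 1 + int b)"
    unfolding minor_def by (rule sq_det_cong) (auto simp: W_def skip_def algebra_simps)
  finally have "right_inv x i j = (-1) ^ l * minor x l (\<lambda>a. i + int a) (\<lambda>b. i + 1 + int b)" .
  moreover have "minor x l (\<lambda>a. i + int a) (\<lambda>b. i + 1 + int b) \<ge> 0"
    using tnn by (auto simp: totally_nonneg_minor strict_mono_on_def)
  ultimately show ?thesis by (auto simp: alternate_def j uminus_power_if)
qed

text \<open>
  After alternation the inverses are nonnegative and unipotent, and the inverse of the product is the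
  product of the inverses, so it dominates each of them.
\<close>

lemma abs_right_inv_factor_le:
  assumes a: "a \<in> unipotent_tnn n" and y: "y \<in> unipotent_tnn n"
  shows "\<bar>right_inv y i j\<bar> \<le> \<bar>right_inv (a \<star> y) i j\<bar>"
proof -
  note au = unipotent_tnnD(1)[OF a] and yu = unipotent_tnnD(1)[OF y]
  have "alternate (right_inv y) i j \<le> (alternate (right_inv y) \<star> alternate (right_inv a)) i j"
    by (rule mprod_ge(1)[of _ n]) (use au yu a y in \<open>auto intro: alternate_unipotent right_inv_unipotent right_inv_alternating\<close>)
  also have "\<dots> = alternate (right_inv (a \<star> y)) i j"
    by (simp add: right_inv_mprod[OF au yu] alternate_mprod)
  finally have "\<bar>alternate (right_inv y) i j\<bar> \<le> \<bar>alternate (right_inv (a \<star> y)) i j\<bar>"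
    using right_inv_alternating[OF y, of i j] by (simp del: abs_alternate)
  thus ?thesis by simp
qed

section \<open>Chevalley generators and the right limit semigroup\<close>

text \<open>
  The unfolding of the Chevalley generator \<open>e\<^sub>k(a)\<close>.
\<close>

definition gen :: "nat \<Rightarrow> int \<Rightarrow> real \<Rightarrow> int \<Rightarrow> int \<Rightarrow> real" where
  "gen n k a i j = (if i = j then 1 else if j = i + 1 \<and> [i = k] (mod int n) then a else 0)"

lemma gen_unipotent: "gen n k a \<in> unipotent n"
  by (rule unipotentI) (auto simp: gen_def cong_def)

lemma gen_mprod:
  assumes "x \<in> unipotent n"
  shows "gen n k a \<star> x = row_op {i. [i = k] (mod int n)} a x"
proof (intro ext)
  fix i j :: int
  show "(gen n k a \<star> x) i j = row_op {i. [i = k] (mod int n)} a x i j"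
  proof (cases "j < i")
    case True
    thus ?thesis using unipotentD(2)[OF assms] by (simp add: mprod_def row_op_def)
  next
    case False
    have "(gen n k a \<star> x) i j = (\<Sum>l=i..j+1. gen n k a i l * x l j)"
      by (rule mprod_extend[OF gen_unipotent assms]) auto
    also have "\<dots> = (\<Sum>l\<in>{i, i+1}. gen n k a i l * x l j)"
      by (rule sum.mono_neutral_right) (use False in \<open>auto simp: gen_def\<close>)
    also have "\<dots> = row_op {i. [i = k] (mod int n)} a x i j"
      by (simp add: gen_def row_op_def)
    finally show ?thesis .
  qed
qed

lemma not_cong_succ:
  assumes "n \<ge> 2" "[i = k] (mod int n)"
  shows "\<not> [i + 1 = k] (mod int n)"
proof
  assume "[i + 1 = k] (mod int n)"
  hence "[i + 1 = i] (mod int n)" using assms(2) cong_sym cong_trans by blast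
  hence "int n dvd 1" by (metis add_diff_cancel_left' cong_iff_dvd_diff)
  thus False using assms(1) by simp
qed

lemma gen_inverse:
  assumes "n \<ge> 2"
  shows "gen n k a \<star> gen n k (- a) = idm"
  unfolding gen_mprod[OF gen_unipotent]
  using not_cong_succ[OF assms] by (auto simp: fun_eq_iff row_op_def gen_def idm_def)

lemma antireflect_gen: "antireflect (gen n k a) = gen n (- k - 1) a"
proof -
  have "[- (i + 1) = k] (mod int n) \<longleftrightarrow> [i = - k - 1] (mod int n)" for i
  proof -
    have "- (i + 1) - k = - (i - (- k - 1))" by simp
    thus ?thesis unfolding cong_iff_dvd_diff using dvd_minus_iff by metis
  qed
  hence "antireflect (gen n k a) i j = gen n (- k - 1) a i j" for i j
    by (cases "j = i + 1") (auto simp: antireflect_def gen_def)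
  thus ?thesis by (intro ext)
qed

lemma last_row_op_nonneg_pos:
  assumes "totally_nonneg x" "e \<ge> 0"
  shows "last_row_op_nonneg x i e"
  unfolding last_row_op_nonneg_def
proof (intro allI impI)
  fix p and r c :: "nat \<Rightarrow> int"
  assume r: "strict_mono_on {..<Suc p} r" and c: "strict_mono_on {..<Suc p} c" and i: "r p = i"
  have "strict_mono_on {..<Suc p} (r(p := i + 1))"
    unfolding strict_mono_on_def using strict_mono_onD[OF r] i by (fastforce simp: less_Suc_eq)
  with r c assms show "minor x (Suc p) r c + e * minor x (Suc p) (r(p := i + 1)) c \<ge> 0"
    by (auto simp: totally_nonneg_minor simp del: fun_upd_apply)
qed

lemma gen_mprod_tnn:
  assumes "x \<in> unipotent_tnn n" "n \<ge> 2"
    and "\<And>i. [i = k] (mod int n) \<Longrightarrow> last_row_op_nonneg x i a"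
  shows "gen n k a \<star> x \<in> unipotent_tnn n"
proof -
  have "totally_nonneg (row_op {i. [i = k] (mod int n)} a x)"
    by (rule totally_nonneg_row_op) (use assms not_cong_succ in \<open>auto simp: unipotent_tnn_def\<close>)
  thus ?thesis
    using assms(1) gen_mprod[of x n k a] mprod_unipotent[OF gen_unipotent, of x n k a]
    by (auto simp: unipotent_tnn_def)
qed

primrec rprod :: "(nat \<Rightarrow> int \<Rightarrow> int \<Rightarrow> real) \<Rightarrow> nat \<Rightarrow> int \<Rightarrow> int \<Rightarrow> real" where
  "rprod A 0 = idm"
| "rprod A (Suc m) = rprod A m \<star> A m"

text \<open>
  The unfolded form of a right limit semigroup that contains the identity and the generators. Left
  limit semigroups become right ones under \<open>antireflect\<close>, so this notion serves both sides.
\<close>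

definition right_closed :: "nat \<Rightarrow> (int \<Rightarrow> int \<Rightarrow> real) set \<Rightarrow> bool" where
  "right_closed n G \<longleftrightarrow> G \<subseteq> unipotent n \<and> idm \<in> G \<and>
     (\<forall>k a. n \<ge> 2 \<longrightarrow> a \<ge> 0 \<longrightarrow> gen n k a \<in> G) \<and>
     (\<forall>a\<in>G. \<forall>b\<in>G. a \<star> b \<in> G) \<and>
     (\<forall>A p. (\<forall>m. A m \<in> G) \<longrightarrow> p \<in> unipotent n \<longrightarrow>
        (\<forall>i j. (\<lambda>m. rprod A m i j) \<longlonglongrightarrow> p i j) \<longrightarrow> p \<in> G)"

definition right_limit :: "nat \<Rightarrow> (int \<Rightarrow> int \<Rightarrow> real) set" where
  "right_limit n = \<Inter>{G. right_closed n G \<and> G \<subseteq> unipotent_tnn n}"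

text \<open>
  These matrices form a right limit semigroup, by a direct verification on generators, products and
  limits. By minimality it contains \<open>right_limit n\<close>, so multiplication from the left by elements of
  \<open>right_limit n\<close> preserves total nonnegativity.
\<close>

definition preserver :: "nat \<Rightarrow> (int \<Rightarrow> int \<Rightarrow> real) set" where
  "preserver n = {a \<in> unipotent n. \<forall>y\<in>unipotent_tnn n. a \<star> y \<in> unipotent_tnn n}"

lemma preserver_subset: "preserver n \<subseteq> unipotent_tnn n"
proof
  fix a assume a: "a \<in> preserver n"
  hence "a \<star> idm \<in> unipotent_tnn n" by (auto simp: preserver_def)
  thus "a \<in> unipotent_tnn n" using a mprod_idm_right[of a n] by (simp add: preserver_def)
qed

lemma preserver_right_closed: "right_closed n (preserver n)"
  unfolding right_closed_def
proof (intro conjI ballI allI impI)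
  show "preserver n \<subseteq> unipotent n" by (auto simp: preserver_def)
  show "idm \<in> preserver n"
    using mprod_idm_left[of _ n] by (auto simp: preserver_def unipotent_tnn_def)
  show "gen n k a \<in> preserver n" if "n \<ge> 2" "a \<ge> 0" for k a
    using that gen_mprod_tnn last_row_op_nonneg_pos gen_unipotent
    by (auto simp: preserver_def unipotent_tnn_def)
  show prod: "a \<star> b \<in> preserver n" if "a \<in> preserver n" "b \<in> preserver n" for a b
    using that mprod_assoc[of a n b] by (auto simp: preserver_def mprod_unipotent unipotent_tnn_def)
  fix A p
  assume A: "\<forall>m. A m \<in> preserver n" and p: "p \<in> unipotent n" and lim: "\<forall>i j. (\<lambda>m. rprod A m i j) \<longlonglongrightarrow> p i j"
  have R: "rprod A m \<in> preserver n" for m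
    by (induction m) (use A prod \<open>idm \<in> preserver n\<close> in auto)
  have "p \<star> y \<in> unipotent_tnn n" if y: "y \<in> unipotent_tnn n" for y
  proof (rule unipotent_tnn_limit)
    show "rprod A m \<star> y \<in> unipotent_tnn n" for m using R y by (auto simp: preserver_def)
    show "(\<lambda>m. (rprod A m \<star> y) i j) \<longlonglongrightarrow> (p \<star> y) i j" for i j
      by (rule mprod_limit) (use lim in auto)
  qed
  thus "p \<in> preserver n" using p by (simp add: preserver_def)
qed

lemma right_limit_preserver: "right_limit n \<subseteq> preserver n"
  using preserver_right_closed preserver_subset by (auto simp: right_limit_def)

lemma right_limit_unipotent_tnn: "a \<in> right_limit n \<Longrightarrow> a \<in> unipotent_tnn n"
  using right_limit_preserver preserver_subset by blast

lemma right_limit_mprod_tnn: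
  "a \<in> right_limit n \<Longrightarrow> y \<in> unipotent_tnn n \<Longrightarrow> a \<star> y \<in> unipotent_tnn n"
  using right_limit_preserver by (auto simp: preserver_def)

lemma right_limit_right_closed: "right_closed n (right_limit n)"
  unfolding right_closed_def
proof (intro conjI ballI allI impI)
  show "right_limit n \<subseteq> unipotent n" using right_limit_unipotent_tnn unipotent_tnnD by blast
next
  fix A p
  assume *: "\<forall>m. A m \<in> right_limit n" "p \<in> unipotent n" "\<forall>i j. (\<lambda>m. rprod A m i j) \<longlonglongrightarrow> p i j"
  show "p \<in> right_limit n"
    unfolding right_limit_def
  proof safe
    fix G assume G: "right_closed n G" "G \<subseteq> unipotent_tnn n"
    hence "\<forall>m. A m \<in> G" using *(1) by (auto simp: right_limit_def)
    thus "p \<in> G" using G(1) *(2,3) unfolding right_closed_def by blast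
  qed
qed (auto simp: right_limit_def right_closed_def)

lemma right_limit_intros:
  shows "idm \<in> right_limit n"
    and "n \<ge> 2 \<Longrightarrow> a \<ge> 0 \<Longrightarrow> gen n k a \<in> right_limit n"
    and "x \<in> right_limit n \<Longrightarrow> y \<in> right_limit n \<Longrightarrow> x \<star> y \<in> right_limit n"
  using right_limit_right_closed[of n] by (auto simp: right_closed_def)

lemma right_limit_limit:
  assumes "\<And>m. A m \<in> right_limit n" "p \<in> unipotent n" "\<And>i j. (\<lambda>m. rprod A m i j) \<longlonglongrightarrow> p i j"
  shows "p \<in> right_limit n"
  using right_limit_right_closed[of n] assms unfolding right_closed_def by blast

section \<open>Removing a maximal left factor\<close>

text \<open>
  The sum of the superdiagonal entries over one period. It is an additive measure of how much a left
  factor removes.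
\<close>

definition weight :: "nat \<Rightarrow> (int \<Rightarrow> int \<Rightarrow> real) \<Rightarrow> real" where
  "weight n x = (\<Sum>i=1..int n. x i (i + 1))"

lemma weight_mprod:
  assumes "x \<in> unipotent n" "y \<in> unipotent n"
  shows "weight n (x \<star> y) = weight n x + weight n y"
proof -
  have "(x \<star> y) i (i + 1) = x i (i + 1) + y i (i + 1)" for i
  proof -
    have "{i..i+1} = {i, i+1}" by auto
    thus ?thesis by (simp add: mprod_def unipotentD(3)[OF assms(1)] unipotentD(3)[OF assms(2)])
  qed
  thus ?thesis by (simp add: weight_def sum.distrib)
qed

lemma weight_nonneg: "x \<in> unipotent_tnn n \<Longrightarrow> weight n x \<ge> 0"
  unfolding weight_def by (intro sum_nonneg totally_nonneg_entry unipotent_tnnD)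

lemma weight_gen_pos:
  assumes "n \<ge> 1" "c > 0"
  shows "weight n (gen n k c) > 0"
proof -
  define i where "i = (k - 1) mod int n + 1"
  have i: "i \<in> {1..int n}" using assms(1) by (simp add: i_def add1_zle_eq)
  have "[i = k] (mod int n)" by (simp add: i_def cong_def mod_simps)
  hence "gen n k c i (i + 1) = c" by (simp add: gen_def)
  moreover have "gen n k c i (i + 1) \<le> weight n (gen n k c)"
    unfolding weight_def by (rule member_le_sum) (use i assms in \<open>auto simp: gen_def\<close>)
  ultimately show ?thesis using assms(2) by linarith
qed

text \<open>
  The partial products increase and are bounded by \<open>ys 0\<close>, while the remainders decrease and are
  bounded by 0. As each entry of a product is a finite sum, the product passes to the limit.
\<close>

lemma infinite_factorization:
  assumes ys: "\<And>m. ys m \<in> unipotent_tnn n" and as: "\<And>m. as m \<in> right_limit n"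
    and fact: "\<And>m. ys m = as m \<star> ys (Suc m)"
  obtains p y where "p \<in> right_limit n" "y \<in> unipotent_tnn n" "\<And>i j. (\<lambda>m. ys m i j) \<longlonglongrightarrow> y i j" "ys 0 = p \<star> y"
proof -
  note ast = right_limit_unipotent_tnn[OF as]
  note asu = unipotent_tnnD(1)[OF ast] and ysu = unipotent_tnnD(1)[OF ys]
  have nonneg: "x i j \<ge> 0" if "x \<in> unipotent_tnn n" for x i j
    using totally_nonneg_entry unipotent_tnnD(2)[OF that] by blast
  have R: "rprod as m \<in> right_limit n" for m
    by (induction m) (auto intro: right_limit_intros as)
  note Rt = right_limit_unipotent_tnn[OF R]
  note Ru = unipotent_tnnD(1)[OF Rt]
  have split: "ys 0 = rprod as m \<star> ys m" for m
  proof (induction m)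
    case (Suc m)
    thus ?case unfolding rprod.simps mprod_assoc[OF Ru asu ysu] fact[symmetric] .
  qed (simp add: mprod_idm_left[OF ysu])
  have "\<exists>l. (\<lambda>m. rprod as m i j) \<longlonglongrightarrow> l" for i j
  proof -
    have "incseq (\<lambda>m. rprod as m i j)"
      unfolding incseq_Suc_iff rprod.simps
      by (intro allI mprod_ge(1)[OF Ru asu] nonneg[OF Rt] nonneg[OF ast])
    moreover have "rprod as m i j \<le> ys 0 i j" for m
      unfolding split[of m]
      by (rule mprod_ge(1)[OF Ru ysu]) (rule nonneg[OF Rt] nonneg[OF ys])+
    ultimately obtain l where "(\<lambda>m. rprod as m i j) \<longlonglongrightarrow> l"
      using incseq_convergent[of "\<lambda>m. rprod as m i j" "ys 0 i j"] by blast
    thus ?thesis ..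
  qed
  hence "\<forall>i. \<exists>p. \<forall>j. (\<lambda>m. rprod as m i j) \<longlonglongrightarrow> p j" by (intro allI choice)
  then obtain p where p: "\<And>i j. (\<lambda>m. rprod as m i j) \<longlonglongrightarrow> p i j" using choice by metis
  have "\<exists>l. (\<lambda>m. ys m i j) \<longlonglongrightarrow> l" for i j
  proof -
    have "decseq (\<lambda>m. ys m i j)"
    proof (rule decseq_SucI)
      fix m
      have "ys (Suc m) i j \<le> (as m \<star> ys (Suc m)) i j"
        by (rule mprod_ge(2)[OF asu ysu]) (rule nonneg[OF ast] nonneg[OF ys])+
      thus "ys (Suc m) i j \<le> ys m i j" unfolding fact[symmetric] .
    qed
    moreover have "0 \<le> ys m i j" for m by (rule nonneg[OF ys])
    ultimately obtain l where "(\<lambda>m. ys m i j) \<longlonglongrightarrow> l"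
      using decseq_convergent[of "\<lambda>m. ys m i j" 0] by blast
    thus ?thesis ..
  qed
  hence "\<forall>i. \<exists>y. \<forall>j. (\<lambda>m. ys m i j) \<longlonglongrightarrow> y j" by (intro allI choice)
  then obtain y where y: "\<And>i j. (\<lambda>m. ys m i j) \<longlonglongrightarrow> y i j" using choice by metis
  have "p \<in> unipotent n" by (rule unipotent_limit[OF Ru p])
  hence "p \<in> right_limit n" by (rule right_limit_limit[OF as _ p])
  moreover have "y \<in> unipotent_tnn n" by (rule unipotent_tnn_limit[OF ys y])
  moreover have "ys 0 = p \<star> y"
  proof (intro ext)
    fix i j
    have "(\<lambda>m. ys 0 i j) \<longlonglongrightarrow> (p \<star> y) i j"
      using mprod_limit[of "rprod as" p ys y i j, OF p y] unfolding split[symmetric] .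
    thus "ys 0 i j = (p \<star> y) i j" by (simp add: LIMSEQ_const_iff)
  qed
  ultimately show ?thesis using y by (intro that)
qed

text \<open>
  For \<open>n = 1\<close> there are no generators, hence the guard \<open>n \<ge> 2\<close>.
\<close>

definition left_prime :: "nat \<Rightarrow> (int \<Rightarrow> int \<Rightarrow> real) \<Rightarrow> bool" where
  "left_prime n y \<longleftrightarrow> (\<forall>k c. n \<ge> 2 \<longrightarrow> c > 0 \<longrightarrow> gen n k (- c) \<star> y \<notin> unipotent_tnn n)"

text \<open>
  The factor \<open>a (ys m)\<close> is chosen with at least half of the largest possible weight. If a generator of
  weight \<open>w > 0\<close> divided the limit \<open>y\<close>, then for every \<open>m\<close> the tail product from \<open>m\<close> on, followed by this
  generator, would divide \<open>ys m\<close>; so the chosen weights would be at least \<open>w / 2\<close> and could not be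
  summable.
\<close>

lemma maximal_left_factor:
  assumes x: "x \<in> unipotent_tnn n"
  obtains a y where "a \<in> right_limit n" "y \<in> unipotent_tnn n" "x = a \<star> y" "left_prime n y"
proof -
  define W where "W = (\<lambda>y. {weight n a | a z. a \<in> right_limit n \<and> z \<in> unipotent_tnn n \<and> y = a \<star> z})"
  have weight_split: "weight n y = weight n a + weight n z"
    if "a \<in> right_limit n" "z \<in> unipotent_tnn n" "y = a \<star> z" for y a z
    using that weight_mprod[of a n z] right_limit_unipotent_tnn[of a n] unipotent_tnnD(1) by blast
  have W_I: "weight n a \<in> W y" if "a \<in> right_limit n" "z \<in> unipotent_tnn n" "y = a \<star> z" for a z y
    unfolding W_def using that by blast
  have bdd: "bdd_above (W y)" for y
  proof (rule bdd_aboveI)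
    fix w assume "w \<in> W y"
    then obtain a z where "w = weight n a" "a \<in> right_limit n" "z \<in> unipotent_tnn n" "y = a \<star> z"
      unfolding W_def by blast
    thus "w \<le> weight n y" using weight_split[of a z y] weight_nonneg[of z n] by simp
  qed
  have "\<exists>a z. a \<in> right_limit n \<and> z \<in> unipotent_tnn n \<and> y = a \<star> z \<and> Sup (W y) \<le> 2 * weight n a"
    if y: "y \<in> unipotent_tnn n" for y
  proof -
    have triv: "idm \<in> right_limit n" "y = idm \<star> y"
      using right_limit_intros(1) mprod_idm_left[OF unipotent_tnnD(1)[OF y]] by auto
    have "weight n idm = 0" by (simp add: weight_def idm_def)
    hence "0 \<in> W y" using W_I[OF triv(1) y triv(2)] by simp
    show ?thesis
    proof (cases "Sup (W y) \<le> 0")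
      case True
      have "Sup (W y) \<le> 2 * weight n idm" using True \<open>weight n idm = 0\<close> by simp
      with triv y show ?thesis by blast
    next
      case False
      hence "Sup (W y) / 2 < Sup (W y)" by simp
      then obtain w where w: "w \<in> W y" "Sup (W y) / 2 < w"
        using less_cSup_iff[OF _ bdd] \<open>0 \<in> W y\<close> by blast
      obtain a z where az: "w = weight n a" "a \<in> right_limit n" "z \<in> unipotent_tnn n" "y = a \<star> z"
        using w(1) unfolding W_def by blast
      from w(2) az(1) have "Sup (W y) \<le> 2 * weight n a" by simp
      with az(2-4) show ?thesis by blast
    qed
  qed
  then obtain a z where az: "\<And>y. y \<in> unipotent_tnn n \<Longrightarrow>
      a y \<in> right_limit n \<and> z y \<in> unipotent_tnn n \<and> y = a y \<star> z y \<and> Sup (W y) \<le> 2 * weight n (a y)"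
    by metis
  define ys where "ys = rec_nat x (\<lambda>_. z)"
  have ys_simps: "ys 0 = x" "ys (Suc m) = z (ys m)" for m by (simp_all add: ys_def)
  have ys: "ys m \<in> unipotent_tnn n" for m
  proof (induction m)
    case (Suc m)
    show ?case unfolding ys_simps using az[OF Suc] by blast
  qed (simp add: ys_simps x)
  define as where "as = (\<lambda>m. a (ys m))"
  have as: "as m \<in> right_limit n" "ys m = as m \<star> ys (Suc m)" "Sup (W (ys m)) \<le> 2 * weight n (as m)" for m
    unfolding as_def ys_simps using az[OF ys[of m]] by blast+
  obtain p y where py: "p \<in> right_limit n" "y \<in> unipotent_tnn n" "\<And>i j. (\<lambda>m. ys m i j) \<longlonglongrightarrow> y i j" "x = p \<star> y"
    using infinite_factorization[of ys n as, OF ys as(1,2)] unfolding ys_simps(1) by blast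
  have small: "(\<lambda>m. weight n (as m)) \<longlonglongrightarrow> 0"
  proof -
    have "(\<Sum>m<M. weight n (as m)) + weight n (ys M) = weight n x" for M
    proof (induction M)
      case (Suc M)
      thus ?case using weight_split[OF as(1) ys as(2), of M] by simp
    qed (simp add: ys_simps)
    hence "(\<Sum>m<M. weight n (as m)) \<le> weight n x" for M
      using weight_nonneg[OF ys, of M] by (metis add_increasing2 order_refl)
    hence bound: "(\<Sum>m\<le>M. weight n (as m)) \<le> weight n x" for M
      by (simp only: lessThan_Suc_atMost[symmetric])
    have "summable (\<lambda>m. weight n (as m))"
      by (rule bounded_imp_summable[OF weight_nonneg[OF right_limit_unipotent_tnn[OF as(1)]] bound])
    thus ?thesis by (rule summable_LIMSEQ_zero)
  qed
  have "left_prime n y"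
    unfolding left_prime_def
  proof (intro allI impI notI)
    fix k c assume n: "n \<ge> 2" and c: "(c::real) > 0" and div: "gen n k (- c) \<star> y \<in> unipotent_tnn n"
    let ?g = "gen n k c"
    have yu: "y \<in> unipotent n" using py(2) by (rule unipotent_tnnD)
    have yg: "y = ?g \<star> (gen n k (- c) \<star> y)"
      unfolding mprod_assoc[OF gen_unipotent gen_unipotent yu, symmetric] gen_inverse[OF n]
      by (rule mprod_idm_left[OF yu, symmetric])
    have g: "?g \<in> right_limit n" by (rule right_limit_intros(2)) (use n c in simp_all)
    have bound: "weight n ?g \<le> 2 * weight n (as m)" for m
    proof -
      \<comment> \<open>The remainders of the shifted factorization have the same limit \<open>y\<close>.\<close>
      have fact: "ys (l + m) = as (l + m) \<star> ys (Suc l + m)" for l using as(2)[of "l + m"] by simp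
      obtain q y' where q: "q \<in> right_limit n" "y' \<in> unipotent_tnn n"
          "\<And>i j. (\<lambda>l. ys (l + m) i j) \<longlonglongrightarrow> y' i j" "ys (0 + m) = q \<star> y'"
        by (rule infinite_factorization[of "\<lambda>l. ys (l + m)" n "\<lambda>l. as (l + m)", OF ys as(1) fact]) blast
      have "y' = y"
      proof (intro ext)
        fix i j
        show "y' i j = y i j"
          by (rule LIMSEQ_unique[OF q(3) LIMSEQ_ignore_initial_segment[OF py(3)]])
      qed
      note qu = unipotent_tnnD(1)[OF right_limit_unipotent_tnn[OF q(1)]]
      have "ys m = (q \<star> ?g) \<star> (gen n k (- c) \<star> y)"
        unfolding mprod_assoc[OF qu gen_unipotent unipotent_tnnD(1)[OF div]] yg[symmetric]
        using q(4) \<open>y' = y\<close> by simp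
      hence "weight n (q \<star> ?g) \<in> W (ys m)"
        by (rule W_I[OF right_limit_intros(3)[OF q(1) g] div])
      hence le: "weight n (q \<star> ?g) \<le> Sup (W (ys m))" by (rule cSup_upper[OF _ bdd])
      have eq: "weight n (q \<star> ?g) = weight n q + weight n ?g" by (rule weight_mprod[OF qu gen_unipotent])
      have "weight n q \<ge> 0" by (rule weight_nonneg[OF right_limit_unipotent_tnn[OF q(1)]])
      thus ?thesis using le eq as(3)[of m] by linarith
    qed
    have "(\<lambda>m. 2 * weight n (as m)) \<longlonglongrightarrow> 2 * 0" by (rule tendsto_mult_left[OF small])
    hence "weight n ?g \<le> 2 * 0" by (rule LIMSEQ_le_const) (intro exI allI impI bound)
    moreover have "weight n ?g > 0" by (rule weight_gen_pos) (use n c in auto)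
    ultimately show False by simp
  qed
  thus ?thesis by (rule that[OF py(1,2,4)])
qed

section \<open>Matrices without a left Chevalley factor\<close>

text \<open>
  Add row \<open>i + 1\<close> and column \<open>j\<close> to the minor, expand along column \<open>j\<close>, divide by \<open>y (i + 1) j\<close> and let
  \<open>j\<close> tend along \<open>F\<close>. The expansion has the right sign pattern, the terms of the rows above \<open>i\<close>
  disappear, and the terms of rows \<open>i\<close> and \<open>i + 1\<close> give the two minors in the claim. The filter
  \<open>F\<close> is \<open>at_top\<close> for infinite rows; for finite rows it is concentrated on a single column.
\<close>

lemma row_op_minor_limit:
  assumes tnn: "totally_nonneg y" and F: "F \<noteq> bot"
    and r: "strict_mono_on {..<Suc p} r" and c: "strict_mono_on {..<Suc p} c" and rp: "r p = i"
    and large: "eventually (\<lambda>j. c p < j) F" and pos: "eventually (\<lambda>j. y (i + 1) j > 0) F"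
    and lim: "((\<lambda>j. y i j / y (i + 1) j) \<longlongrightarrow> a) F"
    and above: "\<And>k. k < i \<Longrightarrow> ((\<lambda>j. y k j / y (i + 1) j) \<longlongrightarrow> 0) F"
  shows "minor y (Suc p) r c + (- a) * minor y (Suc p) (r(p := i + 1)) c \<ge> 0"
proof -
  define r' where "r' = r(Suc p := i + 1)"
  define M where "M = (\<lambda>q. sq_det (Suc p) (\<lambda>u v. y (r' (skip q u)) (c v)))"
  have r_lt: "r q < i" if "q < p" for q using strict_mono_onD[OF r, of q p] that rp by simp
  have r': "strict_mono_on {..<Suc (Suc p)} r'"
    unfolding strict_mono_on_def
  proof safe
    fix u v assume uv: "u < Suc (Suc p)" "v < Suc (Suc p)" "u < v"
    show "r' u < r' v"
    proof (cases "v = Suc p")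
      case True
      have "r u \<le> i" using r_lt[of u] rp uv True by (cases "u = p") auto
      thus ?thesis using True uv by (simp add: r'_def)
    next
      case False
      thus ?thesis using strict_mono_onD[OF r, of u v] uv by (simp add: r'_def)
    qed
  qed
  have nonneg: "0 \<le> (\<Sum>q<Suc (Suc p). y (r' q) j / y (i + 1) j * ((-1) ^ (q + Suc p) * M q))"
    if j: "c p < j" "y (i + 1) j > 0" for j
  proof -
    define c' where "c' = c(Suc p := j)"
    have c': "strict_mono_on {..<Suc (Suc p)} c'"
      unfolding strict_mono_on_def
    proof safe
      fix u v assume uv: "u < Suc (Suc p)" "v < Suc (Suc p)" "u < v"
      show "c' u < c' v"
      proof (cases "v = Suc p")
        case True
        have "c u \<le> c p" using strict_mono_onD[OF c, of u p] uv True by (cases "u = p") auto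
        thus ?thesis using True uv j(1) by (simp add: c'_def)
      next
        case False
        thus ?thesis using strict_mono_onD[OF c, of u v] uv by (simp add: c'_def)
      qed
    qed
    let ?N = "\<lambda>u v. y (r' u) (c' v)"
    have "0 \<le> minor y (Suc (Suc p)) r' c'" using tnn r' c' by (auto simp: totally_nonneg_minor)
    also have "\<dots> = (\<Sum>q<Suc (Suc p). sq_mat (Suc (Suc p)) ?N $$ (q, Suc p) * cofactor (sq_mat (Suc (Suc p)) ?N) q (Suc p))"
      unfolding minor_def sq_det_def by (rule laplace_expansion_column) auto
    also have "\<dots> = (\<Sum>q<Suc (Suc p). y (r' q) j * ((-1) ^ (q + Suc p) * M q))"
    proof (rule sum.cong)
      fix q assume q: "q \<in> {..<Suc (Suc p)}"
      have "sq_det (Suc p) (\<lambda>u v. ?N (skip q u) (skip (Suc p) v)) = M q"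
        unfolding M_def by (rule sq_det_cong) (simp add: skip_def c'_def)
      thus "sq_mat (Suc (Suc p)) ?N $$ (q, Suc p) * cofactor (sq_mat (Suc (Suc p)) ?N) q (Suc p)
          = y (r' q) j * ((-1) ^ (q + Suc p) * M q)"
        using q cofactor_sq_mat[of q "Suc p" "Suc p" ?N] by (simp add: c'_def)
    qed simp
    finally have "0 \<le> (\<Sum>q<Suc (Suc p). y (r' q) j * ((-1) ^ (q + Suc p) * M q)) / y (i + 1) j"
      using j(2) by simp
    thus ?thesis by (simp only: sum_divide_distrib times_divide_eq_left)
  qed
  define L where "L = (\<lambda>q. if q < p then 0 else if q = p then a else (1::real))"
  have "((\<lambda>j. \<Sum>q<Suc (Suc p). y (r' q) j / y (i + 1) j * ((-1) ^ (q + Suc p) * M q))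
      \<longlongrightarrow> (\<Sum>q<Suc (Suc p). L q * ((-1) ^ (q + Suc p) * M q))) F"
  proof (intro tendsto_sum tendsto_mult tendsto_const)
    fix q assume "q \<in> {..<Suc (Suc p)}"
    then consider "q < p" | "q = p" | "q = Suc p" by force
    thus "((\<lambda>j. y (r' q) j / y (i + 1) j) \<longlongrightarrow> L q) F"
    proof cases
      case 1
      thus ?thesis using above[OF r_lt[OF 1]] by (simp add: r'_def L_def)
    next
      case 2
      thus ?thesis using lim rp by (simp add: r'_def L_def)
    next
      case 3
      have "((\<lambda>j. y (i + 1) j / y (i + 1) j) \<longlongrightarrow> 1) F"
        by (rule tendsto_eventually) (use pos in \<open>auto elim: eventually_mono\<close>)
      thus ?thesis using 3 by (simp add: r'_def L_def)
    qed
  qed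
  hence "0 \<le> (\<Sum>q<Suc (Suc p). L q * ((-1) ^ (q + Suc p) * M q))"
    by (rule tendsto_lowerbound[OF _ _ F]) (use eventually_conj[OF large pos] nonneg in \<open>auto elim!: eventually_mono\<close>)
  also have "\<dots> = M (Suc p) - a * M p"
  proof -
    have "(\<Sum>q<p. L q * ((-1) ^ (q + Suc p) * M q)) = 0" by (rule sum.neutral) (simp add: L_def)
    thus ?thesis by (simp add: L_def power_add[symmetric] mult_2[symmetric])
  qed
  also have "M (Suc p) = minor y (Suc p) r c"
    unfolding M_def minor_def by (rule sq_det_cong) (simp add: r'_def skip_def)
  also have "M p = minor y (Suc p) (r(p := i + 1)) c"
    unfolding M_def minor_def by (rule sq_det_cong) (simp add: r'_def skip_def)
  finally show ?thesis by simp
qed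

lemma last_row_op_nonneg_shift:
  assumes y: "y \<in> unipotent n" and base: "last_row_op_nonneg y i e" and cong: "[i' = i] (mod int n)"
  shows "last_row_op_nonneg y i' e"
proof -
  obtain q where q: "i' - i = int n * q" using cong by (auto simp: cong_iff_dvd_diff dvd_def)
  hence q: "i' = i + q * int n" by (simp add: algebra_simps)
  have "y (u - q * int n) (v - q * int n) = y u v" for u v
    using unipotent_shift[OF y, of "u - q * int n" q "v - q * int n"] by simp
  hence shift: "minor y m (\<lambda>u. r u - q * int n) (\<lambda>u. c u - q * int n) = minor y m r c" for m r c
    by (intro minor_cong)
  show ?thesis
    unfolding last_row_op_nonneg_def
  proof (intro allI impI)
    fix p and r c :: "nat \<Rightarrow> int"
    assume r: "strict_mono_on {..<Suc p} r" and c: "strict_mono_on {..<Suc p} c" and rp: "r p = i'"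
    let ?r = "\<lambda>u. r u - q * int n" and ?c = "\<lambda>u. c u - q * int n"
    have mono: "strict_mono_on {..<Suc p} ?r" "strict_mono_on {..<Suc p} ?c" "?r p = i"
      using r c rp q by (auto simp: strict_mono_on_def)
    have "minor y (Suc p) ?r ?c + e * minor y (Suc p) (?r(p := i + 1)) ?c \<ge> 0"
      using base[unfolded last_row_op_nonneg_def, rule_format, OF mono] .
    also have "?r(p := i + 1) = (\<lambda>u. (r(p := i' + 1)) u - q * int n)" using q by auto
    finally show "minor y (Suc p) r c + e * minor y (Suc p) (r(p := i' + 1)) c \<ge> 0"
      unfolding shift .
  qed
qed

subsection \<open>Supports of the rows\<close>

text \<open>
  Compare with the diagonal entry \<open>y (i + 1) (i + 1) = 1\<close> in a minor of size 2.
\<close>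

lemma tnn_below_pos:
  assumes "y \<in> unipotent_tnn n" "i < j" "y i j \<noteq> 0"
  shows "y (i + 1) j > 0"
proof (cases "j = i + 1")
  case True
  thus ?thesis using unipotentD(3)[OF unipotent_tnnD(1)[OF assms(1)]] by simp
next
  case False
  note tnn = unipotent_tnnD(2)[OF assms(1)]
  have "y i j * y (i + 1) (i + 1) \<le> y i (i + 1) * y (i + 1) j"
    using totally_nonneg_minor2[OF tnn, of i "i + 1" "i + 1" j] assms(2) False by simp
  moreover have "y i j > 0" using totally_nonneg_entry[OF tnn, of i j] assms(3) by simp
  ultimately have "y (i + 1) j \<noteq> 0" using unipotentD(3)[OF unipotent_tnnD(1)[OF assms(1)]] by auto
  thus ?thesis using totally_nonneg_entry[OF tnn, of "i + 1" j] by simp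
qed

lemma tnn_down_pos:
  assumes y: "y \<in> unipotent_tnn n" and "i \<le> k" "k \<le> j" "y i j \<noteq> 0"
  shows "y k j \<noteq> 0"
  using assms(2,3)
proof (induction k rule: int_ge_induct)
  case (step k)
  thus ?case using tnn_below_pos[OF y, of k j] by auto
qed (use assms in auto)

lemma tnn_left_of_pos:
  assumes y: "y \<in> unipotent_tnn n" and "i \<le> k" "k \<le> j" "y i j \<noteq> 0"
  shows "y i k \<noteq> 0"
proof -
  have "antireflect y (- k) (- i) \<noteq> 0"
    by (rule tnn_down_pos[OF antireflect_unipotent_tnn[OF y], of "- j"]) (use assms in \<open>auto simp: antireflect_def\<close>)
  thus ?thesis by (simp add: antireflect_def)
qed

text \<open>
  A zero at \<open>(i0, j0)\<close> spreads to all entries above and to the right of it; its translates by multiples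
  of the period bound the support of every row.
\<close>

lemma finite_row_supports:
  assumes y: "y \<in> unipotent_tnn n" and n: "n \<ge> 1" and z: "i0 \<le> j0" "y i0 j0 = 0"
  obtains l where "\<And>i. y i (l i) \<noteq> 0" "\<And>i j. l i < j \<Longrightarrow> y i j = 0"
proof -
  note yu = unipotent_tnnD(1)[OF y]
  have zero: "y i j = 0" if "i \<le> i0" "j0 \<le> j" for i j
  proof (rule ccontr)
    assume "y i j \<noteq> 0"
    hence "y i0 j \<noteq> 0" using tnn_down_pos[OF y, of i i0 j] that z by auto
    hence "y i0 j0 \<noteq> 0" using tnn_left_of_pos[OF y, of i0 j0 j] that z by auto
    thus False using z by simp
  qed
  have "\<exists>l. y i l \<noteq> 0 \<and> (\<forall>j>l. y i j = 0)" for i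
  proof -
    define q where "q = \<bar>i\<bar> + \<bar>i0\<bar>"
    have "q * 1 \<le> q * int n" using n by (intro mult_left_mono) (auto simp: q_def)
    hence "i - q * int n \<le> i0" by (simp add: q_def)
    hence vanish: "y i j = 0" if "j0 + q * int n \<le> j" for j
      using zero[of "i - q * int n" "j - q * int n"] unipotent_shift[OF yu, of "i - q * int n" q "j - q * int n"] that by simp
    let ?S = "{j. y i j \<noteq> 0}"
    have "?S \<subseteq> {i..j0 + q * int n}"
    proof
      fix j assume "j \<in> ?S"
      thus "j \<in> {i..j0 + q * int n}" using vanish[of j] unipotentD(2)[OF yu, of j i] by force
    qed
    hence fin: "finite ?S" using finite_subset by blast
    have ne: "i \<in> ?S" using unipotentD(3)[OF yu] by simp
    have "Max ?S \<in> ?S" using Max_in[OF fin] ne by blast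
    moreover have "y i j = 0" if "j > Max ?S" for j using Max_ge[OF fin, of j] that by force
    ultimately show ?thesis by blast
  qed
  then obtain l where "\<And>i. y i (l i) \<noteq> 0 \<and> (\<forall>j>l i. y i j = 0)" by metis
  thus ?thesis using that by blast
qed

text \<open>
  The unfolded form of entireness: Cauchy's estimate for every radius, uniformly in the entries.
\<close>

definition rapidly_decreasing :: "(int \<Rightarrow> int \<Rightarrow> real) \<Rightarrow> bool" where
  "rapidly_decreasing x \<longleftrightarrow> (\<forall>r>0. \<exists>C. \<forall>i j. i \<le> j \<longrightarrow> \<bar>x i j\<bar> * r ^ nat (j - i) \<le> C)"

lemma periodic_bounded:
  fixes f :: "int \<Rightarrow> real"
  assumes "n \<ge> 1" "\<And>i. f (i + int n) = f i"
  obtains k where "\<And>i. f i \<le> f k"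
proof -
  have shift: "f (a + int m * int n) = f a" for a m
  proof (induction m)
    case (Suc m)
    have "a + int (Suc m) * int n = (a + int m * int n) + int n" by (simp add: algebra_simps)
    thus ?case using assms(2) Suc by metis
  qed simp
  have red: "f i = f (i mod int n)" for i
  proof (cases "i div int n \<ge> 0")
    case True
    thus ?thesis using shift[of "i mod int n" "nat (i div int n)"] by (simp add: minus_mod_eq_div_mult[symmetric])
  next
    case False
    thus ?thesis using shift[of i "nat (- (i div int n))"] by (simp add: minus_div_mult_eq_mod[symmetric])
  qed
  have fin: "finite (f ` {0..<int n})" by simp
  have "Max (f ` {0..<int n}) \<in> f ` {0..<int n}" by (rule Max_in[OF fin]) (use assms(1) in auto)
  then obtain k where k: "Max (f ` {0..<int n}) = f k" by blast
  have "f i \<le> f k" for i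
    unfolding k[symmetric] red[of i] by (rule Max_ge[OF fin]) (use assms(1) in auto)
  thus ?thesis using that by blast
qed

text \<open>
  The equation \<open>y \<star> z = idm\<close> expresses \<open>z (i + d) j\<close> linearly by the \<open>d\<close> entries above it in column
  \<open>j\<close>, with coefficients bounded by periodicity. Hence entries grow at most geometrically going down a
  column, by a factor \<open>K\<close> at each step. As they reach the value 1 on the diagonal, they cannot have
  started out smaller than a geometric sequence.
\<close>

lemma banded_inverse_not_rapidly_decreasing:
  assumes y: "y \<in> unipotent n" and n: "n \<ge> 1" and d: "d \<ge> 1"
    and top: "\<And>i. y i (i + int d) \<noteq> 0" and band: "\<And>i j. i + int d < j \<Longrightarrow> y i j = 0"
  shows "\<not> rapidly_decreasing (right_inv y)"
proof
  assume rapid: "rapidly_decreasing (right_inv y)"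
  define z where "z = right_inv y"
  note zu = right_inv_unipotent[OF y, folded z_def]
  define Q where "Q = (\<lambda>i. \<Sum>m<d. \<bar>y i (i + int m)\<bar> / \<bar>y i (i + int d)\<bar>)"
  have "Q (i + int n) = Q i" for i
  proof -
    have "y (i + int n) (i + int n + int m) = y i (i + int m)" for m
      using unipotentD(1)[OF y, of i "i + int m"] by (simp add: ac_simps)
    thus ?thesis by (simp only: Q_def)
  qed
  then obtain k where k: "\<And>i. Q i \<le> Q k" using periodic_bounded[of n Q] n by blast
  define K where "K = Q k + 1"
  have Qnn: "0 \<le> Q i" for i unfolding Q_def by (intro sum_nonneg) auto
  have K1: "K \<ge> 1" using Qnn by (simp add: K_def)
  have rec: "\<bar>z (i + int d) j\<bar> \<le> (\<Sum>m<d. \<bar>y i (i + int m)\<bar> / \<bar>y i (i + int d)\<bar> * \<bar>z (i + int m) j\<bar>)" if "i < j" for i j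
  proof -
    have "0 = (y \<star> z) i j" using mprod_right_inv[OF y] that by (simp add: z_def idm_def)
    also have "\<dots> = (\<Sum>k=i..j + int d. y i k * z k j)" by (rule mprod_extend[OF y zu]) auto
    also have "\<dots> = (\<Sum>k=i..i + int d. y i k * z k j)"
      by (rule sum.mono_neutral_right) (use that band in auto)
    also have "\<dots> = (\<Sum>m<Suc d. y i (i + int m) * z (i + int m) j)"
      by (rule sum.reindex_bij_witness[where i = "\<lambda>m. i + int m" and j = "\<lambda>k. nat (k - i)"]) auto
    finally have "y i (i + int d) * z (i + int d) j = - (\<Sum>m<d. y i (i + int m) * z (i + int m) j)" by simp
    hence "\<bar>y i (i + int d)\<bar> * \<bar>z (i + int d) j\<bar> = \<bar>\<Sum>m<d. y i (i + int m) * z (i + int m) j\<bar>"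
      by (metis abs_minus_cancel abs_mult)
    also have "\<dots> \<le> (\<Sum>m<d. \<bar>y i (i + int m)\<bar> * \<bar>z (i + int m) j\<bar>)"
      by (rule order.trans[OF sum_abs]) (simp add: abs_mult)
    finally have "\<bar>z (i + int d) j\<bar> \<le> (\<Sum>m<d. \<bar>y i (i + int m)\<bar> * \<bar>z (i + int m) j\<bar>) / \<bar>y i (i + int d)\<bar>"
      using top[of i] by (simp add: field_simps)
    thus ?thesis by (simp add: sum_divide_distrib)
  qed
  have growth: "\<bar>z (i0 + int t) j\<bar> \<le> \<eta> * K ^ t"
    if init: "\<And>m. m < d \<Longrightarrow> \<bar>z (i0 + int m) j\<bar> \<le> \<eta>" and t: "i0 + int t < j + int d" for i0 j \<eta> t
    using t
  proof (induction t rule: less_induct)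
    case (less t)
    have \<eta>: "\<eta> \<ge> 0" using init[of 0] d by simp
    show ?case
    proof (cases "t < d")
      case True
      have "\<eta> * 1 \<le> \<eta> * K ^ t" using \<eta> K1 by (intro mult_left_mono one_le_power) auto
      thus ?thesis using init[OF True] by simp
    next
      case False
      define i where "i = i0 + int (t - d)"
      have it: "i + int d = i0 + int t" using False by (simp add: i_def)
      have "\<bar>z (i + int m) j\<bar> \<le> \<eta> * K ^ (t - 1)" if "m < d" for m
      proof -
        have "i + int m = i0 + int (t - d + m)" by (simp add: i_def)
        moreover have "\<bar>z (i0 + int (t - d + m)) j\<bar> \<le> \<eta> * K ^ (t - d + m)"
          by (rule less.IH) (use that False less.prems in auto)
        moreover have "\<eta> * K ^ (t - d + m) \<le> \<eta> * K ^ (t - 1)"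
          using \<eta> K1 that False by (intro mult_left_mono power_increasing) auto
        ultimately show ?thesis by (simp only:)
      qed
      hence "(\<Sum>m<d. \<bar>y i (i + int m)\<bar> / \<bar>y i (i + int d)\<bar> * \<bar>z (i + int m) j\<bar>)
          \<le> (\<Sum>m<d. \<bar>y i (i + int m)\<bar> / \<bar>y i (i + int d)\<bar> * (\<eta> * K ^ (t - 1)))"
        by (intro sum_mono mult_left_mono) auto
      also have "\<dots> = Q i * (\<eta> * K ^ (t - 1))" by (simp only: Q_def sum_distrib_right)
      also have "\<dots> \<le> K * (\<eta> * K ^ (t - 1))"
        using k[of i] \<eta> K1 by (intro mult_right_mono) (auto simp: K_def)
      also have "\<dots> = \<eta> * K ^ t" using False d by (cases t) (auto simp: mult_ac)
      finally show ?thesis using rec[of i j] it less.prems by simp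
    qed
  qed
  obtain C where C: "\<And>i j. i \<le> j \<Longrightarrow> \<bar>z i j\<bar> * (2 * K) ^ nat (j - i) \<le> C"
  proof -
    have "2 * K > 0" using K1 by simp
    thus ?thesis using rapid that unfolding rapidly_decreasing_def z_def by blast
  qed
  \<comment> \<open>Start \<open>d + s\<close> rows above the diagonal; the radius \<open>2 K\<close> beats the growth factor \<open>K\<close>.\<close>
  have bound: "2 ^ s \<le> C * K ^ d" for s
  proof -
    have "\<bar>z (- int (d + s) + int m) 0\<bar> \<le> C / (2 * K) ^ s" if m: "m < d" for m
    proof -
      have "nat (0 - (- int (d + s) + int m)) = s + (d - m)" using m by simp
      hence "\<bar>z (- int (d + s) + int m) 0\<bar> * (2 * K) ^ (s + (d - m)) \<le> C"
        using C[of "- int (d + s) + int m" 0] m by simp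
      moreover have "\<bar>z (- int (d + s) + int m) 0\<bar> * (2 * K) ^ s \<le> \<bar>z (- int (d + s) + int m) 0\<bar> * (2 * K) ^ (s + (d - m))"
        using K1 by (intro mult_left_mono power_increasing) auto
      ultimately show ?thesis using K1 by (simp add: pos_le_divide_eq)
    qed
    from growth[of "- int (d + s)" 0 "C / (2 * K) ^ s" "d + s", OF this]
    have "\<bar>z 0 0\<bar> \<le> C / (2 * K) ^ s * K ^ (d + s)" using d by simp
    also have "\<bar>z 0 0\<bar> = 1" by (simp add: unipotentD(3)[OF zu])
    finally have "(2 * K) ^ s \<le> C * K ^ (d + s)" using K1 by (simp add: field_simps)
    hence "2 ^ s * K ^ s \<le> C * K ^ d * K ^ s" by (simp add: power_mult_distrib power_add mult_ac)
    thus ?thesis using K1 by simp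
  qed
  obtain s :: nat where "C * K ^ d < 2 ^ s" using real_arch_pow[of 2 "C * K ^ d"] by auto
  thus False using bound[of s] by simp
qed

text \<open>
  Let \<open>l i\<close> be the last column in the support of row \<open>i\<close>. At a corner, where
  \<open>l (i - 1) < l i = l (i + 1)\<close>, the column \<open>l i\<close> vanishes above row \<open>i\<close> and
  \<open>row_op_minor_limit\<close> splits off a generator. Without corners, \<open>l\<close> is strictly increasing, since
  otherwise it would be constant towards \<open>-\<infinity>\<close>; being monotone with \<open>l (i + n) = l i + n\<close>, it is then a
  shift \<open>i + d\<close>. The banded case excludes \<open>d > 0\<close>.
\<close>

lemma left_prime_finite_case:
  assumes y: "y \<in> unipotent_tnn n" and n: "n \<ge> 1" and prime: "left_prime n y"
    and rapid: "rapidly_decreasing (right_inv y)" and z: "i0 \<le> j0" "y i0 j0 = 0"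
  shows "y = idm"
proof -
  note yu = unipotent_tnnD(1)[OF y] and tnn = unipotent_tnnD(2)[OF y]
  obtain l where l: "\<And>i. y i (l i) \<noteq> 0" "\<And>i j. l i < j \<Longrightarrow> y i j = 0"
    by (rule finite_row_supports[OF y n z]) blast
  have l_ge: "i \<le> l i" for i using l(1)[of i] unipotentD(2)[OF yu, of "l i" i] by force
  have l_eq: "l i = j" if "y i j \<noteq> 0" "\<And>j'. j < j' \<Longrightarrow> y i j' = 0" for i j
    using l(1)[of i] l(2)[of i j] that(1) that(2)[of "l i"] by force
  have l_shift: "l (i + int n) = l i + int n" for i
  proof (rule l_eq)
    show "y (i + int n) (l i + int n) \<noteq> 0" using unipotentD(1)[OF yu] l(1) by simp
    show "y (i + int n) j = 0" if "l i + int n < j" for j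
      using unipotentD(1)[OF yu, of i "j - int n"] l(2)[of i "j - int n"] that by simp
  qed
  have l_mono: "l i \<le> l (i + 1)" for i
  proof (cases "l i = i")
    case True
    thus ?thesis using l_ge[of "i + 1"] by simp
  next
    case False
    hence "y (i + 1) (l i) > 0" using tnn_below_pos[OF y, of i "l i"] l_ge[of i] l(1)[of i] by simp
    thus ?thesis using l(2)[of "i + 1" "l i"] by force
  qed
  have no_corner: False if corner: "l (i - 1) < l i" "l i = l (i + 1)" for i
  proof -
    have n2: "n \<ge> 2"
    proof (rule ccontr)
      assume "\<not> n \<ge> 2"
      hence "n = 1" using n by simp
      thus False using l_shift[of i] corner by simp
    qed
    define a where "a = y i (l i) / y (i + 1) (l i)"
    have nn: "y u v \<ge> 0" for u v by (rule totally_nonneg_entry[OF tnn])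
    have apos: "a > 0" using l(1)[of i] l(1)[of "i + 1"] nn corner by (simp add: a_def less_le)
    have base: "last_row_op_nonneg y i (- a)"
      unfolding last_row_op_nonneg_def
    proof (intro allI impI)
      fix p and r c :: "nat \<Rightarrow> int"
      assume r: "strict_mono_on {..<Suc p} r" and c: "strict_mono_on {..<Suc p} c" and rp: "r p = i"
      let ?J = "l i"
      have before: "y k j = 0" if "k < i" "?J \<le> j" for k j
      proof (rule ccontr)
        assume "y k j \<noteq> 0"
        moreover have "i - 1 \<le> j" using l_ge[of i] that by simp
        ultimately have "y (i - 1) j \<noteq> 0" using tnn_down_pos[OF y, of k "i - 1" j] that by simp
        thus False using l(2)[of "i - 1" j] corner that by simp
      qed
      show "minor y (Suc p) r c + (- a) * minor y (Suc p) (r(p := i + 1)) c \<ge> 0"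
      proof (cases "c p < ?J")
        case True
        show ?thesis
        proof (rule row_op_minor_limit[OF tnn _ r c rp, where F = "principal {?J}"])
          show "((\<lambda>j. y i j / y (i + 1) j) \<longlongrightarrow> a) (principal {?J})"
            by (rule tendsto_eventually) (simp add: eventually_principal a_def)
          show "((\<lambda>j. y k j / y (i + 1) j) \<longlongrightarrow> 0) (principal {?J})" if "k < i" for k
            by (rule tendsto_eventually) (use before[OF that] in \<open>simp add: eventually_principal\<close>)
          show "eventually (\<lambda>j. y (i + 1) j > 0) (principal {?J})"
            using l(1)[of "i + 1"] nn corner by (simp add: eventually_principal less_le)
        qed (use True in \<open>auto simp: eventually_principal principal_eq_bot_iff\<close>)
      next
        \<comment> \<open>The last column then meets the chosen rows at most in the last one, so both minors
          are multiples of the same minor.\<close>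
        case False
        have rlt: "r q < i" if "q < p" for q using strict_mono_onD[OF r, of q p] that rp by simp
        define M where "M = sq_det p (\<lambda>u v. y (r u) (c v))"
        have expand: "minor y (Suc p) s c = y (s p) (c p) * M" if s: "\<And>q. q < p \<Longrightarrow> s q = r q" for s
        proof -
          let ?N = "\<lambda>u v. y (s u) (c v)"
          have "minor y (Suc p) s c = (\<Sum>q<Suc p. sq_mat (Suc p) ?N $$ (q, p) * cofactor (sq_mat (Suc p) ?N) q p)"
            unfolding minor_def sq_det_def by (rule laplace_expansion_column) auto
          also have "\<dots> = y (s p) (c p) * cofactor (sq_mat (Suc p) ?N) p p"
          proof -
            have "(\<Sum>q<p. sq_mat (Suc p) ?N $$ (q, p) * cofactor (sq_mat (Suc p) ?N) q p) = 0"
              by (rule sum.neutral) (use False s before rlt in auto)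
            thus ?thesis by simp
          qed
          also have "cofactor (sq_mat (Suc p) ?N) p p = M"
            unfolding cofactor_sq_mat[OF lessI lessI] M_def
            by (simp add: mult_2[symmetric]) (rule sq_det_cong, simp add: skip_def s)
          finally show ?thesis .
        qed
        have "y i (c p) = a * y (i + 1) (c p)"
        proof (cases "c p = ?J")
          case True
          thus ?thesis using l(1)[of "i + 1"] corner by (simp add: a_def)
        next
          case False': False
          thus ?thesis using l(2)[of i "c p"] l(2)[of "i + 1" "c p"] False corner by simp
        qed
        thus ?thesis using expand[of r] expand[of "r(p := i + 1)"] rp by simp
      qed
    qed
    have "gen n i (- a) \<star> y \<in> unipotent_tnn n"
      by (rule gen_mprod_tnn[OF y n2 last_row_op_nonneg_shift[OF yu base]])
    thus False using prime n2 apos by (auto simp: left_prime_def)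
  qed
  have l_strict: "l i < l (i + 1)" for i
  proof (rule ccontr)
    assume "\<not> l i < l (i + 1)"
    hence eq: "l i = l (i + 1)" using l_mono[of i] by simp
    have "l (i - int m) = l (i + 1) \<and> l (i - int m + 1) = l (i + 1)" for m
    proof (induction m)
      case (Suc m)
      have "l (i - int m - 1) = l (i - int m)"
        using no_corner[of "i - int m"] Suc l_mono[of "i - int m - 1"] by force
      moreover have "i - int m - 1 = i - int (Suc m)" by simp
      ultimately show ?case using Suc by simp
    qed (simp add: eq)
    from this[of n] show False using l_shift[of "i - int n"] eq n by simp
  qed
  have l_add: "l i + int m \<le> l (i + int m)" for i m
  proof (induction m)
    case (Suc m)
    thus ?case using l_strict[of "i + int m"] by (simp add: add.commute add.left_commute)
  qed simp
  have l_step: "l (i + 1) = l i + 1" for i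
  proof -
    have "i + 1 + int (n - 1) = i + int n" using n by simp
    hence "l (i + 1) + int (n - 1) \<le> l (i + int n)" using l_add[of "i + 1" "n - 1"] by simp
    thus ?thesis using l_shift[of i] l_strict[of i] n by simp
  qed
  define d where "d = nat (l 0)"
  have d: "l i = i + int d" for i
  proof (induction i rule: int_induct[where k = 0])
    case base
    show ?case using l_ge[of 0] by (simp add: d_def)
  next
    case (step1 i)
    thus ?case using l_step[of i] by simp
  next
    case (step2 i)
    thus ?case using l_step[of "i - 1"] by simp
  qed
  show ?thesis
  proof (cases "d = 0")
    case True
    show ?thesis
    proof (intro ext)
      fix i j
      show "y i j = idm i j"
        using l(2)[of i j] unipotentD(2)[OF yu, of j i] unipotentD(3)[OF yu, of i] d[of i] True
        by (cases i j rule: linorder_cases) (auto simp: idm_def)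
    qed
  next
    case False
    have "\<not> rapidly_decreasing (right_inv y)"
      by (rule banded_inverse_not_rapidly_decreasing[OF yu n, of d]) (use l d False in auto)
    thus ?thesis using rapid by simp
  qed
qed

subsection \<open>Ratios of neighbouring rows\<close>

text \<open>
  The quotients decrease in \<open>j\<close> by the minors of size 2, so this infimum is the limit \<open>\<epsilon>\<^sub>i\<close>.
\<close>

definition row_ratio :: "(int \<Rightarrow> int \<Rightarrow> real) \<Rightarrow> int \<Rightarrow> real" where
  "row_ratio y i = (INF j\<in>{i + 1..}. y i j / y (i + 1) j)"

lemma row_ratio_limit:
  assumes y: "y \<in> unipotent_tnn n" and pos: "\<And>i j. i \<le> j \<Longrightarrow> y i j > 0"
  shows "row_ratio y i \<ge> 0"
    and "i < j \<Longrightarrow> row_ratio y i * y (i + 1) j \<le> y i j"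
    and "((\<lambda>j. y i j / y (i + 1) j) \<longlongrightarrow> row_ratio y i) at_top"
proof -
  let ?R = "\<lambda>j. y i j / y (i + 1) j"
  have nn: "0 \<le> ?R j" if "i + 1 \<le> j" for j
    using pos[of i j] pos[of "i + 1" j] that by simp
  have bdd: "bdd_below (?R ` {i + 1..})" using nn by (intro bdd_belowI[of _ 0]) auto
  have anti: "?R k \<le> ?R j" if "i + 1 \<le> j" "j \<le> k" for j k
  proof (cases "j = k")
    case False
    have "y i k * y (i + 1) j \<le> y i j * y (i + 1) k"
      using totally_nonneg_minor2[OF unipotent_tnnD(2)[OF y], of i "i + 1" j k] that False by simp
    thus ?thesis using pos[of "i + 1" j] pos[of "i + 1" k] that by (simp add: field_simps)
  qed simp
  show "row_ratio y i \<ge> 0" unfolding row_ratio_def by (rule cINF_greatest) (use nn in auto)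
  have le: "row_ratio y i \<le> ?R j" if "i + 1 \<le> j" for j
    unfolding row_ratio_def by (rule cINF_lower[OF bdd]) (use that in simp)
  show "row_ratio y i * y (i + 1) j \<le> y i j" if "i < j"
    using le[of j] pos[of "i + 1" j] that by (simp add: pos_le_divide_eq)
  show "(?R \<longlongrightarrow> row_ratio y i) at_top"
  proof (rule order_tendstoI)
    fix a assume "a < row_ratio y i"
    hence "a < ?R j" if "i + 1 \<le> j" for j using le[OF that] by simp
    thus "eventually (\<lambda>j. a < ?R j) at_top" by (auto simp: eventually_at_top_linorder)
  next
    fix a assume "row_ratio y i < a"
    then obtain j where "i + 1 \<le> j" "?R j < a"
      unfolding row_ratio_def using cINF_less_iff[OF _ bdd] by auto
    hence "?R k < a" if "j \<le> k" for k using anti[of j k] that by simp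
    thus "eventually (\<lambda>j. ?R j < a) at_top" by (auto simp: eventually_at_top_linorder)
  qed
qed

lemma row_ratio_periodic:
  assumes "y \<in> unipotent n"
  shows "row_ratio y (i + int n) = row_ratio y i"
proof -
  have "(\<lambda>j. y (i + int n) j / y (i + int n + 1) j) ` {i + int n + 1..} = (\<lambda>j. y i j / y (i + 1) j) ` {i + 1..}"
    (is "?f ` ?A = ?g ` ?B")
  proof -
    have eq: "?g j = ?f (j + int n)" for j
      using unipotentD(1)[OF assms, of i j] unipotentD(1)[OF assms, of "i + 1" j] by (simp add: ac_simps)
    have "?A = (\<lambda>j. j + int n) ` ?B"
    proof -
      have "j \<in> (\<lambda>j. j + int n) ` ?B" if "j \<in> ?A" for j
        by (rule image_eqI[of _ _ "j - int n"]) (use that in auto)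
      thus ?thesis by auto
    qed
    thus ?thesis by (simp only: image_image eq)
  qed
  thus ?thesis by (simp only: row_ratio_def)
qed

text \<open>
  The quotient of any row above \<open>i\<close> by row \<open>i + 1\<close> contains the factor \<open>\<epsilon>\<^sub>i\<^sub>-\<^sub>1 = 0\<close> in the limit, which
  is what \<open>row_op_minor_limit\<close> asks for.
\<close>

lemma row_ratio_peak_divides:
  assumes y: "y \<in> unipotent_tnn n" and n: "n \<ge> 2" and pos: "\<And>i j. i \<le> j \<Longrightarrow> y i j > 0"
    and zero: "row_ratio y (i - 1) = 0"
  shows "gen n i (- row_ratio y i) \<star> y \<in> unipotent_tnn n"
proof -
  note yu = unipotent_tnnD(1)[OF y] and tnn = unipotent_tnnD(2)[OF y]
  note lim = row_ratio_limit(3)[OF y pos]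
  have above: "((\<lambda>j. y (i - 1 - int m) j / y (i + 1) j) \<longlongrightarrow> 0) at_top" for m
  proof (induction m)
    case 0
    have "((\<lambda>j. (y (i - 1) j / y i j) * (y i j / y (i + 1) j)) \<longlongrightarrow> 0 * row_ratio y i) at_top"
      using lim[of "i - 1"] zero by (intro tendsto_mult lim[of i]) simp
    moreover have "eventually (\<lambda>j. (y (i - 1) j / y i j) * (y i j / y (i + 1) j) = y (i - 1 - int 0) j / y (i + 1) j) at_top"
      unfolding eventually_at_top_linorder by (rule exI[of _ i]) (use pos[of i] in \<open>force\<close>)
    ultimately show ?case unfolding mult_zero_left by (rule Lim_transform_eventually)
  next
    case (Suc m)
    define k where "k = i - 1 - int (Suc m)"
    have k1: "k + 1 = i - 1 - int m" by (simp add: k_def)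
    have "((\<lambda>j. (y k j / y (k + 1) j) * (y (k + 1) j / y (i + 1) j)) \<longlongrightarrow> row_ratio y k * 0) at_top"
      unfolding k1[symmetric] using Suc lim[of k] by (intro tendsto_mult) (simp_all add: k1)
    moreover have "eventually (\<lambda>j. (y k j / y (k + 1) j) * (y (k + 1) j / y (i + 1) j) = y k j / y (i + 1) j) at_top"
      unfolding eventually_at_top_linorder by (rule exI[of _ "k + 1"]) (use pos[of "k + 1"] in \<open>force\<close>)
    ultimately show ?case unfolding k_def[symmetric] mult_zero_right by (rule Lim_transform_eventually)
  qed
  have base: "last_row_op_nonneg y i (- row_ratio y i)"
    unfolding last_row_op_nonneg_def
  proof (intro allI impI)
    fix p and r c :: "nat \<Rightarrow> int"
    assume r: "strict_mono_on {..<Suc p} r" and c: "strict_mono_on {..<Suc p} c" and rp: "r p = i"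
    show "minor y (Suc p) r c + (- row_ratio y i) * minor y (Suc p) (r(p := i + 1)) c \<ge> 0"
    proof (rule row_op_minor_limit[OF tnn trivial_limit_at_top_linorder r c rp _ _ lim])
      show "eventually (\<lambda>j. c p < j) at_top" by (rule eventually_gt_at_top)
      show "eventually (\<lambda>j. y (i + 1) j > 0) at_top"
        using eventually_ge_at_top[of "i + 1"] by eventually_elim (rule pos)
      show "((\<lambda>j. y k j / y (i + 1) j) \<longlongrightarrow> 0) at_top" if "k < i" for k
        using above[of "nat (i - 1 - k)"] that by simp
    qed
  qed
  show ?thesis by (rule gen_mprod_tnn[OF y n last_row_op_nonneg_shift[OF yu base]])
qed

text \<open>
  If some \<open>\<epsilon>\<^sub>i\<close> is positive and no generator splits off, then all are positive, by descending from \<open>i\<close>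
  and using periodicity. They have a positive lower bound \<open>\<delta>\<close>, and the entries decay at most like
  powers of \<open>\<delta>\<close>.
\<close>

lemma left_prime_infinite_case:
  assumes y: "y \<in> unipotent_tnn n" and n: "n \<ge> 1" and prime: "left_prime n y"
    and rapid: "rapidly_decreasing y" and pos: "\<And>i j. i \<le> j \<Longrightarrow> y i j > 0"
  shows "row_ratio y i = 0"
proof (rule ccontr)
  note yu = unipotent_tnnD(1)[OF y]
  note nn = row_ratio_limit(1)[OF y pos]
  assume i: "row_ratio y i \<noteq> 0"
  have prev: "row_ratio y (k - 1) \<noteq> 0" if "row_ratio y k \<noteq> 0" for k
  proof
    assume zero: "row_ratio y (k - 1) = 0"
    have n2: "n \<ge> 2"
    proof (rule ccontr)
      assume "\<not> n \<ge> 2"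
      hence "n = 1" using n by simp
      thus False using row_ratio_periodic[OF yu, of "k - 1"] zero that by simp
    qed
    have "gen n k (- row_ratio y k) \<star> y \<in> unipotent_tnn n"
      by (rule row_ratio_peak_divides[OF y n2 pos zero])
    thus False using prime n2 nn[of k] that by (auto simp: left_prime_def less_le)
  qed
  have down: "row_ratio y (i - int m) \<noteq> 0" for m
  proof (induction m)
    case (Suc m)
    have eq: "i - int (Suc m) = i - int m - 1" by simp
    show ?case unfolding eq by (rule prev[OF Suc])
  qed (use i in simp)
  have shift: "row_ratio y (a + int m * int n) = row_ratio y a" for a m
  proof (induction m)
    case (Suc m)
    have "a + int (Suc m) * int n = (a + int m * int n) + int n" by (simp add: algebra_simps)
    thus ?case using row_ratio_periodic[OF yu] Suc by metis
  qed simp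
  have all: "row_ratio y k > 0" for k
  proof -
    define m where "m = nat (\<bar>k\<bar> + \<bar>i\<bar>)"
    have "int m * 1 \<le> int m * int n" using n by (intro mult_left_mono) auto
    hence "k - int m * int n \<le> i" by (simp add: m_def)
    then obtain t where "k - int m * int n = i - int t"
      by (metis add_diff_cancel_left' diff_diff_eq2 zle_iff_zadd)
    hence "row_ratio y (k - int m * int n) \<noteq> 0" using down by simp
    moreover have "row_ratio y (k - int m * int n) = row_ratio y k"
      using shift[of "k - int m * int n" m] by simp
    ultimately show ?thesis using nn[of k] by simp
  qed
  obtain k where k: "\<And>j. - row_ratio y j \<le> - row_ratio y k"
    using periodic_bounded[of n "\<lambda>j. - row_ratio y j"] n row_ratio_periodic[OF yu] by auto
  define \<delta> where "\<delta> = row_ratio y k"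
  have \<delta>: "\<delta> > 0" "\<And>j. \<delta> \<le> row_ratio y j" using all k by (auto simp: \<delta>_def)
  have low: "\<delta> ^ m \<le> y (- int m) 0" for m
  proof (induction m)
    case 0
    thus ?case using unipotentD(3)[OF yu] by simp
  next
    case (Suc m)
    have "\<delta> ^ Suc m \<le> row_ratio y (- int (Suc m)) * y (- int m) 0"
      unfolding power_Suc using \<delta> Suc nn by (intro mult_mono) auto
    also have "\<dots> \<le> y (- int (Suc m)) 0"
      using row_ratio_limit(2)[OF y pos, of "- int (Suc m)" 0] by simp
    finally show ?case .
  qed
  have "2 / \<delta> > 0" using \<delta> by simp
  then obtain C where C: "\<And>i j. i \<le> j \<Longrightarrow> \<bar>y i j\<bar> * (2 / \<delta>) ^ nat (j - i) \<le> C"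
    using rapid unfolding rapidly_decreasing_def by blast
  have "2 ^ m \<le> C" for m
  proof -
    have "(2::real) ^ m = \<delta> ^ m * (2 / \<delta>) ^ m" using \<delta>(1) by (simp add: power_divide)
    also have "\<dots> \<le> \<bar>y (- int m) 0\<bar> * (2 / \<delta>) ^ m"
      using low[of m] \<delta>(1) by (intro mult_right_mono) auto
    also have "\<dots> \<le> C" using C[of "- int m" 0] by simp
    finally show ?thesis .
  qed
  moreover obtain m :: nat where "C < 2 ^ m" using real_arch_pow[of 2 C] by auto
  ultimately show False using not_le by blast
qed

lemma left_prime_dichotomy:
  assumes y: "y \<in> unipotent_tnn n" and n: "n \<ge> 1" and prime: "left_prime n y"
    and rapid: "rapidly_decreasing y" "rapidly_decreasing (right_inv y)"
  shows "y = idm \<or> (\<forall>i j. i \<le> j \<longrightarrow> y i j > 0) \<and> (\<forall>i. ((\<lambda>j. y i j / y (i + 1) j) \<longlongrightarrow> 0) at_top)"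
proof (cases "\<forall>i j. i \<le> j \<longrightarrow> y i j > 0")
  case True
  hence pos: "y i j > 0" if "i \<le> j" for i j using that by blast
  have "((\<lambda>j. y i j / y (i + 1) j) \<longlongrightarrow> 0) at_top" for i
    using row_ratio_limit(3)[OF y pos, of i] left_prime_infinite_case[OF y n prime rapid(1) pos, of i] by simp
  thus ?thesis using True by blast
next
  case False
  then obtain i0 j0 where "i0 \<le> j0" "\<not> y i0 j0 > 0" by blast
  hence "y i0 j0 = 0" using totally_nonneg_entry[OF unipotent_tnnD(2)[OF y], of i0 j0] by simp
  thus ?thesis using left_prime_finite_case[OF y n prime rapid(2) \<open>i0 \<le> j0\<close>] by simp
qed

section \<open>The two-sided factorization\<close>

lemma rapidly_decreasing_mono:
  assumes "rapidly_decreasing x" "\<And>i j. \<bar>y i j\<bar> \<le> \<bar>x i j\<bar>"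
  shows "rapidly_decreasing y"
  unfolding rapidly_decreasing_def
proof (intro allI impI)
  fix r :: real assume r: "r > 0"
  then obtain C where C: "\<And>i j. i \<le> j \<Longrightarrow> \<bar>x i j\<bar> * r ^ nat (j - i) \<le> C"
    using assms(1) unfolding rapidly_decreasing_def by blast
  have "\<bar>y i j\<bar> * r ^ nat (j - i) \<le> C" if "i \<le> j" for i j
    by (rule order.trans[OF mult_right_mono[OF assms(2)] C[OF that]]) (use r in auto)
  thus "\<exists>C. \<forall>i j. i \<le> j \<longrightarrow> \<bar>y i j\<bar> * r ^ nat (j - i) \<le> C" by blast
qed

lemma rapidly_decreasing_antireflect:
  assumes "rapidly_decreasing x"
  shows "rapidly_decreasing (antireflect x)"
  unfolding rapidly_decreasing_def
proof (intro allI impI)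
  fix r :: real assume r: "r > 0"
  then obtain C where C: "\<And>i j. i \<le> j \<Longrightarrow> \<bar>x i j\<bar> * r ^ nat (j - i) \<le> C"
    using assms(1) unfolding rapidly_decreasing_def by blast
  have "\<bar>antireflect x i j\<bar> * r ^ nat (j - i) \<le> C" if "i \<le> j" for i j
    using C[of "- j" "- i"] that by (simp add: antireflect_def)
  thus "\<exists>C. \<forall>i j. i \<le> j \<longrightarrow> \<bar>antireflect x i j\<bar> * r ^ nat (j - i) \<le> C" by blast
qed

definition doubly_rapid :: "(int \<Rightarrow> int \<Rightarrow> real) \<Rightarrow> bool" where
  "doubly_rapid x \<longleftrightarrow> rapidly_decreasing x \<and> rapidly_decreasing (right_inv x)"

lemma doubly_rapid_antireflect:
  assumes "x \<in> unipotent n" "doubly_rapid x"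
  shows "doubly_rapid (antireflect x)"
  using assms(2) rapidly_decreasing_antireflect[of x] rapidly_decreasing_antireflect[of "right_inv x"]
  by (simp add: doubly_rapid_def antireflect_right_inv[OF assms(1)])

text \<open>
  Both the factor and its inverse are dominated by the product and its inverse.
\<close>

lemma doubly_rapid_factor:
  assumes a: "a \<in> unipotent_tnn n" and y: "y \<in> unipotent_tnn n" and x: "doubly_rapid (a \<star> y)"
  shows "doubly_rapid y"
proof -
  note nn = totally_nonneg_entry[OF unipotent_tnnD(2)]
  have "\<bar>y i j\<bar> \<le> \<bar>(a \<star> y) i j\<bar>" for i j
    using mprod_ge(2)[OF unipotent_tnnD(1)[OF a] unipotent_tnnD(1)[OF y], of i j] nn[OF a] nn[OF y, of i j] nn[OF y] by fastforce
  thus ?thesis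
    using x rapidly_decreasing_mono[of "a \<star> y" y] rapidly_decreasing_mono[of "right_inv (a \<star> y)" "right_inv y"]
      abs_right_inv_factor_le[OF a y]
    by (simp add: doubly_rapid_def)
qed

lemma two_sided_factorization:
  assumes x: "x \<in> unipotent_tnn n" and n: "n \<ge> 1" and rapid: "doubly_rapid x"
  obtains a y b where "a \<in> right_limit n" "antireflect b \<in> right_limit n" "b \<in> unipotent_tnn n"
    "y \<in> unipotent_tnn n" "x = a \<star> y \<star> b" "doubly_rapid y"
    "y = idm \<or> (\<forall>i j. i \<le> j \<longrightarrow> y i j > 0)
      \<and> (\<forall>i. ((\<lambda>j. y i j / y (i + 1) j) \<longlongrightarrow> 0) at_top)
      \<and> (\<forall>i. ((\<lambda>j. y j (i + 1) / y j i) \<longlongrightarrow> 0) at_bot)"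
proof -
  obtain a x1 where a: "a \<in> right_limit n" and x1: "x1 \<in> unipotent_tnn n" and xa: "x = a \<star> x1"
    and prime1: "left_prime n x1"
    by (rule maximal_left_factor[OF x]) blast
  note au = unipotent_tnnD(1)[OF right_limit_unipotent_tnn[OF a]]
  have rapid1: "doubly_rapid x1"
    using doubly_rapid_factor[OF right_limit_unipotent_tnn[OF a] x1] rapid xa by simp
  obtain b' y' where b': "b' \<in> right_limit n" and y': "y' \<in> unipotent_tnn n"
    and x1': "antireflect x1 = b' \<star> y'" and prime': "left_prime n y'"
    by (rule maximal_left_factor[OF antireflect_unipotent_tnn[OF x1]]) blast
  define b where "b = antireflect b'"
  define y where "y = antireflect y'"
  note b't = right_limit_unipotent_tnn[OF b']
  have b: "b \<in> unipotent_tnn n" unfolding b_def by (rule antireflect_unipotent_tnn[OF b't])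
  have y: "y \<in> unipotent_tnn n" unfolding y_def by (rule antireflect_unipotent_tnn[OF y'])
  note bu = unipotent_tnnD(1)[OF b] and yu = unipotent_tnnD(1)[OF y]
  have x1_eq: "x1 = y \<star> b"
    using arg_cong[OF x1', of antireflect] by (simp add: antireflect_mprod y_def b_def)
  have x_eq: "x = a \<star> y \<star> b"
    unfolding xa x1_eq by (rule mprod_assoc[OF au yu bu, symmetric])
  have rapid': "doubly_rapid y'"
    using doubly_rapid_factor[OF b't y'] doubly_rapid_antireflect[OF unipotent_tnnD(1)[OF x1] rapid1] x1' by simp
  have rapid_y: "doubly_rapid y"
    unfolding y_def by (rule doubly_rapid_antireflect[OF unipotent_tnnD(1)[OF y'] rapid'])
  \<comment> \<open>Multiplication by \<open>b\<close> preserves total nonnegativity, so a left factor of \<open>y\<close> would be one of \<open>x1\<close>.\<close>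
  have prime_y: "left_prime n y"
    unfolding left_prime_def
  proof (intro allI impI notI)
    fix k and c :: real assume nc: "n \<ge> 2" "c > 0" and div: "gen n k (- c) \<star> y \<in> unipotent_tnn n"
    let ?z = "gen n k (- c) \<star> y"
    have "b' \<star> antireflect ?z \<in> unipotent_tnn n"
      by (rule right_limit_mprod_tnn[OF b' antireflect_unipotent_tnn[OF div]])
    hence "antireflect (b' \<star> antireflect ?z) \<in> unipotent_tnn n" by (rule antireflect_unipotent_tnn)
    hence "gen n k (- c) \<star> x1 \<in> unipotent_tnn n"
      unfolding x1_eq mprod_assoc[OF gen_unipotent yu bu, symmetric]
      by (simp add: antireflect_mprod[of b'] b_def)
    thus False using prime1 nc by (simp add: left_prime_def)
  qed
  have cases: "y = idm \<or> (\<forall>i j. i \<le> j \<longrightarrow> y i j > 0) \<and> (\<forall>i. ((\<lambda>j. y i j / y (i + 1) j) \<longlongrightarrow> 0) at_top)"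
    using left_prime_dichotomy[OF y n prime_y] rapid_y by (simp add: doubly_rapid_def)
  have cases': "y' = idm \<or> (\<forall>i. ((\<lambda>j. y' i j / y' (i + 1) j) \<longlongrightarrow> 0) at_top)"
    using left_prime_dichotomy[OF y' n prime'] rapid' by (auto simp: doubly_rapid_def)
  have mu: "((\<lambda>j. y j (i + 1) / y j i) \<longlongrightarrow> 0) at_bot" if "y \<noteq> idm" for i
  proof -
    have "y' \<noteq> idm" using that by (auto simp: y_def)
    hence "((\<lambda>j. y' (- i - 1) j / y' (- i - 1 + 1) j) \<longlongrightarrow> 0) at_top" using cases' by blast
    moreover have "filterlim uminus at_top (at_bot :: int filter)"
      unfolding filterlim_at_top eventually_at_bot_linorder
    proof
      fix Z :: int
      show "\<exists>N. \<forall>j\<le>N. Z \<le> - j" by (rule exI[of _ "- Z"]) auto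
    qed
    ultimately have "((\<lambda>j. y' (- i - 1) (- j) / y' (- i - 1 + 1) (- j)) \<longlongrightarrow> 0) at_bot"
      by (rule filterlim_compose)
    thus ?thesis by (simp add: y_def antireflect_def)
  qed
  show ?thesis
    by (rule that[OF a _ b y x_eq rapid_y]) (use b' cases mu in \<open>auto simp: b_def\<close>)
qed

section \<open>Foldings and unfoldings\<close>

lemma fls_times_nth_nonneg:
  fixes f g :: "'a :: comm_semiring_0 fls"
  assumes f: "\<And>k. k < 0 \<Longrightarrow> fls_nth f k = 0" and g: "\<And>k. k < 0 \<Longrightarrow> fls_nth g k = 0"
  shows "fls_nth (f * g) k = (\<Sum>q=0..k. fls_nth f q * fls_nth g (k - q))"
  unfolding fls_times_nth(2)
proof (rule sum.mono_neutral_left)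
  have "fls_subdegree f \<ge> 0" "fls_subdegree g \<ge> 0"
    by (auto intro!: fls_subdegree_ge0I f g)
  thus "{fls_subdegree f..k - fls_subdegree g} \<subseteq> {0..k}" by auto
  show "\<forall>q\<in>{0..k} - {fls_subdegree f..k - fls_subdegree g}. fls_nth f q * fls_nth g (k - q) = 0"
  proof
    fix q assume "q \<in> {0..k} - {fls_subdegree f..k - fls_subdegree g}"
    hence "q < fls_subdegree f \<or> k - q < fls_subdegree g" by auto
    thus "fls_nth f q * fls_nth g (k - q) = 0" by auto
  qed
qed simp

lemma fls_nth_folding_mat:
  assumes "x \<in> unipotent n" "i < n" "j < n"
  shows "fls_nth (index_mat (folding_mat n x) (i, j)) k = x (int i + 1) (int j + 1 + k * int n)"
proof -
  have "\<forall>k<0. x (int i + 1) (int j + 1 + k * int n) = 0"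
  proof (intro allI impI unipotentD(2)[OF assms(1)])
    fix k :: int assume "k < 0"
    hence "k * int n \<le> - 1 * int n" by (intro mult_right_mono) auto
    thus "int j + 1 + k * int n < int i + 1" using assms by linarith
  qed
  from nth_Abs_fls_lower_bound[OF this] show ?thesis using assms by (simp add: folding_mat_def)
qed

lemma folding_mat_carrier [simp]: "folding_mat n x \<in> carrier_mat n n"
  by (simp add: folding_mat_def)

text \<open>
  The coefficient of \<open>t^k\<close> in the sum over the inner index \<open>l\<close> is a sum over pairs \<open>(l, q)\<close>, where \<open>q\<close> is
  the exponent taken from the first factor. Writing the column index of the unfolding as
  \<open>L = l + 1 + q n\<close> turns it into the sum that defines \<open>mprod\<close>.
\<close>

lemma folding_mat_mprod:
  assumes x: "x \<in> unipotent n" and y: "y \<in> unipotent n"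
  shows "folding_mat n (x \<star> y) = folding_mat n x * folding_mat n y"
proof (rule eq_matI)
  fix i j assume "i < dim_row (folding_mat n x * folding_mat n y)" "j < dim_col (folding_mat n x * folding_mat n y)"
  hence ij: "i < n" "j < n" by (auto simp: folding_mat_def)
  have zero: "fls_nth (index_mat (folding_mat n z) (a, b)) k = 0" if "z \<in> unipotent n" "a < n" "b < n" "k < 0" for z a b k
  proof -
    have "k * int n \<le> - 1 * int n" using that by (intro mult_right_mono) auto
    thus ?thesis using that by (simp add: fls_nth_folding_mat unipotentD(2))
  qed
  show "index_mat (folding_mat n (x \<star> y)) (i, j) = index_mat (folding_mat n x * folding_mat n y) (i, j)"
  proof (rule fls_eqI)
    fix k :: int
    let ?f = "\<lambda>L. x (int i + 1) L * y L (int j + 1 + k * int n)"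
    have entry: "index_mat (folding_mat n x * folding_mat n y) (i, j)
        = (\<Sum>l<n. index_mat (folding_mat n x) (i, l) * index_mat (folding_mat n y) (l, j))"
      using ij by (simp add: folding_mat_def scalar_prod_def atLeast0LessThan)
    have "fls_nth (index_mat (folding_mat n x * folding_mat n y) (i, j)) k
        = (\<Sum>l<n. \<Sum>q=0..k. ?f (int l + 1 + q * int n))"
      unfolding entry fls_nth_sum
    proof (rule sum.cong)
      fix l assume l: "l \<in> {..<n}"
      have "fls_nth (index_mat (folding_mat n x) (i, l) * index_mat (folding_mat n y) (l, j)) k
          = (\<Sum>q=0..k. fls_nth (index_mat (folding_mat n x) (i, l)) q * fls_nth (index_mat (folding_mat n y) (l, j)) (k - q))"
        by (rule fls_times_nth_nonneg) (use zero x y ij l in auto)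
      also have "\<dots> = (\<Sum>q=0..k. ?f (int l + 1 + q * int n))"
      proof (rule sum.cong)
        fix q
        have "y (int l + 1) (int j + 1 + (k - q) * int n) = y (int l + 1 + q * int n) (int j + 1 + k * int n)"
          using unipotent_shift[OF y, of "int l + 1" q "int j + 1 + (k - q) * int n"] by (simp add: algebra_simps)
        thus "fls_nth (index_mat (folding_mat n x) (i, l)) q * fls_nth (index_mat (folding_mat n y) (l, j)) (k - q)
            = ?f (int l + 1 + q * int n)"
          using ij l x y by (simp add: fls_nth_folding_mat)
      qed simp
      finally show "fls_nth (index_mat (folding_mat n x) (i, l) * index_mat (folding_mat n y) (l, j)) k
          = (\<Sum>q=0..k. ?f (int l + 1 + q * int n))" .
    qed simp
    also have "\<dots> = (\<Sum>(l, q)\<in>{..<n} \<times> {0..k}. ?f (int l + 1 + q * int n))"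
      by (simp add: sum.cartesian_product)
    also have "\<dots> = (\<Sum>L=1..(k + 1) * int n. ?f L)"
    proof (rule sum.reindex_bij_witness[where j = "\<lambda>(l, q). int l + 1 + q * int n"
          and i = "\<lambda>L. (nat ((L - 1) mod int n), (L - 1) div int n)"])
      fix a assume a: "a \<in> {..<n} \<times> {0..k}"
      obtain l q where lq: "a = (l, q)" "l < n" "0 \<le> q" "q \<le> k" using a by auto
      show "(nat (((case a of (l, q) \<Rightarrow> int l + 1 + q * int n) - 1) mod int n), ((case a of (l, q) \<Rightarrow> int l + 1 + q * int n) - 1) div int n) = a"
        using lq by simp
      have "q * int n \<le> k * int n" by (rule mult_right_mono) (use lq in auto)
      moreover have "0 \<le> q * int n" using lq by simp
      moreover have "int l + 1 \<le> int n" using lq by simp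
      ultimately have "int l + 1 + q * int n \<le> int n + k * int n" "1 \<le> int l + 1 + q * int n" by linarith+
      thus "(case a of (l, q) \<Rightarrow> int l + 1 + q * int n) \<in> {1..(k + 1) * int n}"
        using lq by (simp add: algebra_simps)
    next
      fix L assume L: "L \<in> {1..(k + 1) * int n}"
      have n: "0 < int n" using ij by simp
      have dm: "(L - 1) div int n * int n + (L - 1) mod int n = L - 1" by simp
      show "(case (nat ((L - 1) mod int n), (L - 1) div int n) of (l, q) \<Rightarrow> int l + 1 + q * int n) = L"
        using n by simp
      have "L - 1 < (k + 1) * int n" using L by simp
      moreover have "(L - 1) div int n * int n \<le> L - 1"
        using dm pos_mod_sign[OF n, of "L - 1"] by linarith
      ultimately have "(L - 1) div int n * int n < (k + 1) * int n" by linarith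
      hence "(L - 1) div int n < k + 1" using n by (simp only: mult_less_cancel_right_pos)
      moreover have "0 \<le> (L - 1) div int n" using L n by (simp add: pos_imp_zdiv_nonneg_iff)
      moreover have "nat ((L - 1) mod int n) < n" using n by (simp add: nat_less_iff)
      ultimately show "(nat ((L - 1) mod int n), (L - 1) div int n) \<in> {..<n} \<times> {0..k}" by simp
    qed (auto split: prod.splits)
    also have "\<dots> = (x \<star> y) (int i + 1) (int j + 1 + k * int n)"
      by (rule mprod_extend[OF x y, symmetric]) (use ij in \<open>auto simp: algebra_simps\<close>)
    also have "\<dots> = fls_nth (index_mat (folding_mat n (x \<star> y)) (i, j)) k"
      by (rule fls_nth_folding_mat[OF mprod_unipotent[OF x y] ij, symmetric])
    finally show "fls_nth (index_mat (folding_mat n (x \<star> y)) (i, j)) k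
        = fls_nth (index_mat (folding_mat n x * folding_mat n y) (i, j)) k" by simp
  qed
qed (auto simp: folding_mat_def)

lemma unfolding_folding_unipotent:
  assumes "n \<ge> 1" "x \<in> unipotent n"
  shows "unfolding_mat n (folding_mat n x) = x"
  using unfolding_folding_mat[OF assms(1)] unipotentD[OF assms(2)] by metis

lemma unfolding_idm:
  assumes "n \<ge> 1"
  shows "unfolding_mat n (1\<^sub>m n) = idm"
proof (intro ext)
  fix i j :: int
  have lt: "nat ((u - 1) mod int n) < n" for u using assms by (simp add: nat_less_iff)
  have eq: "i = j \<longleftrightarrow> (i - 1) mod int n = (j - 1) mod int n \<and> (j - 1) div int n - (i - 1) div int n = 0"
  proof -
    have "i = j" if "(i - 1) mod int n = (j - 1) mod int n" "(j - 1) div int n = (i - 1) div int n"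
      using that mult_div_mod_eq[of "int n" "i - 1"] mult_div_mod_eq[of "int n" "j - 1"] by simp
    thus ?thesis by auto
  qed
  show "unfolding_mat n (1\<^sub>m n) i j = idm i j"
    using assms lt unfolding unfolding_mat_def idm_def eq by (auto simp: nat_eq_iff)
qed

lemma folding_idm:
  assumes "n \<ge> 1"
  shows "folding_mat n idm = 1\<^sub>m n"
  using folding_unfolding_mat[of "1\<^sub>m n" n] by (simp add: unfolding_idm[OF assms])

lemma folding_inverse:
  assumes "n \<ge> 1" "x \<in> unipotent n"
  shows "folding_mat n x * folding_mat n (right_inv x) = 1\<^sub>m n"
    and "folding_mat n (right_inv x) * folding_mat n x = 1\<^sub>m n"
  using folding_mat_mprod[OF assms(2) right_inv_unipotent[OF assms(2)]]
    folding_mat_mprod[OF right_inv_unipotent[OF assms(2)] assms(2)]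
  by (simp_all add: mprod_right_inv[OF assms(2)] mprod_left_inv[OF assms(2)] folding_idm[OF assms(1)])

text \<open>
  The folding of the inverse witnesses that the determinant is nonzero.
\<close>

lemma folding_loop_U:
  assumes n: "n \<ge> 1" and x: "x \<in> unipotent n"
  shows "folding_mat n x \<in> loop_U n"
proof -
  have "Determinant.det (folding_mat n x) * Determinant.det (folding_mat n (right_inv x)) = 1"
    using arg_cong[OF folding_inverse(1)[OF n x], of Determinant.det]
    by (simp add: det_mult[of _ n])
  hence "Determinant.det (folding_mat n x) \<noteq> 0" by auto
  thus ?thesis
    using unipotentD[OF x] by (auto simp: loop_U_def loop_GL_def unfolding_folding_unipotent[OF n x])
qed

lemma unfolding_unipotent:
  assumes "n \<ge> 1" "A \<in> loop_U n"
  shows "unfolding_mat n A \<in> unipotent n"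
  by (rule unipotentI) (use assms in \<open>auto simp: loop_U_def unfolding_mat_periodic\<close>)

lemma folding_unfolding_loop_U: "A \<in> loop_U n \<Longrightarrow> folding_mat n (unfolding_mat n A) = A"
  by (rule folding_unfolding_mat) (simp add: loop_U_def loop_GL_def)

lemma unfolding_mult:
  assumes "n \<ge> 1" "A \<in> loop_U n" "B \<in> loop_U n"
  shows "unfolding_mat n (A * B) = unfolding_mat n A \<star> unfolding_mat n B"
proof -
  note u = unfolding_unipotent[OF assms(1,2)] unfolding_unipotent[OF assms(1,3)]
  have "A * B = folding_mat n (unfolding_mat n A \<star> unfolding_mat n B)"
    using folding_mat_mprod[OF u] assms by (simp add: folding_unfolding_loop_U)
  thus ?thesis by (simp add: unfolding_folding_unipotent[OF assms(1) mprod_unipotent[OF u]])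
qed

lemma folding_loop_U_nonneg:
  assumes "n \<ge> 1" "x \<in> unipotent_tnn n"
  shows "folding_mat n x \<in> loop_U_nonneg n"
  using assms folding_loop_U[OF assms(1) unipotent_tnnD(1)[OF assms(2)]]
  by (simp add: loop_U_nonneg_def unfolding_folding_unipotent[OF assms(1) unipotent_tnnD(1)] unipotent_tnnD(2))

lemma unfolding_unipotent_tnn:
  assumes "n \<ge> 1" "A \<in> loop_U_nonneg n"
  shows "unfolding_mat n A \<in> unipotent_tnn n"
  using assms unfolding_unipotent[of n A] by (simp add: loop_U_nonneg_def unipotent_tnn_def)

lemma unfolding_chevalley:
  assumes "n \<ge> 1"
  shows "unfolding_mat n (chevalley n k a) = gen n k a"
proof -
  have "chevalley n k a = folding_mat n (gen n k a)"
    unfolding chevalley_def by (rule arg_cong[of _ _ "folding_mat n"]) (simp add: gen_def fun_eq_iff)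
  thus ?thesis by (simp add: unfolding_folding_unipotent[OF assms gen_unipotent])
qed

subsection \<open>Limit semigroups\<close>

text \<open>
  The unfolding carries every limit semigroup in the intersection that defines \<open>right_limit_L\<close> to a
  right-closed set.
\<close>

lemma folding_right_limit_L:
  assumes n: "n \<ge> 1" and a: "a \<in> right_limit n"
  shows "folding_mat n a \<in> right_limit_L n"
  unfolding right_limit_L_def
proof safe
  fix S assume S: "right_limit_semigroup n S" "S \<subseteq> loop_U_nonneg n" "insert (1\<^sub>m n) (chevalley_gens n) \<subseteq> S"
  have U: "S \<subseteq> loop_U n" and mult: "A \<in> S \<Longrightarrow> B \<in> S \<Longrightarrow> A * B \<in> S" for A B
    using S(1) by (auto simp: right_limit_semigroup_def U_subsemigroup_def)
  have lim: "A \<in> S" if "A \<in> loop_U n" "\<And>m. X m \<in> S" "converges_to n (right_partial_prod n X) A" for X A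
    using S(1) that by (auto simp: right_limit_semigroup_def)
  have chev: "chevalley n k c \<in> S" if "n \<ge> 2" "c \<ge> 0" for k c
    using S(3) that unfolding chevalley_gens_def by blast
  let ?G = "unfolding_mat n ` S"
  have tnn: "?G \<subseteq> unipotent_tnn n" using S(2) unfolding_unipotent_tnn[OF n] by auto
  have "right_closed n ?G"
    unfolding right_closed_def
  proof (intro conjI allI impI ballI)
    show "?G \<subseteq> unipotent n" using tnn unipotent_tnnD(1) by blast
    show "idm \<in> ?G" by (rule image_eqI[of _ _ "1\<^sub>m n"]) (use S(3) unfolding_idm[OF n] in auto)
    show "gen n k c \<in> ?G" if "n \<ge> 2" "c \<ge> 0" for k c
      by (rule image_eqI[of _ _ "chevalley n k c"])
        (use chev that unfolding_chevalley[OF n] in auto)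
    show "x \<star> y \<in> ?G" if xy: "x \<in> ?G" "y \<in> ?G" for x y
    proof -
      obtain A B where AB: "A \<in> S" "B \<in> S" "x = unfolding_mat n A" "y = unfolding_mat n B" using xy by blast
      have "x \<star> y = unfolding_mat n (A * B)" using unfolding_mult[OF n, of A B] U AB by (simp add: subset_iff)
      thus ?thesis using mult[OF AB(1,2)] by (rule image_eqI)
    qed
  next
    fix Z p
    assume Z: "\<forall>m. Z m \<in> ?G" and p: "p \<in> unipotent n" and conv: "\<forall>i j. (\<lambda>m. rprod Z m i j) \<longlonglongrightarrow> p i j"
    from Z have "\<forall>m. \<exists>A. A \<in> S \<and> Z m = unfolding_mat n A" by blast
    then obtain X where X: "\<And>m. X m \<in> S" "\<And>m. Z m = unfolding_mat n (X m)" by metis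
    have "right_partial_prod n X m \<in> S \<and> unfolding_mat n (right_partial_prod n X m) = rprod Z m" for m
    proof (induction m)
      case 0
      thus ?case using S(3) by (simp add: unfolding_idm[OF n])
    next
      case (Suc m)
      thus ?case using mult[of "right_partial_prod n X m" "X m"] unfolding_mult[OF n, of "right_partial_prod n X m" "X m"] X[of m] U
        by (simp add: subset_iff)
    qed
    hence "converges_to n (right_partial_prod n X) (folding_mat n p)"
      using conv by (simp add: converges_to_def unfolding_folding_unipotent[OF n p])
    hence "folding_mat n p \<in> S" using lim[OF folding_loop_U[OF n p], of X] X by blast
    thus "p \<in> ?G" by (rule image_eqI[rotated]) (simp add: unfolding_folding_unipotent[OF n p])
  qed
  hence "a \<in> ?G" using a tnn by (auto simp: right_limit_def)
  thus "folding_mat n a \<in> S" using folding_unfolding_loop_U U by auto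
qed

text \<open>
  The same transfer, composed with the reflection that turns left products into right ones.
\<close>

lemma folding_left_limit_L:
  assumes n: "n \<ge> 1" and a: "antireflect a \<in> right_limit n"
  shows "folding_mat n a \<in> left_limit_L n"
  unfolding left_limit_L_def
proof safe
  fix S assume S: "left_limit_semigroup n S" "S \<subseteq> loop_U_nonneg n" "insert (1\<^sub>m n) (chevalley_gens n) \<subseteq> S"
  have U: "S \<subseteq> loop_U n" and mult: "A \<in> S \<Longrightarrow> B \<in> S \<Longrightarrow> A * B \<in> S" for A B
    using S(1) by (auto simp: left_limit_semigroup_def U_subsemigroup_def)
  have lim: "A \<in> S" if "A \<in> loop_U n" "\<And>m. X m \<in> S" "converges_to n (left_partial_prod n X) A" for X A
    using S(1) that by (auto simp: left_limit_semigroup_def)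
  have chev: "chevalley n k c \<in> S" if "n \<ge> 2" "c \<ge> 0" for k c
    using S(3) that unfolding chevalley_gens_def by blast
  define refl where "refl = (\<lambda>A. antireflect (unfolding_mat n A))"
  let ?G = "refl ` S"
  have tnn: "?G \<subseteq> unipotent_tnn n"
    using S(2) antireflect_unipotent_tnn[OF unfolding_unipotent_tnn[OF n]] by (auto simp: refl_def)
  have "right_closed n ?G"
    unfolding right_closed_def
  proof (intro conjI allI impI ballI)
    show "?G \<subseteq> unipotent n" using tnn unipotent_tnnD(1) by blast
    show "idm \<in> ?G" by (rule image_eqI[of _ _ "1\<^sub>m n"]) (use S(3) unfolding_idm[OF n] in \<open>auto simp: refl_def\<close>)
    show "gen n k c \<in> ?G" if "n \<ge> 2" "c \<ge> 0" for k c
      by (rule image_eqI[of _ _ "chevalley n (- k - 1) c"])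
        (use chev that unfolding_chevalley[OF n] in \<open>auto simp: refl_def antireflect_gen\<close>)
    show "x \<star> y \<in> ?G" if xy: "x \<in> ?G" "y \<in> ?G" for x y
    proof -
      obtain A B where AB: "A \<in> S" "B \<in> S" "x = refl A" "y = refl B" using xy by blast
      have "x \<star> y = refl (B * A)"
        using unfolding_mult[OF n, of B A] U AB by (simp add: subset_iff refl_def antireflect_mprod)
      thus ?thesis using mult[OF AB(2,1)] by (rule image_eqI)
    qed
  next
    fix Z p
    assume Z: "\<forall>m. Z m \<in> ?G" and p: "p \<in> unipotent n" and conv: "\<forall>i j. (\<lambda>m. rprod Z m i j) \<longlonglongrightarrow> p i j"
    from Z have "\<forall>m. \<exists>A. A \<in> S \<and> Z m = refl A" by blast
    then obtain X where X: "\<And>m. X m \<in> S" "\<And>m. Z m = refl (X m)" by metis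
    note p' = antireflect_unipotent[OF p]
    have part: "left_partial_prod n X m \<in> S \<and> unfolding_mat n (left_partial_prod n X m) = antireflect (rprod Z m)" for m
    proof (induction m)
      case 0
      thus ?case using S(3) by (simp add: unfolding_idm[OF n])
    next
      case (Suc m)
      thus ?case using mult[of "X m" "left_partial_prod n X m"] unfolding_mult[OF n, of "X m" "left_partial_prod n X m"] X[of m] U
        by (simp add: subset_iff refl_def antireflect_mprod)
    qed
    have "converges_to n (left_partial_prod n X) (folding_mat n (antireflect p))"
      using conv part by (simp add: converges_to_def unfolding_folding_unipotent[OF n p'] antireflect_def)
    hence "folding_mat n (antireflect p) \<in> S" using lim[OF folding_loop_U[OF n p'], of X] X by blast
    thus "p \<in> ?G" by (rule image_eqI[rotated]) (simp add: refl_def unfolding_folding_unipotent[OF n p'])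
  qed
  hence "antireflect a \<in> ?G" using a tnn by (auto simp: right_limit_def)
  then obtain A where A: "A \<in> S" "antireflect a = refl A" by blast
  hence "a = unfolding_mat n A" by (metis antireflect_antireflect refl_def)
  thus "folding_mat n a \<in> S" using folding_unfolding_loop_U U A(1) by auto
qed

subsection \<open>Entire foldings\<close>

text \<open>
  Both sides say that the power series has infinite radius of convergence; the bound for the radius
  \<open>2 r\<close> gives summability for \<open>r\<close>.
\<close>

lemma entire_fls_iff:
  assumes neg: "\<And>k. k < 0 \<Longrightarrow> fls_nth a k = 0"
  shows "entire_fls a \<longleftrightarrow> (\<forall>r>0. \<exists>C. \<forall>k::nat. \<bar>fls_nth a (int k)\<bar> * r ^ k \<le> C)"
proof -
  define G where "G = Abs_fps (\<lambda>k. complex_of_real (fls_nth a (int k)))"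
  have G: "Abs_fls (\<lambda>k. complex_of_real (fls_nth a k)) = fps_to_fls G"
  proof (rule fls_eqI)
    fix k
    have "fls_nth (Abs_fls (\<lambda>k. complex_of_real (fls_nth a k))) k = complex_of_real (fls_nth a k)"
      by (rule nth_Abs_fls_lower_bound[of 0]) (use neg in auto)
    thus "fls_nth (Abs_fls (\<lambda>k. complex_of_real (fls_nth a k))) k = fls_nth (fps_to_fls G) k"
      using neg[of k] by (auto simp: G_def)
  qed
  show ?thesis
  proof
    assume "entire_fls a"
    then obtain f where f: "f holomorphic_on UNIV" "f has_laurent_expansion fps_to_fls G"
      by (auto simp: entire_fls_def G)
    have "f has_laurent_expansion fps_to_fls (fps_expansion f 0)"
      by (rule has_laurent_expansion_fps[OF has_fps_expansion_fps_expansion[OF open_UNIV _ f(1)]]) simp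
    hence "fps_to_fls G = fps_to_fls (fps_expansion f 0)"
      using has_laurent_expansion_unique f(2) by blast
    hence Geq: "G = fps_expansion f 0" by (rule fps_to_fls_eq_imp_fps_eq)
    have radius: "fps_conv_radius G = \<infinity>"
      unfolding Geq using conv_radius_fps_expansion[of f 0 \<infinity>] f(1) by simp
    show "\<forall>r>0. \<exists>C. \<forall>k::nat. \<bar>fls_nth a (int k)\<bar> * r ^ k \<le> C"
    proof (intro allI impI)
      fix r :: real assume r: "r > 0"
      have "summable (\<lambda>k. fps_nth G k * complex_of_real r ^ k)"
        by (rule summable_fps) (simp add: radius)
      hence "bounded (range (\<lambda>k. fps_nth G k * complex_of_real r ^ k))"
        by (rule summable_imp_bounded)
      then obtain C where C: "\<And>k. norm (fps_nth G k * complex_of_real r ^ k) \<le> C"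
        by (auto simp: bounded_iff)
      have "\<bar>fls_nth a (int k)\<bar> * r ^ k \<le> C" for k
        using C[of k] r by (simp add: G_def norm_mult norm_power)
      thus "\<exists>C. \<forall>k::nat. \<bar>fls_nth a (int k)\<bar> * r ^ k \<le> C" by blast
    qed
  next
    assume bound: "\<forall>r>0. \<exists>C. \<forall>k::nat. \<bar>fls_nth a (int k)\<bar> * r ^ k \<le> C"
    have "\<infinity> \<le> fps_conv_radius G"
      unfolding fps_conv_radius_def
    proof (rule conv_radius_geI_ex')
      fix r :: real assume r: "0 < r"
      obtain C where C: "\<And>k. \<bar>fls_nth a (int k)\<bar> * (2 * r) ^ k \<le> C"
        using bound[rule_format, of "2 * r"] r by auto
      show "summable (\<lambda>k. fps_nth G k * complex_of_real r ^ k)"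
      proof (rule summable_comparison_test'[where N = 0])
        show "summable (\<lambda>k. C * (1 / 2 :: real) ^ k)" by (intro summable_mult summable_geometric) simp
        fix k
        have "\<bar>fls_nth a (int k)\<bar> * (2 * r) ^ k \<le> C" by (rule C)
        thus "norm (fps_nth G k * complex_of_real r ^ k) \<le> C * (1 / 2) ^ k"
          using r by (simp add: G_def norm_mult norm_power power_mult_distrib field_simps)
      qed
    qed
    hence radius: "fps_conv_radius G = \<infinity>" by simp
    have "eval_fps G has_laurent_expansion fps_to_fls G"
      by (rule has_laurent_expansion_fps[OF eval_fps_has_fps_expansion]) (simp add: radius)
    moreover have "eval_fps G holomorphic_on UNIV"
      by (rule holomorphic_on_eval_fps) (simp add: radius)
    ultimately show "entire_fls a" by (auto simp: entire_fls_def G)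
  qed
qed

text \<open>
  The coefficient of \<open>t^k\<close> of an entry lies on a diagonal between \<open>k n - n\<close> and \<open>k n + n\<close>, so bounds for
  a radius \<open>r\<close> on one side follow from bounds for \<open>max 1 r\<close> or its \<open>n\<close>-th power on the other side.
\<close>

lemma entire_folding_iff:
  assumes n: "n \<ge> 1" and x: "x \<in> unipotent n"
  shows "entire_mat n (folding_mat n x) \<longleftrightarrow> rapidly_decreasing x"
proof -
  have neg: "fls_nth (index_mat (folding_mat n x) (i, j)) k = 0" if "i < n" "j < n" "k < 0" for i j k
  proof -
    have "k * int n \<le> - 1 * int n" using that by (intro mult_right_mono) auto
    thus ?thesis using that x by (simp add: fls_nth_folding_mat unipotentD(2))
  qed
  have iff: "entire_mat n (folding_mat n x) \<longleftrightarrow>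
      (\<forall>i<n. \<forall>j<n. \<forall>r>0. \<exists>C. \<forall>k::nat. \<bar>x (int i + 1) (int j + 1 + int k * int n)\<bar> * r ^ k \<le> C)"
    unfolding entire_mat_def using entire_fls_iff[OF neg] by (simp add: fls_nth_folding_mat[OF x])
  show ?thesis
  proof
    assume entire: "entire_mat n (folding_mat n x)"
    show "rapidly_decreasing x"
      unfolding rapidly_decreasing_def
    proof (intro allI impI)
      fix r :: real assume "r > 0"
      define R where "R = max 1 r"
      have R: "R \<ge> 1" "r \<le> R" by (auto simp: R_def)
      hence Rn: "R ^ n > 0" by simp
      have "\<forall>i\<in>{..<n}. \<forall>j\<in>{..<n}. \<exists>C. \<forall>k::nat. \<bar>x (int i + 1) (int j + 1 + int k * int n)\<bar> * (R ^ n) ^ k \<le> C"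
        using entire[unfolded iff, rule_format, OF _ _ Rn] by simp
      then obtain C where C: "\<And>i j k. i < n \<Longrightarrow> j < n \<Longrightarrow>
          \<bar>x (int i + 1) (int j + 1 + int k * int n)\<bar> * (R ^ n) ^ k \<le> C i j"
        unfolding lessThan_iff Ball_def by metis
      define D where "D = (\<Sum>i<n. \<Sum>j<n. \<bar>C i j\<bar>)"
      have D: "C i j \<le> D" if "i < n" "j < n" for i j
      proof -
        have "\<bar>C i j\<bar> \<le> (\<Sum>j<n. \<bar>C i j\<bar>)"
          by (rule member_le_sum) (use that in auto)
        hence "C i j \<le> (\<Sum>j<n. \<bar>C i j\<bar>)" by simp
        also have "\<dots> \<le> D"
          unfolding D_def by (rule member_le_sum) (use that in \<open>auto intro: sum_nonneg\<close>)
        finally show ?thesis .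
      qed
      have "\<bar>x i j\<bar> * r ^ nat (j - i) \<le> R ^ n * D" if "i \<le> j" for i j
      proof -
        obtain u v where uv: "0 \<le> u" "u < int n" "v - u = (j - 1) - (i - 1)" "x (u + 1) (v + 1) = x i j"
        proof -
          have "x ((i - 1) mod int n + 1) ((j - 1) - (i - 1) div int n * int n + 1) = x i j"
            using unipotent_shift[OF x, of "(i - 1) mod int n + 1" "(i - 1) div int n" "(j - 1) - (i - 1) div int n * int n + 1"]
            by (simp add: algebra_simps)
          moreover have "((j - 1) - (i - 1) div int n * int n) - (i - 1) mod int n = (j - 1) - (i - 1)"
            using div_mult_mod_eq[of "i - 1" "int n"] by linarith
          ultimately show ?thesis using that[of "(i - 1) mod int n" "(j - 1) - (i - 1) div int n * int n"] n by simp
        qed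
        define k where "k = nat (v div int n)"
        have v0: "v \<ge> 0" using uv that by simp
        have vdiv: "v = int (nat (v mod int n)) + int k * int n"
          using v0 n by (simp add: k_def pos_imp_zdiv_nonneg_iff)
        have lt: "nat u < n" "nat (v mod int n) < n" using uv n by (auto simp: nat_less_iff)
        have exp: "nat (j - i) \<le> n + n * k"
        proof -
          have "j - i \<le> v" using uv by simp
          also have "v \<le> int n + int k * int n" using vdiv lt by linarith
          finally show ?thesis by (simp add: nat_le_iff algebra_simps)
        qed
        have "x i j = x (int (nat u) + 1) (int (nat (v mod int n)) + 1 + int k * int n)"
          using uv vdiv by (simp add: algebra_simps)
        hence 1: "\<bar>x i j\<bar> * (R ^ n) ^ k \<le> D"
          using C[OF lt, of k] D[OF lt] by simp
        have "r ^ nat (j - i) \<le> R ^ nat (j - i)" using R \<open>r > 0\<close> by (intro power_mono) auto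
        also have "\<dots> \<le> R ^ (n + n * k)" using R exp by (intro power_increasing) auto
        also have "\<dots> = R ^ n * (R ^ n) ^ k" by (simp add: power_add power_mult)
        finally have "\<bar>x i j\<bar> * r ^ nat (j - i) \<le> \<bar>x i j\<bar> * (R ^ n * (R ^ n) ^ k)" by (intro mult_left_mono) auto
        also have "\<dots> = R ^ n * (\<bar>x i j\<bar> * (R ^ n) ^ k)" by simp
        also have "\<dots> \<le> R ^ n * D" using 1 Rn by (intro mult_left_mono) auto
        finally show ?thesis .
      qed
      thus "\<exists>C. \<forall>i j. i \<le> j \<longrightarrow> \<bar>x i j\<bar> * r ^ nat (j - i) \<le> C" by blast
    qed
  next
    assume rapid: "rapidly_decreasing x"
    show "entire_mat n (folding_mat n x)"
      unfolding iff
    proof (intro allI impI)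
      fix i j and r :: real assume ij: "i < n" "j < n" and "r > 0"
      define R where "R = max 1 r"
      have R: "R \<ge> 1" "r \<le> R" by (auto simp: R_def)
      hence "R > 0" by simp
      then obtain C where C: "\<And>i j. i \<le> j \<Longrightarrow> \<bar>x i j\<bar> * R ^ nat (j - i) \<le> C"
        using rapid unfolding rapidly_decreasing_def by blast
      have C0: "C \<ge> 0" using C[of 0 0] by (simp add: unipotentD(3)[OF x])
      have "\<bar>x (int i + 1) (int j + 1 + int k * int n)\<bar> * r ^ k \<le> R ^ n * C" for k
      proof (cases "i \<le> j + k * n")
        case False
        hence "int j + int k * int n < int i" by (metis not_le of_nat_add of_nat_less_iff of_nat_mult)
        hence "x (int i + 1) (int j + 1 + int k * int n) = 0" by (intro unipotentD(2)[OF x]) simp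
        thus ?thesis using C0 R by simp
      next
        case True
        let ?e = "nat (int j + 1 + int k * int n - (int i + 1))"
        have le: "int i \<le> int j + int k * int n"
          using True by (metis of_nat_add of_nat_le_iff of_nat_mult)
        have "int k * 1 \<le> int k * int n" using n by (intro mult_left_mono) auto
        hence exp: "k \<le> n + ?e" using ij le by linarith
        have "r ^ k \<le> R ^ k" using R \<open>r > 0\<close> by (intro power_mono) auto
        also have "\<dots> \<le> R ^ (n + ?e)" using R exp by (intro power_increasing) auto
        also have "\<dots> = R ^ n * R ^ ?e" by (simp add: power_add)
        finally have "\<bar>x (int i + 1) (int j + 1 + int k * int n)\<bar> * r ^ k
            \<le> \<bar>x (int i + 1) (int j + 1 + int k * int n)\<bar> * (R ^ n * R ^ ?e)" by (intro mult_left_mono) auto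
        also have "\<dots> = R ^ n * (\<bar>x (int i + 1) (int j + 1 + int k * int n)\<bar> * R ^ ?e)" by simp
        also have "\<dots> \<le> R ^ n * C" using C[of "int i + 1" "int j + 1 + int k * int n"] le R
          by (intro mult_left_mono) auto
        finally show ?thesis .
      qed
      thus "\<exists>C. \<forall>k::nat. \<bar>x (int i + 1) (int j + 1 + int k * int n)\<bar> * r ^ k \<le> C" by blast
    qed
  qed
qed

lemma doubly_entire_folding_iff:
  assumes n: "n \<ge> 1" and x: "x \<in> unipotent n"
  shows "doubly_entire n (folding_mat n x) \<longleftrightarrow> doubly_rapid x"
proof -
  let ?A = "folding_mat n x" and ?B = "folding_mat n (right_inv x)"
  have unique: "B = ?B" if "B \<in> carrier_mat n n" "?A * B = 1\<^sub>m n" for B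
  proof -
    have "B = (?B * ?A) * B" using that folding_inverse(2)[OF n x] by simp
    also have "\<dots> = ?B * (?A * B)" by (rule assoc_mult_mat[of _ n n _ n _ n]) (use that in auto)
    also have "\<dots> = ?B" using that(2) right_mult_one_mat[of ?B n n] by simp
    finally show ?thesis .
  qed
  have dims: "dim_row ?A = n" "dim_row ?B = n" by (auto simp: folding_mat_def)
  have "(\<exists>B \<in> carrier_mat n n. inverts_mat ?A B \<and> inverts_mat B ?A \<and> entire_mat n B) \<longleftrightarrow> entire_mat n ?B"
  proof
    assume "\<exists>B \<in> carrier_mat n n. inverts_mat ?A B \<and> inverts_mat B ?A \<and> entire_mat n B"
    then obtain B where "B \<in> carrier_mat n n" "?A * B = 1\<^sub>m n" "entire_mat n B"
      by (auto simp: inverts_mat_def dims)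
    thus "entire_mat n ?B" using unique by blast
  next
    assume "entire_mat n ?B"
    thus "\<exists>B \<in> carrier_mat n n. inverts_mat ?A B \<and> inverts_mat B ?A \<and> entire_mat n B"
      using folding_inverse[OF n x] by (intro bexI[of _ ?B]) (auto simp: inverts_mat_def dims)
  qed
  thus ?thesis
    by (simp add: doubly_entire_def doubly_rapid_def entire_folding_iff[OF n x] entire_folding_iff[OF n right_inv_unipotent[OF x]])
qed

theorem theorem8p8:
  fixes n :: nat and X :: "real fls mat"
  assumes "n \<ge> 1"
    and "X \<in> loop_U_nonneg n"
    and "doubly_entire n X"
    and "infinitely_supported n X"
  shows "\<exists>A \<in> right_limit_L n. \<exists>B \<in> left_limit_L n. \<exists>Y \<in> loop_U_nonneg n.
           regular_mat n Y \<and> X = A * Y * B"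
proof -
  note n = assms(1)
  define x where "x = unfolding_mat n X"
  have x: "x \<in> unipotent_tnn n" unfolding x_def by (rule unfolding_unipotent_tnn[OF n assms(2)])
  have X: "X = folding_mat n x"
    using folding_unfolding_loop_U assms(2) by (simp add: x_def loop_U_nonneg_def)
  have rapid_x: "doubly_rapid x"
    using assms(3) doubly_entire_folding_iff[OF n unipotent_tnnD(1)[OF x]] X by simp
  obtain a y b where a: "a \<in> right_limit n" and b: "antireflect b \<in> right_limit n" "b \<in> unipotent_tnn n"
    and y: "y \<in> unipotent_tnn n" and xayb: "x = a \<star> y \<star> b" and rapid: "doubly_rapid y"
    and cases: "y = idm \<or> (\<forall>i j. i \<le> j \<longrightarrow> y i j > 0)
      \<and> (\<forall>i. ((\<lambda>j. y i j / y (i + 1) j) \<longlongrightarrow> 0) at_top)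
      \<and> (\<forall>i. ((\<lambda>j. y j (i + 1) / y j i) \<longlongrightarrow> 0) at_bot)"
    by (rule two_sided_factorization[OF x n rapid_x]) blast
  note au = unipotent_tnnD(1)[OF right_limit_unipotent_tnn[OF a]] and yu = unipotent_tnnD(1)[OF y]
    and bu = unipotent_tnnD(1)[OF b(2)]
  let ?Y = "folding_mat n y"
  have Y: "?Y \<in> loop_U_nonneg n" by (rule folding_loop_U_nonneg[OF n y])
  have "X = folding_mat n a * ?Y * folding_mat n b"
    unfolding X xayb using au yu bu by (simp add: folding_mat_mprod mprod_unipotent)
  moreover have "regular_mat n ?Y"
  proof (cases "y = idm")
    case True
    thus ?thesis using Y folding_idm[OF n] by (simp add: regular_mat_def)
  next
    case False
    have "infinitely_supported n ?Y"
    proof -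
      have "{0..} \<subseteq> {d::int. \<exists>i. y i (i + d) \<noteq> 0}"
      proof
        fix d :: int assume "d \<in> {0..}"
        hence "y 0 (0 + d) > 0" using cases False by simp
        hence "y 0 (0 + d) \<noteq> 0" by simp
        thus "d \<in> {d. \<exists>i. y i (i + d) \<noteq> 0}" unfolding mem_Collect_eq ..
      qed
      hence "infinite {d::int. \<exists>i. y i (i + d) \<noteq> 0}"
        by (rule infinite_super) (rule infinite_Ici)
      thus ?thesis
        by (simp add: infinitely_supported_def finitely_supported_def unfolding_folding_unipotent[OF n yu])
    qed
    thus ?thesis using Y False cases rapid
      by (simp add: regular_mat_def doubly_entire_folding_iff[OF n yu] has_epsilon_def has_mu_def
          unfolding_folding_unipotent[OF n yu])
  qed
  ultimately show ?thesis
    by (intro bexI[of _ "folding_mat n a"] bexI[of _ "folding_mat n b"] bexI[of _ ?Y] conjI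
        folding_right_limit_L[OF n a] folding_left_limit_L[OF n b(1)] Y)
qed

end
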